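(* Problem $(GLQ)_T$ satisfies the exponential turnpike property at some steady state $(x_e,u_e)$ if and only if problem $(LQ)_T$ satisfies the exponential turnpike property at $(0,0)$.
   Context: Setting. $\mathcal H,\mathcal U,\mathcal Y$ are complex Hilbert spaces. $A:D(A)\to\mathcal H$ generates a strongly continuous semigroup $\mathcal T=(\mathcal T_t)_{t\ge0}$ on $\mathcal H$; $B\in\mathcal L(\mathcal U,\mathcal H)$, $C\in\mathcal L(\mathcal H,\mathcal Y)$, $K\in\mathcal L(\mathcal U)$, $z\in\mathcal H$, $v\in\mathcal U$. $K$ is coercive: there is $m>0$ with $\langle K^*Ku,u\rangle\ge m\|u\|^2$ for all $u\in\mathcal U$. The running cost is $$\ell(x,u)=\|Cx\|^2+\|Ku\|^2+2\operatorname{Re}\langle z,x\rangle+2\operatorname{Re}\langle v,u\rangle .$$ Problem $(GLQ)_T$: for horizon $T>0$ and initial state $x_0\in\mathcal H$, minimize $J_T(x_0,u)=\int_0^T\ell(x(t),u(t))\,dt$ over $u\in L^2(0,T;\mathcal U)$, where $x$ is the mild solution of $\dot x=Ax+Bu$, $x(0)=x_0$. The optimal pair exists and is unique; it is denoted $(x_T^*(\cdot,x_0),u_T^*(\cdot,x_0))$. Problem $(LQ)_T$ is the same problem, with the same $A,B,C,K$, but with $z=0$ and $v=0$. Steady state: a pair $(x_e,u_e)\in D(A)\times\mathcal U$ with $Ax_e+Bu_e=0$. Exponential turnpike property (of $(GLQ)_T$ or $(LQ)_T$) at a steady state $(x_e,u_e)$: for every bounded neighborhood $\mathcal N$ of $x_e$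 in $\mathcal H$ there are positive constants $M_{\mathcal N},k$ such that for all $x_0\in\mathcal N$ and all $T>0$, the optimal pair of the problem satisfies $\|x_T^*(t,x_0)-x_e\|+\|u_T^*(t,x_0)-u_e\|\le M_{\mathcal N}(e^{-kt}+e^{-k(T-t)})$ for all $t\in[0,T]$. *)

theory Defs
  imports "HOL-Analysis.Analysis"
begin

text \<open>
  Complex Hilbert spaces, not assumed separable. The real inner product inherited from
  \<^class>\<open>real_inner\<close> (which determines norm and topology) is the real part of the complex one.
\<close>

class chilbert_space = real_inner + complete_space +
  fixes scaleC :: "complex \<Rightarrow> 'a \<Rightarrow> 'a"  (infixr "*\<^sub>C" 75)
    and cinner :: "'a \<Rightarrow> 'a \<Rightarrow> complex"
  assumes scaleC_add_right: "c *\<^sub>C (x + y) = c *\<^sub>C x + c *\<^sub>C y"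
    and scaleC_add_left: "(c + d) *\<^sub>C x = c *\<^sub>C x + d *\<^sub>C x"
    and scaleC_scaleC: "c *\<^sub>C (d *\<^sub>C x) = (c * d) *\<^sub>C x"
    and scaleR_scaleC: "r *\<^sub>R x = complex_of_real r *\<^sub>C x"
    and cinner_commute: "cinner x y = cnj (cinner y x)"
    and cinner_add_left: "cinner (x + y) w = cinner x w + cinner y w"
    and cinner_scaleC_left: "cinner (c *\<^sub>C x) y = c * cinner x y"
    and inner_eq_Re_cinner: "inner x y = Re (cinner x y)"

definition bounded_clinear :: "('a::chilbert_space \<Rightarrow> 'b::chilbert_space) \<Rightarrow> bool" where
  "bounded_clinear F \<longleftrightarrow> bounded_linear F \<and> (\<forall>c x. F (c *\<^sub>C x) = c *\<^sub>C F x)"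

definition cadjoint :: "('a::chilbert_space \<Rightarrow> 'b::chilbert_space) \<Rightarrow> 'b \<Rightarrow> 'a" where
  "cadjoint F = (THE G. \<forall>x y. cinner (F x) y = cinner x (G y))"

text \<open>
  The form \<open>\<langle>K\<^sup>* K u, u\<rangle>\<close> is real-valued, so taking its real part loses nothing.
\<close>

definition coercive :: "('a::chilbert_space \<Rightarrow> 'a) \<Rightarrow> bool" where
  "coercive K \<longleftrightarrow> (\<exists>m>0. \<forall>u. Re (cinner (cadjoint K (K u)) u) \<ge> m * (norm u)\<^sup>2)"

definition C0_semigroup :: "(real \<Rightarrow> 'h::chilbert_space \<Rightarrow> 'h) \<Rightarrow> bool" where
  "C0_semigroup S \<longleftrightarrow>
     (\<forall>t\<ge>0. bounded_clinear (S t)) \<and>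
     (\<forall>x. S 0 x = x) \<and>
     (\<forall>s\<ge>0. \<forall>t\<ge>0. \<forall>x. S (s + t) x = S s (S t x)) \<and>
     (\<forall>x. ((\<lambda>t. S t x) \<longlongrightarrow> x) (at_right 0))"

text \<open>
  The unbounded operator \<open>A\<close> is a total function together with its domain \<open>D\<close>; its values
  outside \<open>D\<close> are irrelevant.
\<close>

definition generates ::
    "'h set \<Rightarrow> ('h \<Rightarrow> 'h) \<Rightarrow> (real \<Rightarrow> 'h::chilbert_space \<Rightarrow> 'h) \<Rightarrow> bool" where
  "generates D A S \<longleftrightarrow>
     C0_semigroup S \<and>
     D = {x. \<exists>y. ((\<lambda>t. (S t x - x) /\<^sub>R t) \<longlongrightarrow> y) (at_right 0)} \<and>
     (\<forall>x\<in>D. ((\<lambda>t. (S t x - x) /\<^sub>R t) \<longlongrightarrow> A x) (at_right 0))"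

text \<open>
  Strong (Bochner) measurability: Borel measurability would not suffice for non-separable
  value spaces.
\<close>

definition strongly_measurable :: "'a measure \<Rightarrow> ('a \<Rightarrow> 'b::real_normed_vector) \<Rightarrow> bool" where
  "strongly_measurable M f \<longleftrightarrow>
     (\<exists>s :: nat \<Rightarrow> 'a \<Rightarrow> 'b. (\<forall>i. simple_function M (s i)) \<and>
        (AE t in M. (\<lambda>i. s i t) \<longlonglongrightarrow> f t))"

text \<open>Representatives of the elements of \<open>L\<^sup>2(0,T;U)\<close>; values outside \<open>[0,T]\<close> are irrelevant.\<close>

definition L2_controls :: "real \<Rightarrow> (real \<Rightarrow> 'u::chilbert_space) set" where
  "L2_controls T =
     {u. strongly_measurable (lebesgue_on {0..T}) u \<and>
         integrable (lebesgue_on {0..T}) (\<lambda>t. (norm (u t))\<^sup>2)}"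

text \<open>
  The mild solution of \<open>x' = A x + B u\<close>, \<open>x(0) = x0\<close>. The library's Bochner integral is confined
  to second countable value spaces, so the integral is the Henstock--Kurzweil one, which exists and
  agrees with the Bochner integral for every Bochner integrable integrand, in particular whenever
  \<open>u\<close> is in \<open>L\<^sup>2\<close>.
\<close>

definition mild_solution ::
    "(real \<Rightarrow> 'h::chilbert_space \<Rightarrow> 'h) \<Rightarrow> ('u::chilbert_space \<Rightarrow> 'h) \<Rightarrow> 'h \<Rightarrow> (real \<Rightarrow> 'u)
       \<Rightarrow> real \<Rightarrow> 'h" where
  "mild_solution S B x0 u t = S t x0 + integral {0..t} (\<lambda>s. S (t - s) (B (u s)))"

definition running_cost ::
    "('h::chilbert_space \<Rightarrow> 'y::chilbert_space) \<Rightarrow> ('u::chilbert_space \<Rightarrow> 'u) \<Rightarrow> 'h \<Rightarrow> 'u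
       \<Rightarrow> 'h \<Rightarrow> 'u \<Rightarrow> real" where
  "running_cost C K z v x u =
     (norm (C x))\<^sup>2 + (norm (K u))\<^sup>2 + 2 * Re (cinner z x) + 2 * Re (cinner v u)"

definition cost ::
    "(real \<Rightarrow> 'h::chilbert_space \<Rightarrow> 'h) \<Rightarrow> ('u::chilbert_space \<Rightarrow> 'h) \<Rightarrow>
     ('h \<Rightarrow> 'y::chilbert_space) \<Rightarrow> ('u \<Rightarrow> 'u) \<Rightarrow> 'h \<Rightarrow> 'u \<Rightarrow>
     real \<Rightarrow> 'h \<Rightarrow> (real \<Rightarrow> 'u) \<Rightarrow> real" where
  "cost S B C K z v T x0 u =
     (LINT t|lebesgue_on {0..T}. running_cost C K z v (mild_solution S B x0 u t) (u t))"

definition optimal_pair ::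
    "(real \<Rightarrow> 'h::chilbert_space \<Rightarrow> 'h) \<Rightarrow> ('u::chilbert_space \<Rightarrow> 'h) \<Rightarrow>
     ('h \<Rightarrow> 'y::chilbert_space) \<Rightarrow> ('u \<Rightarrow> 'u) \<Rightarrow> 'h \<Rightarrow> 'u \<Rightarrow>
     real \<Rightarrow> 'h \<Rightarrow> (real \<Rightarrow> 'h) \<Rightarrow> (real \<Rightarrow> 'u) \<Rightarrow> bool" where
  "optimal_pair S B C K z v T x0 x u \<longleftrightarrow>
     u \<in> L2_controls T \<and>
     (\<forall>t\<in>{0..T}. x t = mild_solution S B x0 u t) \<and>
     (\<forall>w\<in>L2_controls T. cost S B C K z v T x0 u \<le> cost S B C K z v T x0 w)"

text \<open>Uniqueness of the control is that of its class in \<open>L\<^sup>2\<close>, i.e. up to null sets.\<close>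

definition the_optimal_pair ::
    "(real \<Rightarrow> 'h::chilbert_space \<Rightarrow> 'h) \<Rightarrow> ('u::chilbert_space \<Rightarrow> 'h) \<Rightarrow>
     ('h \<Rightarrow> 'y::chilbert_space) \<Rightarrow> ('u \<Rightarrow> 'u) \<Rightarrow> 'h \<Rightarrow> 'u \<Rightarrow>
     real \<Rightarrow> 'h \<Rightarrow> (real \<Rightarrow> 'h) \<Rightarrow> (real \<Rightarrow> 'u) \<Rightarrow> bool" where
  "the_optimal_pair S B C K z v T x0 x u \<longleftrightarrow>
     optimal_pair S B C K z v T x0 x u \<and>
     (\<forall>x' u'. optimal_pair S B C K z v T x0 x' u' \<longrightarrow>
        (\<forall>t\<in>{0..T}. x' t = x t) \<and> (AE t in lebesgue_on {0..T}. u' t = u t))"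

definition steady_state ::
    "'h set \<Rightarrow> ('h::chilbert_space \<Rightarrow> 'h) \<Rightarrow> ('u::chilbert_space \<Rightarrow> 'h) \<Rightarrow> 'h \<Rightarrow> 'u \<Rightarrow> bool" where
  "steady_state D A B xe ue \<longleftrightarrow> xe \<in> D \<and> A xe + B ue = 0"

text \<open>
  The optimal pair is unique (the control as an \<open>L\<^sup>2\<close> class), so the inner existential only chooses
  a representative \<open>u\<close> of the optimal control for which the estimate holds at every \<open>t\<close>. The
  problem with \<open>z = 0\<close> and \<open>v = 0\<close> is \<open>(LQ)\<close>.
\<close>

definition exponential_turnpike ::
    "(real \<Rightarrow> 'h::chilbert_space \<Rightarrow> 'h) \<Rightarrow> ('u::chilbert_space \<Rightarrow> 'h) \<Rightarrow>
     ('h \<Rightarrow> 'y::chilbert_space) \<Rightarrow> ('u \<Rightarrow> 'u) \<Rightarrow> 'h \<Rightarrow> 'u \<Rightarrow> 'h \<Rightarrow> 'u \<Rightarrow> bool" where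
  "exponential_turnpike S B C K z v xe ue \<longleftrightarrow>
     (\<forall>N. bounded N \<and> xe \<in> interior N \<longrightarrow>
        (\<exists>M>0. \<exists>k>0. \<forall>x0\<in>N. \<forall>T>0.
           \<exists>x u. the_optimal_pair S B C K z v T x0 x u \<and>
             (\<forall>t\<in>{0..T}. norm (x t - xe) + norm (u t - ue)
                            \<le> M * (exp (- k * t) + exp (- k * (T - t))))))"

end

theory Submission
  imports Defs
begin

text \<open>
  Both problems are quadratic, so a pair is optimal iff the first variation of the cost vanishes
  there. The difference of two optimal pairs of the generalized problem is therefore optimal for the
  homogeneous one, and this gives one direction.

  Conversely, homogeneous optimal trajectories, restarted at the midpoint of the horizon, are
  contracted by \<open>exp (- k T / 2)\<close> up to a constant. Comparing an arbitrary trajectory with the optimal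
  one on a fixed long window then bounds trajectories from \<open>0\<close> by their cost (detectability) and makes
  the static cost coercive on steady states. The contraction also yields, by a fixed point argument and
  averaging over the window, a bounded solution of \<open>A x + B u = h\<close> for every \<open>h\<close>, so the optimal
  steady state has a bounded Lagrange multiplier. Subtracting that steady state turns the generalized
  problem into the homogeneous one with a linear terminal cost. Its optimal pair is the homogeneous
  one plus a correction generated by the terminal term, and testing the variational equation of the
  correction with itself up to time \<open>s\<close>, continued optimally after \<open>s\<close>, shows that its state decays
  like \<open>exp (- k (T - s) / 2)\<close>.
\<close>

section \<open>Strong measurability on the line\<close>

text \<open>Neither stabilizability nor detectability is assumed, and \<open>A\<close> is unbounded.
  The decay of homogeneous optima is the only source of stability, so every constant must come from
  it and stay independent of the horizon. The given bound does not vanish at the final time, which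
  is why contraction has to be produced by restarting.

  Optimality is kept in weak form, as a variational equation tested with trajectories that start at
  0: no adjoint state or Riccati operator occurs, and the multiplier of the steady state appears as
  a functional \<open>l\<close> of the final state of the test trajectory. The generator is likewise
  replaced by its integrated version, so that limits and time integrals of trajectories never meet a
  domain condition.

  A second obstacle is that the turnpike estimate is pointwise in the control, whereas the
  variational equation yields energy bounds. The pointwise bound is recovered on unit windows from
  the coercivity of \<open>K\<close>, outside a null set, and the control is then redefined on that
  set. The rate \<open>k\<close> is halved on the way, since the midpoint restart sees only half of
  the horizon.\<close>

instance chilbert_space \<subseteq> banach ..

lemma measurable_on_bounded_linear:
  assumes "f measurable_on S" "bounded_linear F"
  shows "(\<lambda>x. F (f x)) measurable_on S"
  using measurable_on_compose_continuous_0[OF assms(1), of F] assms(2)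
  by (simp add: bounded_linear.linear linear_0 linear_continuous_on o_def)

lemma measurable_on_norm:
  assumes "f measurable_on S"
  shows "(\<lambda>x. norm (f x)) measurable_on S"
  using measurable_on_compose_continuous_0[OF assms, of norm]
  by (simp add: o_def continuous_on_norm_id)

lemma measurable_on_inner:
  fixes f g :: "'a::euclidean_space \<Rightarrow> 'b::real_inner"
  assumes "f measurable_on S" "g measurable_on S"
  shows "(\<lambda>x. inner (f x) (g x)) measurable_on S"
  by (intro measurable_on_combine[OF assms] continuous_intros) auto

text \<open>On a set of finite measure, convergence almost everywhere implies convergence in
  measure, so \<open>r n\<close> can be chosen with error above \<open>(1/2)^n\<close> only on a set
  of measure below \<open>(1/2)^n\<close>; Borel-Cantelli removes these sets.\<close>

lemma diagonal_AE_convergence: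
  fixes f :: "nat \<Rightarrow> real \<Rightarrow> 'b::real_normed_vector" and g :: "nat \<Rightarrow> nat \<Rightarrow> real \<Rightarrow> 'b"
  assumes S: "S \<in> lmeasurable"
    and meas: "\<And>n m. (\<lambda>x. norm (g n m x - f n x)) \<in> borel_measurable (lebesgue_on S)"
    and lim: "\<And>n. AE x in lebesgue_on S. (\<lambda>m. g n m x) \<longlonglongrightarrow> f n x"
  obtains r where "AE x in lebesgue_on S. (\<lambda>n. g n (r n) x - f n x) \<longlonglongrightarrow> 0"
proof -
  let ?M = "lebesgue_on S"
  interpret finite_measure ?M
    using S by (simp add: finite_measure_lebesgue_on)
  \<comment> \<open>Quantifying over all \<open>k \<ge> m\<close> makes the sets decrease in
    \<open>m\<close>, so that continuity of the measure from above applies.\<close>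
  define E where "E n m = {x \<in> space ?M. \<exists>k\<ge>m. norm (g n k x - f n x) > (1/2)^n}" for n m
  have Em: "E n m \<in> sets ?M" for n m
    unfolding E_def using meas[measurable] by measurable
  have "(\<lambda>m. measure ?M (E n m)) \<longlonglongrightarrow> measure ?M (\<Inter>m. E n m)" for n
  proof (rule finite_Lim_measure_decseq)
    show "decseq (E n)" unfolding decseq_def E_def by (blast intro: order_trans)
  qed (use Em in auto)
  moreover have "measure ?M (\<Inter>m. E n m) = 0" for n
  proof -
    have "AE x in ?M. x \<notin> (\<Inter>m. E n m)"
      using lim[of n]
    proof eventually_elim
      case (elim x)
      from LIMSEQ_D[OF this, of "(1/2)^n"] obtain m where "\<forall>k\<ge>m. norm (g n k x - f n x) < (1/2)^n" by auto
      hence "x \<notin> E n m" by (auto simp: E_def not_less less_imp_le)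
      thus ?case by auto
    qed
    moreover have "(\<Inter>m. E n m) \<in> sets ?M" using Em by auto
    ultimately have "(\<Inter>m. E n m) \<in> null_sets ?M"
      using AE_iff_null_sets by blast
    thus ?thesis by (simp add: measure_eq_0_null_sets)
  qed
  ultimately have "(\<lambda>m. measure ?M (E n m)) \<longlonglongrightarrow> 0" for n by metis
  hence "\<exists>m. measure ?M (E n m) < (1/2)^n" for n
    by (metis (no_types, lifting) LIMSEQ_D abs_of_nonneg diff_zero half_gt_zero_iff measure_nonneg order_refl real_norm_def zero_less_one zero_less_power)
  then obtain r where r: "\<And>n. measure ?M (E n (r n)) < (1/2)^n" by metis
  have "AE x in ?M. eventually (\<lambda>n. x \<in> space ?M - E n (r n)) sequentially"
  proof (rule borel_cantelli_AE1)
    show "summable (\<lambda>n. measure ?M (E n (r n)))"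
      by (rule summable_comparison_test'[OF summable_geometric, of "1/2" 0])
        (use r in \<open>auto simp: less_imp_le\<close>)
  qed (use Em emeasure_finite in \<open>auto simp: less_top[symmetric]\<close>)
  hence "AE x in ?M. (\<lambda>n. g n (r n) x - f n x) \<longlonglongrightarrow> 0"
  proof eventually_elim
    case (elim x)
    show ?case
    proof (rule Lim_null_comparison)
      show "eventually (\<lambda>n. norm (g n (r n) x - f n x) \<le> (1/2)^n) sequentially"
        using elim by eventually_elim (auto simp: E_def not_less)
      show "(\<lambda>n. (1/2)^n :: real) \<longlonglongrightarrow> 0" by (simp add: LIMSEQ_power_zero)
    qed
  qed
  thus ?thesis using that by blast
qed

lemma AE_lebesgue_on_obtain_negligible:
  assumes "AE x in lebesgue_on S. P x" "S \<in> sets lebesgue"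
  obtains N where "negligible N" "\<And>x. x \<in> S - N \<Longrightarrow> P x"
proof -
  have "AE x in lebesgue. x \<in> S \<longrightarrow> P x"
    using assms(1) by (subst (asm) AE_restrict_space_iff) (use assms(2) in auto)
  then obtain N where "{x \<in> space lebesgue. \<not> (x \<in> S \<longrightarrow> P x)} \<subseteq> N"
    "emeasure lebesgue N = 0" "N \<in> sets lebesgue"
    by (rule AE_E)
  thus ?thesis using that[of N] by (auto simp: negligible_iff_null_sets null_sets_def)
qed

lemma AE_lebesgue_on_negligible:
  assumes "negligible N" "S \<in> sets lebesgue" "\<And>x. x \<in> S - N \<Longrightarrow> P x"
  shows "AE x in lebesgue_on S. P x"
proof -
  have "AE x in lebesgue. x \<in> S \<longrightarrow> P x"
    by (rule AE_I'[of N]) (use assms in \<open>auto simp: negligible_iff_null_sets\<close>)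
  thus ?thesis by (subst AE_restrict_space_iff) (use assms(2) in auto)
qed

lemma measurable_on_obtain_continuous:
  assumes "f measurable_on S" "S \<in> sets lebesgue"
  obtains g where "\<And>n. continuous_on UNIV (g n)" "AE x in lebesgue_on S. (\<lambda>n. g n x) \<longlonglongrightarrow> f x"
proof -
  obtain N g where g: "negligible N" "\<And>n. continuous_on UNIV (g n)"
    "\<And>x. x \<notin> N \<Longrightarrow> (\<lambda>n. g n x) \<longlonglongrightarrow> (if x \<in> S then f x else 0)"
    using assms unfolding measurable_on_def by blast
  show ?thesis
  proof (rule that[of g])
    show "AE x in lebesgue_on S. (\<lambda>n. g n x) \<longlonglongrightarrow> f x"
    proof (rule AE_lebesgue_on_negligible[OF g(1) assms(2)])
      show "(\<lambda>n. g n x) \<longlonglongrightarrow> f x" if "x \<in> S - N" for x using g(3)[of x] that by auto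
    qed
  qed (use g in auto)
qed

text \<open>\<open>measurable_on\<close> asks for continuous functions on the whole space whose
  limit vanishes off \<open>S\<close>; the \<open>g n\<close> are uncontrolled there and have to be
  cut off continuously.\<close>

lemma AE_limit_continuous_measurable_on:
  fixes g :: "nat \<Rightarrow> 'a::euclidean_space \<Rightarrow> 'b::real_normed_vector"
  assumes S: "S \<in> sets lebesgue" and g: "\<And>n. continuous_on UNIV (g n)"
    and lim: "AE x in lebesgue_on S. (\<lambda>n. g n x) \<longlonglongrightarrow> f x"
  shows "f measurable_on S"
proof -
  obtain N where N: "negligible N" "\<And>x. x \<in> S - N \<Longrightarrow> (\<lambda>n. g n x) \<longlonglongrightarrow> f x"
    using AE_lebesgue_on_obtain_negligible[OF lim S] by blast
  obtain N' h where h: "negligible N'" "\<And>n::nat. continuous_on UNIV (h n)"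
    "\<And>x. x \<notin> N' \<Longrightarrow> (\<lambda>n. h n x) \<longlonglongrightarrow> indicat_real S x"
    using indicator_measurable_on[OF S] unfolding measurable_on_def by auto
  show ?thesis unfolding measurable_on_def
  proof (intro exI conjI allI impI)
    show "negligible (N \<union> N' )" using N h by auto
    \<comment> \<open>Where \<open>h n x\<close> tends to 1 the factor is eventually exactly 1,
      where it tends to 0 eventually exactly 0, so the product converges although
      \<open>g n x\<close> may diverge outside \<open>S\<close>.\<close>
    show "continuous_on UNIV (\<lambda>x. (min 1 (real n * max 0 (h n x - 1/2))) *\<^sub>R g n x)" for n
      by (intro continuous_intros h g)
    fix x assume x: "x \<notin> N \<union> N'"
    show "(\<lambda>n. min 1 (real n * max 0 (h n x - 1/2)) *\<^sub>R g n x) \<longlonglongrightarrow> (if x \<in> S then f x else 0)"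
    proof (cases "x \<in> S")
      case True
      have "eventually (\<lambda>n. h n x > 3/4) sequentially"
        using order_tendstoD(1)[OF h(3), of x "3/4"] x True by auto
      hence "eventually (\<lambda>n. min 1 (real n * max 0 (h n x - 1/2)) *\<^sub>R g n x = g n x) sequentially"
        using eventually_ge_at_top[of 4]
      proof eventually_elim
        case (elim n)
        have "real n * max 0 (h n x - 1/2) \<ge> 4 * (1/4)"
          using elim by (intro mult_mono) auto
        thus ?case by simp
      qed
      hence "(\<lambda>n. min 1 (real n * max 0 (h n x - 1/2)) *\<^sub>R g n x) \<longlonglongrightarrow> f x"
        using N(2)[of x] x True by (simp add: tendsto_cong)
      thus ?thesis using True by simp
    next
      case False
      have "eventually (\<lambda>n. h n x < 1/2) sequentially"
        using order_tendstoD(2)[OF h(3), of x "1/2"] x False by auto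
      hence "eventually (\<lambda>n. min 1 (real n * max 0 (h n x - 1/2)) *\<^sub>R g n x = 0) sequentially"
        by eventually_elim simp
      thus ?thesis using False by (simp add: tendsto_eventually)
    qed
  qed
qed

lemma borel_measurable_norm_diff:
  fixes f g :: "real \<Rightarrow> 'b::real_normed_vector"
  assumes "f measurable_on S" "g measurable_on S" "S \<in> sets lebesgue"
  shows "(\<lambda>x. norm (f x - g x)) \<in> borel_measurable (lebesgue_on S)"
  using measurable_on_norm[OF measurable_on_diff[OF assms(1,2)]]
  by (simp add: measurable_on_iff_borel_measurable assms)

lemma continuous_measurable_on:
  assumes "continuous_on UNIV f" "S \<in> sets lebesgue"
  shows "f measurable_on S"
  using AE_limit_continuous_measurable_on[of S "\<lambda>_. f" f] assms by auto

text \<open>Approximating each \<open>f n\<close> by continuous functions and passing to a diagonal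
  sequence reduces the claim to limits of continuous functions, whatever the size of the value
  space.\<close>

lemma measurable_on_AE_limit:
  fixes f :: "nat \<Rightarrow> real \<Rightarrow> 'b::real_normed_vector"
  assumes S: "S \<in> lmeasurable" and f: "\<And>n. f n measurable_on S"
    and lim: "AE x in lebesgue_on S. (\<lambda>n. f n x) \<longlonglongrightarrow> F x"
  shows "F measurable_on S"
proof -
  have S': "S \<in> sets lebesgue" using S by auto
  have "\<exists>g. (\<forall>m. continuous_on UNIV (g m)) \<and> (AE x in lebesgue_on S. (\<lambda>m. g m x) \<longlonglongrightarrow> f n x)" for n
    using measurable_on_obtain_continuous[OF f S'] by metis
  then obtain g where g: "\<And>n m::nat. continuous_on UNIV (g n m)"
    "\<And>n. AE x in lebesgue_on S. (\<lambda>m. g n m x) \<longlonglongrightarrow> f n x" by metis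
  obtain r where r: "AE x in lebesgue_on S. (\<lambda>n. g n (r n) x - f n x) \<longlonglongrightarrow> 0"
    by (rule diagonal_AE_convergence[OF S _ g(2)])
      (intro borel_measurable_norm_diff f S' continuous_measurable_on g)
  show ?thesis
  proof (rule AE_limit_continuous_measurable_on[OF S' g(1)])
    show "AE x in lebesgue_on S. (\<lambda>n. g n (r n) x) \<longlonglongrightarrow> F x"
      using r lim
    proof eventually_elim
      case (elim x)
      from tendsto_add[OF this] show ?case by simp
    qed
  qed
qed

lemma simple_function_measurable_on:
  fixes f :: "real \<Rightarrow> 'b::real_normed_vector"
  assumes "simple_function (lebesgue_on S) f" and S: "S \<in> sets lebesgue"
  shows "f measurable_on S"
proof -
  have fin: "finite (f ` S)" and A: "\<And>y. y \<in> f ` S \<Longrightarrow> f -` {y} \<inter> S \<in> sets lebesgue"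
    using assms by (auto simp: simple_function_def sets_restrict_space_iff)
  have "(\<lambda>x. if x \<in> S then (\<Sum>y\<in>f ` S. indicat_real (f -` {y} \<inter> S) x *\<^sub>R y) else 0) measurable_on UNIV"
    by (intro measurable_on_restrict measurable_on_sum measurable_on_scaleR
        indicator_measurable_on fin A measurable_on_const_UNIV S)
  also have "(\<lambda>x. if x \<in> S then (\<Sum>y\<in>f ` S. indicat_real (f -` {y} \<inter> S) x *\<^sub>R y) else 0)
     = (\<lambda>x. if x \<in> S then f x else 0)"
  proof
    fix x
    have "(\<Sum>y\<in>f ` S. indicat_real (f -` {y} \<inter> S) x *\<^sub>R y) = (\<Sum>y\<in>f ` S. if y = f x then y else 0)" if "x \<in> S"
      using that by (intro sum.cong) auto
    thus "(if x \<in> S then (\<Sum>y\<in>f ` S. indicat_real (f -` {y} \<inter> S) x *\<^sub>R y) else 0) = (if x \<in> S then f x else 0)"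
      using fin by simp
  qed
  finally show ?thesis by (simp add: measurable_on_UNIV)
qed

text \<open>Exchanges simple functions for continuous ones as approximants, and thereby links the
  measurability in the definition of controls to the notion attached to the gauge integral.\<close>

lemma strongly_measurable_iff:
  fixes f :: "real \<Rightarrow> 'b::real_normed_vector"
  shows "strongly_measurable (lebesgue_on {0..T}) f \<longleftrightarrow> f measurable_on {0..T}"
proof
  assume "strongly_measurable (lebesgue_on {0..T}) f"
  then obtain s where "\<And>i. simple_function (lebesgue_on {0..T}) (s i)"
    "AE t in lebesgue_on {0..T}. (\<lambda>i. s i t) \<longlonglongrightarrow> f t"
    unfolding strongly_measurable_def by blast
  thus "f measurable_on {0..T}"
    by - (rule measurable_on_AE_limit[of _ s]; auto intro: simple_function_measurable_on)
next
  assume "f measurable_on {0..T}"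
  then obtain g where g: "\<And>n. continuous_on UNIV (g n)" "AE x in lebesgue_on {0..T}. (\<lambda>n. g n x) \<longlonglongrightarrow> f x"
    using measurable_on_obtain_continuous by (metis lmeasurable_iff_integrable fmeasurableD lmeasurable_interval(1) cbox_interval)
  have "\<exists>s. simple_function (lebesgue_on {0..T}) s \<and> (\<forall>x\<in>{0..T}. norm (s x - g n x) < inverse (real (Suc n)))" for n
  proof -
    have "uniformly_continuous_on {0..T} (g n)"
      by (intro compact_uniformly_continuous continuous_on_subset[OF g(1)]) auto
    then obtain d where d: "d > 0" "\<And>x y. x \<in> {0..T} \<Longrightarrow> y \<in> {0..T} \<Longrightarrow> dist x y < d \<Longrightarrow> dist (g n x) (g n y) < inverse (real (Suc n))"
      unfolding uniformly_continuous_on_def by (metis inverse_positive_iff_positive of_nat_0_less_iff zero_less_Suc)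
    \<comment> \<open>Rounding down to a grid of mesh \<open>d/2\<close> turns \<open>g n\<close>
      into a function with finitely many values, uniformly close by the choice of \<open>d\<close>;
      rounding down, not to the nearest grid point, keeps the argument in
      \<open>{0..T}\<close>.\<close>
    define p where "p x = d/2 * of_int \<lfloor>x / (d/2)\<rfloor>" for x
    have p: "0 \<le> p x" "p x \<le> x" "x - p x < d" if "x \<ge> 0" for x
    proof -
      have "of_int \<lfloor>x / (d/2)\<rfloor> \<le> x / (d/2)" "x / (d/2) < of_int \<lfloor>x / (d/2)\<rfloor> + 1" by linarith+
      hence "d/2 * of_int \<lfloor>x / (d/2)\<rfloor> \<le> d/2 * (x / (d/2))" "d/2 * (x / (d/2)) < d/2 * (of_int \<lfloor>x / (d/2)\<rfloor> + 1)"
        using d(1) by (auto intro!: mult_left_mono mult_strict_left_mono simp del: times_divide_eq_right)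
      thus "p x \<le> x" "x - p x < d" using d(1) by (auto simp: p_def algebra_simps)
      show "0 \<le> p x" using that d(1) by (auto simp: p_def)
    qed
    show ?thesis
    proof (intro exI conjI ballI)
      show "simple_function (lebesgue_on {0..T}) (\<lambda>x. g n (p x))"
      proof -
        have "simple_function (lebesgue_on {0..T}) (\<lambda>x. \<lfloor>x / (d/2)\<rfloor>)"
        proof (rule simple_function_def[THEN iffD2], intro conjI ballI)
          have "(\<lambda>x. \<lfloor>x / (d/2)\<rfloor>) ` {0..T} \<subseteq> {0..\<lfloor>T / (d/2)\<rfloor>}"
            using d(1) by (auto intro!: floor_mono divide_right_mono)
          thus "finite ((\<lambda>x. \<lfloor>x / (d/2)\<rfloor>) ` space (lebesgue_on {0..T}))"
            by (auto intro: finite_subset)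
          fix y
          have "(\<lambda>x::real. \<lfloor>x / (d/2)\<rfloor>) \<in> lborel \<rightarrow>\<^sub>M count_space UNIV"
            by measurable
          hence "(\<lambda>x. \<lfloor>x / (d/2)\<rfloor>) \<in> lebesgue_on {0..T} \<rightarrow>\<^sub>M count_space UNIV"
            by (intro measurable_restrict_space1 measurable_completion)
          thus "(\<lambda>x. \<lfloor>x / (d/2)\<rfloor>) -` {y} \<inter> space (lebesgue_on {0..T}) \<in> sets (lebesgue_on {0..T})"
            by (rule measurable_sets) auto
        qed
        from simple_function_compose1[OF this, of "\<lambda>i. g n (d/2 * of_int i)"]
        show ?thesis by (simp add: p_def)
      qed
      fix x assume "x \<in> {0..T}"
      thus "norm (g n (p x) - g n x) < inverse (real (Suc n))"
        using d(2)[of "p x" x] p[of x] by (auto simp: dist_norm)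
    qed
  qed
  then obtain s where s: "\<And>n. simple_function (lebesgue_on {0..T}) (s n)"
     "\<And>n x. x\<in>{0..T} \<Longrightarrow> norm (s n x - g n x) < inverse (real (Suc n))" by metis
  show "strongly_measurable (lebesgue_on {0..T}) f" unfolding strongly_measurable_def
  proof (intro exI conjI allI)
    show "simple_function (lebesgue_on {0..T}) (s i)" for i by fact
    have "AE t in lebesgue_on {0..T}. t \<in> {0..T}"
      using AE_space[of "lebesgue_on {0..T}"] by simp
    with g(2) show "AE t in lebesgue_on {0..T}. (\<lambda>i. s i t) \<longlonglongrightarrow> f t"
    proof eventually_elim
      case (elim x)
      have "(\<lambda>i. s i x - g i x) \<longlonglongrightarrow> 0"
        by (rule Lim_null_comparison[OF _ LIMSEQ_inverse_real_of_nat])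
          (use s(2) elim in \<open>auto simp: less_imp_le\<close>)
      from tendsto_add[OF this elim(1)] show ?case by simp
    qed
  qed
qed

section \<open>Integration of Banach space valued functions and square integrable controls\<close>

lemma tagged_sum_norm_le:
  fixes f h :: "real \<Rightarrow> 'b::real_normed_vector"
  assumes D: "D tagged_division_of cbox a b" and le: "\<And>x. x \<in> cbox a b \<Longrightarrow> norm (f x - h x) \<le> k x"
  shows "norm ((\<Sum>(x,K)\<in>D. measure lborel K *\<^sub>R f x) - (\<Sum>(x,K)\<in>D. measure lborel K *\<^sub>R h x)) \<le> (\<Sum>(x,K)\<in>D. measure lborel K *\<^sub>R k x)"
proof -
  have "(\<Sum>(x,K)\<in>D. measure lborel K *\<^sub>R f x) - (\<Sum>(x,K)\<in>D. measure lborel K *\<^sub>R h x) = (\<Sum>(x,K)\<in>D. measure lborel K *\<^sub>R (f x - h x))"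
    by (simp add: sum_subtractf[symmetric] split_def scaleR_diff_right)
  also have "norm \<dots> \<le> (\<Sum>(x,K)\<in>D. measure lborel K *\<^sub>R k x)"
  proof (rule sum_norm_le)
    fix p assume p: "p \<in> D"
    obtain x K where [simp]: "p = (x,K)" by (cases p)
    have "x \<in> cbox a b" using tagged_division_ofD(2,3)[OF D, of x K] p by auto
    thus "norm (case p of (x,K) \<Rightarrow> measure lborel K *\<^sub>R (f x - h x)) \<le> (case p of (x,K) \<Rightarrow> measure lborel K *\<^sub>R k x)"
      using le by (auto intro!: mult_left_mono)
  qed
  finally show ?thesis .
qed

text \<open>The Cauchy criterion for Riemann sums passes from \<open>h\<close> to \<open>f\<close>,
  because on fine divisions the sums of the two differ at most by a sum of \<open>k\<close>, which
  is close to its small integral.\<close>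

lemma integrable_on_approximation:
  fixes f :: "real \<Rightarrow> 'b::banach"
  assumes "\<And>e. e > 0 \<Longrightarrow> \<exists>h k. h integrable_on {a..b} \<and> k integrable_on {a..b} \<and>
     (\<forall>x\<in>{a..b}. norm (f x - h x) \<le> k x) \<and> integral {a..b} k < e"
  shows "f integrable_on {a..b}"
  unfolding interval_cbox
proof (subst integrable_Cauchy, intro allI impI)
  fix e :: real assume "e > 0"
  \<comment> \<open>A Riemann sum of \<open>k\<close> then stays below \<open>e/6 + e/6\<close>; two
    of these and the Cauchy defect \<open>e/3\<close> of \<open>h\<close> make up
    \<open>e\<close>.\<close>
  from assms[of "e/6"] this obtain h k where h: "h integrable_on cbox a b" and k: "k integrable_on cbox a b"
     and le: "\<And>x. x\<in>cbox a b \<Longrightarrow> norm (f x - h x) \<le> k x" and small: "integral (cbox a b) k < e/6" by auto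
  obtain g1 where g1: "gauge g1" and h1: "\<And>D1 D2. D1 tagged_division_of cbox a b \<and> g1 fine D1 \<and> D2 tagged_division_of cbox a b \<and> g1 fine D2 \<Longrightarrow>
      norm ((\<Sum>(x,K)\<in>D1. measure lborel K *\<^sub>R h x) - (\<Sum>(x,K)\<in>D2. measure lborel K *\<^sub>R h x)) < e/3"
    using h[unfolded integrable_Cauchy, rule_format, of "e/3"] \<open>e > 0\<close> by auto
  have "(k has_integral integral (cbox a b) k) (cbox a b)" using k by auto
  then obtain g2 where g2: "gauge g2" and k2: "\<And>D. D tagged_division_of cbox a b \<and> g2 fine D \<Longrightarrow>
      norm ((\<Sum>(x,K)\<in>D. measure lborel K *\<^sub>R k x) - integral (cbox a b) k) < e/6"
    using \<open>e > 0\<close> unfolding has_integral by (metis divide_pos_pos zero_less_numeral)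
  show "\<exists>\<gamma>. gauge \<gamma> \<and>
           (\<forall>\<D>1 \<D>2. \<D>1 tagged_division_of cbox a b \<and> \<gamma> fine \<D>1 \<and> \<D>2 tagged_division_of cbox a b \<and> \<gamma> fine \<D>2 \<longrightarrow>
               norm ((\<Sum>(x, K)\<in>\<D>1. measure lborel K *\<^sub>R f x) - (\<Sum>(x, K)\<in>\<D>2. measure lborel K *\<^sub>R f x)) < e)"
  proof (intro exI[of _ "\<lambda>x. g1 x \<inter> g2 x"] conjI allI impI)
    show "gauge (\<lambda>x. g1 x \<inter> g2 x)" using g1 g2 by auto
    fix D1 D2 assume "D1 tagged_division_of cbox a b \<and> (\<lambda>x. g1 x \<inter> g2 x) fine D1 \<and> D2 tagged_division_of cbox a b \<and> (\<lambda>x. g1 x \<inter> g2 x) fine D2"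
    hence D: "D1 tagged_division_of cbox a b" "g1 fine D1" "g2 fine D1" "D2 tagged_division_of cbox a b" "g1 fine D2" "g2 fine D2"
      by (auto simp: fine_Int)
    let ?s = "\<lambda>D f. (\<Sum>(x,K)\<in>D. measure lborel K *\<^sub>R f x)"
    have "norm (?s D1 f - ?s D1 h) \<le> ?s D1 k" "norm (?s D2 f - ?s D2 h) \<le> ?s D2 k"
      using tagged_sum_norm_le le D by blast+
    moreover have "?s D1 k < e/3" "?s D2 k < e/3" using k2[of D1] k2[of D2] D small unfolding real_norm_def by linarith+
    moreover have "norm (?s D1 h - ?s D2 h) < e/3" using h1[of D1 D2] D by auto
    moreover have "norm (?s D1 f - ?s D2 f) \<le> norm (?s D1 f - ?s D1 h) + norm (?s D1 h - ?s D2 h) + norm (?s D2 f - ?s D2 h)"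
      using dist_triangle[of "?s D1 f" "?s D2 f" "?s D1 h"] dist_triangle2[of "?s D1 h" "?s D2 f" "?s D2 h"]
      unfolding dist_norm by linarith
    ultimately show "norm (?s D1 f - ?s D2 f) < e" by linarith
  qed
qed

lemma measurable_on_if_less:
  fixes f :: "real \<Rightarrow> 'b::real_normed_vector" and g :: "real \<Rightarrow> real"
  assumes f: "f measurable_on {a..b}" and g: "g measurable_on {a..b}"
  shows "(\<lambda>x. if g x \<le> N then f x else 0) measurable_on {a..b}"
proof -
  have "g \<in> borel_measurable (lebesgue_on {a..b})"
    using g by (simp add: measurable_on_iff_borel_measurable)
  hence "(\<lambda>x. if g x \<le> N then 1 else 0 :: real) \<in> borel_measurable (lebesgue_on {a..b})" by measurable
  hence "(\<lambda>x. if g x \<le> N then 1 else 0 :: real) measurable_on {a..b}"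
    by (simp add: measurable_on_iff_borel_measurable)
  from measurable_on_scaleR[OF this f] show ?thesis
    by (simp add: if_distrib[of "\<lambda>c. c *\<^sub>R _"] cong: if_cong)
qed

text \<open>Continuous approximants, retracted to the ball of radius \<open>N\<close>, converge in
  the mean by dominated convergence for the real function \<open>norm (f x - h n x)\<close>; this
  scalar statement is all that the approximation criterion asks for.\<close>

lemma integrable_on_bounded_measurable:
  fixes f :: "real \<Rightarrow> 'b::banach"
  assumes f: "f measurable_on {a..b}" and bd: "\<And>x. x \<in> {a..b} \<Longrightarrow> norm (f x) \<le> N" and N: "N > 0"
  shows "f integrable_on {a..b}"
proof (rule integrable_on_approximation)
  fix e :: real assume e: "e > 0"
  obtain g where g: "\<And>n. continuous_on UNIV (g n)" "AE x in lebesgue_on {a..b}. (\<lambda>n. g n x) \<longlonglongrightarrow> f x"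
    using measurable_on_obtain_continuous[OF f] by (metis lmeasurable_cbox interval_cbox fmeasurableD)
  obtain Z where Z: "negligible Z" "\<And>x. x \<in> {a..b} - Z \<Longrightarrow> (\<lambda>n. g n x) \<longlonglongrightarrow> f x"
    using AE_lebesgue_on_obtain_negligible[OF g(2)] by (metis lmeasurable_cbox interval_cbox fmeasurableD)
  \<comment> \<open>Radial retraction onto the ball of radius \<open>N\<close>: it is continuous and
    fixes the values of \<open>f\<close> on the interval.\<close>
  define h0 where "h0 n x = (1 / max 1 (norm (g n x) / N)) *\<^sub>R g n x" for n x
  have h0c: "continuous_on UNIV (h0 n)" for n
    unfolding h0_def by (intro continuous_intros g) (use N in auto)
  have h0n: "norm (h0 n x) \<le> N" for n x
    using N by (auto simp: h0_def max_def field_simps)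
  have h0lim: "(\<lambda>n. h0 n x) \<longlonglongrightarrow> f x" if "x \<in> {a..b} - Z" for x
  proof -
    have "(\<lambda>n. h0 n x) \<longlonglongrightarrow> (1 / max 1 (norm (f x) / N)) *\<^sub>R f x"
      unfolding h0_def by (intro tendsto_intros Z that) (use N in auto)
    moreover have "max 1 (norm (f x) / N) = 1" using bd[of x] that N by (auto simp: max_def field_simps)
    ultimately show ?thesis by simp
  qed
  \<comment> \<open>Setting \<open>h n\<close> equal to \<open>f\<close> on the exceptional null set
    turns almost everywhere convergence into convergence at every point, as
    \<open>dominated_convergence\<close> demands.\<close>
  define h where "h n x = (if x \<in> Z then f x else h0 n x)" for n x
  have hi: "h n integrable_on {a..b}" for n
    by (rule integrable_spike[OF _ Z(1), of "h0 n"])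
      (auto simp: h_def intro!: integrable_continuous_real continuous_on_subset[OF h0c])
  have hm: "h n measurable_on {a..b}" for n
    by (rule measurable_on_spike[OF _ Z(1), of "h0 n"]) (auto simp: h_def intro!: continuous_measurable_on h0c)
  have ki: "(\<lambda>x. norm (f x - h n x)) integrable_on {a..b}" for n
  proof (rule measurable_bounded_by_integrable_imp_integrable[of _ _ "\<lambda>_. 2*N"])
    show "(\<lambda>x. norm (f x - h n x)) \<in> borel_measurable (lebesgue_on {a..b})"
      by (rule borel_measurable_norm_diff[OF f hm]) auto
    show "norm (norm (f x - h n x)) \<le> 2*N" if "x \<in> {a..b}" for x
      using bd[OF that] h0n[of n x] norm_triangle_ineq4[of "f x" "h n x"] N by (auto simp: h_def)
  qed auto
  have "(\<lambda>n. integral {a..b} (\<lambda>x. norm (f x - h n x))) \<longlonglongrightarrow> integral {a..b} (\<lambda>x. 0::real)"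
  proof (rule dominated_convergence(2)[OF ki, of "\<lambda>_. 2*N"])
    show "norm (norm (f x - h n x)) \<le> 2*N" if "x \<in> {a..b}" for x n
      using bd[OF that] h0n[of n x] norm_triangle_ineq4[of "f x" "h n x"] N by (auto simp: h_def)
    show "(\<lambda>n. norm (f x - h n x)) \<longlonglongrightarrow> 0" if "x \<in> {a..b}" for x
    proof (cases "x \<in> Z")
      case False
      hence "(\<lambda>n. h n x) \<longlonglongrightarrow> f x" using h0lim that by (auto simp: h_def)
      from tendsto_norm[OF tendsto_diff[OF tendsto_const[of "f x"] this]] show ?thesis by simp
    qed (auto simp: h_def)
  qed auto
  hence "eventually (\<lambda>n. integral {a..b} (\<lambda>x. norm (f x - h n x)) < e) sequentially"
    by (rule order_tendstoD(2)) (use e in simp)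
  then obtain n where "integral {a..b} (\<lambda>x. norm (f x - h n x)) < e" by (auto simp: eventually_sequentially)
  thus "\<exists>h k. h integrable_on {a..b} \<and> k integrable_on {a..b} \<and>
     (\<forall>x\<in>{a..b}. norm (f x - h x) \<le> k x) \<and> integral {a..b} k < e"
    by (intro exI[of _ "h n"] exI[of _ "\<lambda>x. norm (f x - h n x)"]) (use hi ki in auto)
qed

lemma integrable_real_measurable_on:
  fixes g :: "real \<Rightarrow> real"
  assumes "g integrable_on {a..b}"
  shows "g measurable_on {a..b}"
  using integrable_imp_measurable[OF assms] by (simp add: measurable_on_iff_borel_measurable)

text \<open>Truncation to the set where \<open>g x \<le> n\<close> gives bounded integrable
  functions, and the error is dominated by the tail of \<open>g\<close>, whose integral tends to
  0.\<close>

lemma integrable_on_dominated: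
  fixes f :: "real \<Rightarrow> 'b::banach"
  assumes f: "f measurable_on {a..b}" and g: "g integrable_on {a..b}"
    and bd: "\<And>x. x \<in> {a..b} \<Longrightarrow> norm (f x) \<le> g x"
  shows "f integrable_on {a..b}"
proof (rule integrable_on_approximation)
  fix e :: real assume e: "e > 0"
  have gm: "g measurable_on {a..b}" by (rule integrable_real_measurable_on[OF g])
  have g0: "g x \<ge> 0" if "x \<in> {a..b}" for x using bd[OF that] norm_ge_zero order_trans by blast
  define h where "h n x = (if g x \<le> real n then f x else 0)" for n x
  define k where "k n x = (if g x \<le> real n then 0 else g x)" for n x
  have hi: "h n integrable_on {a..b}" for n
    unfolding h_def
    by (rule integrable_on_bounded_measurable[of _ _ _ "real n + 1"])
      (use measurable_on_if_less[OF f gm] bd in \<open>force+\<close>)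
  have "(\<lambda>x. g x - (if g x \<le> real n then g x else 0)) measurable_on {a..b}" for n
    by (intro measurable_on_diff gm measurable_on_if_less)
  moreover have "(\<lambda>x. g x - (if g x \<le> real n then g x else 0)) = k n" for n by (auto simp: k_def)
  ultimately have km: "k n measurable_on {a..b}" for n by metis
  have ki: "k n integrable_on {a..b}" for n
    by (rule measurable_bounded_by_integrable_imp_integrable[OF _ g])
      (use km g0 in \<open>auto simp: k_def measurable_on_iff_borel_measurable\<close>)
  have "(\<lambda>n. integral {a..b} (k n)) \<longlonglongrightarrow> integral {a..b} (\<lambda>x. 0::real)"
  proof (rule dominated_convergence(2)[OF ki g])
    show "norm (k n x) \<le> g x" if "x \<in> {a..b}" for x n using g0[OF that] by (auto simp: k_def)
    fix x assume "x \<in> {a..b}"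
    obtain n0 where "g x \<le> real n0" using real_arch_simple by blast
    hence "eventually (\<lambda>n. k n x = 0) sequentially"
      by (intro eventually_sequentiallyI[of n0]) (auto simp: k_def)
    thus "(\<lambda>n. k n x) \<longlonglongrightarrow> 0" by (rule tendsto_eventually)
  qed
  hence "eventually (\<lambda>n. integral {a..b} (k n) < e) sequentially"
    by (rule order_tendstoD(2)) (use e in simp)
  then obtain n where "integral {a..b} (k n) < e" by (auto simp: eventually_sequentially)
  thus "\<exists>h k. h integrable_on {a..b} \<and> k integrable_on {a..b} \<and>
     (\<forall>x\<in>{a..b}. norm (f x - h x) \<le> k x) \<and> integral {a..b} k < e"
    by (intro exI[of _ "h n"] exI[of _ "k n"]) (use hi ki bd in \<open>auto simp: h_def k_def\<close>)
qed

section \<open>Square integrability and its closure properties\<close>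

definition L2 :: "real \<Rightarrow> (real \<Rightarrow> 'u::real_normed_vector) \<Rightarrow> bool" where
  "L2 T u \<longleftrightarrow> u measurable_on {0..T} \<and> (\<lambda>t. (norm (u t))\<^sup>2) integrable_on {0..T}"

lemma integrable_lebesgue_on_iff:
  fixes f :: "real \<Rightarrow> real"
  assumes "\<And>x. x \<in> {a..b} \<Longrightarrow> f x \<ge> 0"
  shows "integrable (lebesgue_on {a..b}) f \<longleftrightarrow> f integrable_on {a..b}"
  using integrable_on_lebesgue_on[where f=f and S="{a..b}"] absolutely_integrable_imp_integrable[where f=f and S="{a..b}"]
    nonnegative_absolutely_integrable_1[where f=f and A="{a..b}"] assms by auto

lemma L2_controls_iff: "u \<in> L2_controls T \<longleftrightarrow> L2 T u"
  by (simp add: L2_controls_def L2_def strongly_measurable_iff integrable_lebesgue_on_iff)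

lemma L2_dominated:
  assumes "u measurable_on {0..T}" "g integrable_on {0..T}" "\<And>t. t \<in> {0..T} \<Longrightarrow> (norm (u t))\<^sup>2 \<le> g t"
  shows "L2 T u"
  unfolding L2_def
proof
  have "(\<lambda>t. (norm (u t))\<^sup>2) measurable_on {0..T}"
    using measurable_on_compose_continuous_0[OF assms(1), of "\<lambda>x. (norm x)\<^sup>2"]
    by (simp add: o_def continuous_intros)
  thus "(\<lambda>t. (norm (u t))\<^sup>2) integrable_on {0..T}"
    by (rule integrable_on_dominated[OF _ assms(2)]) (use assms(3) in auto)
qed (use assms in simp)

lemma L2_square_integrable: "L2 T u \<Longrightarrow> (\<lambda>t. (norm (u t))\<^sup>2) integrable_on {0..T}"
  by (simp add: L2_def)

lemma L2_zero [simp]: "L2 T (\<lambda>_. 0)"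
  using integrable_0[of "{0..T}"] by (simp add: L2_def)

lemma L2_bounded_linear:
  assumes "L2 T u" "bounded_linear F"
  shows "L2 T (\<lambda>t. F (u t))"
proof -
  obtain k where k: "\<And>x. norm (F x) \<le> norm x * k" "k \<ge> 0"
    using bounded_linear.nonneg_bounded[OF assms(2)] by blast
  show ?thesis
  proof (rule L2_dominated)
    show "(\<lambda>t. F (u t)) measurable_on {0..T}"
      using assms measurable_on_bounded_linear L2_def by blast
    show "(\<lambda>t. k\<^sup>2 * (norm (u t))\<^sup>2) integrable_on {0..T}"
      using L2_square_integrable[OF assms(1)] by (intro integrable_on_mult_right)
    show "(norm (F (u t)))\<^sup>2 \<le> k\<^sup>2 * (norm (u t))\<^sup>2" for t
      using power_mono[OF k(1)[of "u t"], of 2] by (simp add: power_mult_distrib mult.commute)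
  qed
qed

lemma L2_scaleR: "L2 T u \<Longrightarrow> L2 T (\<lambda>t. c *\<^sub>R u t)"
  using L2_bounded_linear[OF _ bounded_linear_scaleR_right] .

lemma L2_add:
  assumes "L2 T u" "L2 T w"
  shows "L2 T (\<lambda>t. u t + w t)"
proof (rule L2_dominated)
  show "(\<lambda>t. u t + w t) measurable_on {0..T}"
    using assms by (auto simp: L2_def intro: measurable_on_add)
  show "(\<lambda>t. 2 * (norm (u t))\<^sup>2 + 2 * (norm (w t))\<^sup>2) integrable_on {0..T}"
    using assms by (intro integrable_add integrable_on_mult_right L2_square_integrable)
  fix t
  have "(norm (u t + w t))\<^sup>2 \<le> (norm (u t) + norm (w t))\<^sup>2"
    by (intro power_mono norm_triangle_ineq) auto
  also have "\<dots> \<le> 2 * (norm (u t))\<^sup>2 + 2 * (norm (w t))\<^sup>2"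
    using sum_squares_bound[of "norm (u t)" "norm (w t)"] by (simp add: power2_sum)
  finally show "(norm (u t + w t))\<^sup>2 \<le> 2 * (norm (u t))\<^sup>2 + 2 * (norm (w t))\<^sup>2" .
qed

lemma L2_uminus: "L2 T u \<Longrightarrow> L2 T (\<lambda>t. - u t)"
  using L2_scaleR[of T u "-1"] by simp

lemma L2_diff: "L2 T u \<Longrightarrow> L2 T w \<Longrightarrow> L2 T (\<lambda>t. u t - w t)"
  using L2_add[OF _ L2_uminus, of T u w] by simp

lemma measurable_on_subinterval:
  fixes f :: "real \<Rightarrow> 'b::real_normed_vector"
  assumes "f measurable_on S" "S' \<subseteq> S" "S' \<in> sets lebesgue"
  shows "f measurable_on S'"
proof -
  have "(\<lambda>x. if x \<in> S' then (if x \<in> S then f x else 0) else 0) measurable_on UNIV"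
    by (rule measurable_on_restrict) (use assms in \<open>auto simp: measurable_on_UNIV\<close>)
  also have "(\<lambda>x. if x \<in> S' then (if x \<in> S then f x else 0) else 0) = (\<lambda>x. if x \<in> S' then f x else 0)"
    using assms(2) by (intro ext) auto
  finally show ?thesis by (simp add: measurable_on_UNIV)
qed

lemma continuous_on_measurable_on_Icc:
  fixes f :: "real \<Rightarrow> 'b::real_normed_vector"
  assumes "continuous_on {a..b} f"
  shows "f measurable_on {a..b}"
proof (cases "a \<le> b")
  case True
  have "continuous_on UNIV (\<lambda>x. f (max a (min b x)))"
    by (rule continuous_on_compose2[OF assms]) (use True in \<open>auto intro!: continuous_intros\<close>)
  hence "(\<lambda>x. f (max a (min b x))) measurable_on {a..b}" by (rule continuous_measurable_on) auto
  thus ?thesis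
    by (rule measurable_on_spike[of _ _ "{}"]) (auto simp: max_def min_def)
qed (simp add: measurable_on_def exI[of _ "{}"] exI[of _ "\<lambda>_ _. 0"])

lemma L2_continuous:
  fixes u :: "real \<Rightarrow> 'b::real_normed_vector"
  assumes "continuous_on {0..T} u"
  shows "L2 T u"
  by (auto simp: L2_def intro!: continuous_on_measurable_on_Icc assms integrable_continuous_real continuous_intros)

lemma L2_inner_integrable:
  fixes u w :: "real \<Rightarrow> 'b::real_inner"
  assumes "L2 T u" "L2 T w"
  shows "(\<lambda>t. inner (u t) (w t)) integrable_on {0..T}"
proof (rule integrable_on_dominated)
  show "(\<lambda>t. inner (u t) (w t)) measurable_on {0..T}"
    using assms by (auto simp: L2_def intro: measurable_on_inner)
  show "(\<lambda>t. (norm (u t))\<^sup>2 + (norm (w t))\<^sup>2) integrable_on {0..T}"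
    using assms by (intro integrable_add L2_square_integrable)
  fix t
  have "norm (inner (u t) (w t)) \<le> norm (u t) * norm (w t)" using Cauchy_Schwarz_ineq2 by auto
  also have "\<dots> \<le> (norm (u t))\<^sup>2 + (norm (w t))\<^sup>2"
    using sum_squares_bound[of "norm (u t)" "norm (w t)"] mult_nonneg_nonneg[OF norm_ge_zero[of "u t"] norm_ge_zero[of "w t"]]
    unfolding mult.assoc by linarith
  finally show "norm (inner (u t) (w t)) \<le> (norm (u t))\<^sup>2 + (norm (w t))\<^sup>2" .
qed

lemma L2_norm_integrable:
  assumes "L2 T u"
  shows "(\<lambda>t. norm (u t)) integrable_on {0..T}"
proof -
  have "L2 T (\<lambda>t. norm (u t))" using assms by (auto simp: L2_def intro: measurable_on_norm)
  from L2_inner_integrable[OF this L2_continuous[OF continuous_on_const[of _ 1]]] show ?thesis by simp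
qed

lemma L2_subinterval:
  assumes "L2 T u" "s \<le> T"
  shows "L2 s u"
  using assms measurable_on_subinterval[of u "{0..T}" "{0..s}"] integrable_subinterval_real[of "\<lambda>t. (norm (u t))\<^sup>2" 0 T 0 s]
  by (auto simp: L2_def)

lemma L2_spike:
  fixes u w :: "real \<Rightarrow> 'b::real_normed_vector"
  assumes "L2 T u" "negligible N" "\<And>t. t \<in> {0..T} - N \<Longrightarrow> w t = u t"
  shows "L2 T w"
  using assms measurable_on_spike[of u "{0..T}" N w] integrable_spike[of "\<lambda>t. (norm (u t))\<^sup>2" "{0..T}" N "\<lambda>t. (norm (w t))\<^sup>2"]
  by (auto simp: L2_def)

lemma integral_shift_real:
  fixes f :: "real \<Rightarrow> 'b::real_normed_vector"
  shows "(\<lambda>t. f (s + t)) integrable_on {0..T} \<longleftrightarrow> f integrable_on {s..s+T}"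
    and "integral {0..T} (\<lambda>t. f (s + t)) = integral {s..s+T} f"
  using integrable_on_shift_Icc_real[of f s 0 T] integral_shift_Icc_real[of 0 T f s]
  by (auto simp: o_def add.commute)

lemma measurable_on_shift:
  fixes f :: "real \<Rightarrow> 'b::real_normed_vector"
  assumes "f measurable_on {s+a..s+b}"
  shows "(\<lambda>t. f (s + t)) measurable_on {a..b}"
proof -
  obtain N g where g: "negligible N" "\<And>n::nat. continuous_on UNIV (g n)"
    "\<And>x. x \<notin> N \<Longrightarrow> (\<lambda>n. g n x) \<longlonglongrightarrow> (if x \<in> {s+a..s+b} then f x else 0)"
    using assms unfolding measurable_on_def by blast
  show ?thesis unfolding measurable_on_def
  proof (intro exI conjI allI impI)
    show "negligible ((+) (-s) ` N)" using g(1) by (rule negligible_translation)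
    show "continuous_on UNIV (\<lambda>x. g n (s + x))" for n
      by (rule continuous_on_compose2[OF g(2)]) (auto intro!: continuous_intros)
    show "(\<lambda>n. g n (s + x)) \<longlonglongrightarrow> (if x \<in> {a..b} then f (s + x) else 0)" if "x \<notin> (+) (-s) ` N" for x
    proof -
      have "s + x \<notin> N" using that by (metis add.commute add_uminus_conv_diff add_diff_cancel_left' imageI)
      from g(3)[OF this] show ?thesis by (auto split: if_splits)
    qed
  qed
qed

lemma L2_shift:
  assumes "L2 T u" "0 \<le> s" "s \<le> T"
  shows "L2 (T - s) (\<lambda>t. u (s + t))"
proof -
  have "u measurable_on {s..s + (T-s)}"
    using assms measurable_on_subinterval[of u "{0..T}" "{s..T}"] by (auto simp: L2_def)
  moreover have "(\<lambda>t. (norm (u t))\<^sup>2) integrable_on {s..s + (T-s)}"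
    using assms integrable_subinterval_real[of "\<lambda>t. (norm (u t))\<^sup>2" 0 T s T] by (auto simp: L2_def)
  ultimately show ?thesis
    using measurable_on_shift[of u s 0 "T-s"]
    by (simp add: L2_def integral_shift_real(1)[of "\<lambda>t. (norm (u t))\<^sup>2"])
qed

text \<open>The second function runs on its own clock, started at \<open>s\<close>, and already
  supplies the value at \<open>s\<close>. The operation is applied to states as well as to
  controls.\<close>

definition concat_control :: "real \<Rightarrow> (real \<Rightarrow> 'u) \<Rightarrow> (real \<Rightarrow> 'u) \<Rightarrow> real \<Rightarrow> 'u" where
  "concat_control s u w t = (if t < s then u t else w (t - s))"

lemma measurable_on_Un_cases:
  fixes f g :: "real \<Rightarrow> 'b::real_normed_vector"
  assumes "f measurable_on {a..b}" "g measurable_on {b..c}" "a \<le> b" "b \<le> c"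
  shows "(\<lambda>t. if t < b then f t else g t) measurable_on {a..c}"
proof -
  have "(\<lambda>t. (if t \<in> {a..b} then f t else 0) + (if t \<in> {b..c} then g t else 0)) measurable_on UNIV"
    using assms by (intro measurable_on_add) (auto simp only: measurable_on_UNIV)
  hence "(\<lambda>t. if t \<in> {a..c} then (if t < b then f t else g t) else 0) measurable_on UNIV"
    by (rule measurable_on_spike[of _ _ "{b}"]) (use assms in auto)
  thus ?thesis by (simp only: measurable_on_UNIV)
qed

lemma L2_concat:
  fixes u w :: "real \<Rightarrow> 'b::real_normed_vector"
  assumes u: "L2 s u" and w: "L2 (T - s) w" and s: "0 \<le> s" "s \<le> T"
  shows "L2 T (concat_control s u w)"
  unfolding L2_def
proof
  have "(\<lambda>t. w (t - s)) measurable_on {s..T}"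
    using measurable_on_shift[of w "-s" s T] w by (simp add: L2_def)
  from measurable_on_Un_cases[OF _ this s, of u] show "concat_control s u w measurable_on {0..T}"
    using u by (simp add: L2_def concat_control_def[abs_def])
  show "(\<lambda>t. (norm (concat_control s u w t))\<^sup>2) integrable_on {0..T}"
  proof (rule Henstock_Kurzweil_Integration.integrable_combine[OF s])
    show "(\<lambda>t. (norm (concat_control s u w t))\<^sup>2) integrable_on {0..s}"
      by (rule integrable_spike[OF L2_square_integrable[OF u], of "{s}"]) (auto simp: concat_control_def)
    have "(\<lambda>t. (norm (concat_control s u w (s + t)))\<^sup>2) integrable_on {0..T - s}"
      by (rule integrable_eq[OF L2_square_integrable[OF w]]) (auto simp: concat_control_def)
    thus "(\<lambda>t. (norm (concat_control s u w t))\<^sup>2) integrable_on {s..T}"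
      using integral_shift_real(1)[of "\<lambda>t. (norm (concat_control s u w t))\<^sup>2" s "T - s"] by simp
  qed
qed

text \<open>Cauchy-Schwarz against the constant 1, in the form that the variance of
  \<open>norm (u t)\<close> about its mean \<open>m\<close> is nonnegative.\<close>

lemma integral_norm_le_L2:
  assumes u: "L2 T u" and T: "0 \<le> T"
  shows "integral {0..T} (\<lambda>t. norm (u t)) \<le> sqrt T * sqrt (integral {0..T} (\<lambda>t. (norm (u t))\<^sup>2))"
proof (cases "T = 0")
  case False
  hence T: "T > 0" using T by simp
  define m where "m = integral {0..T} (\<lambda>t. norm (u t)) / T"
  note i = L2_norm_integrable[OF u] L2_square_integrable[OF u]
  have "0 \<le> integral {0..T} (\<lambda>t. (norm (u t))\<^sup>2 + (m\<^sup>2 - (2 * m) * norm (u t)))"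
  proof (rule integral_nonneg)
    show "0 \<le> (norm (u t))\<^sup>2 + (m\<^sup>2 - (2 * m) * norm (u t))" for t
      using zero_le_power2[of "norm (u t) - m"] by (simp add: power2_diff algebra_simps)
  qed (intro integrable_add integrable_diff integrable_on_mult_right i, auto)
  also have "\<dots> = integral {0..T} (\<lambda>t. (norm (u t))\<^sup>2) + (m\<^sup>2 * T - (2 * m) * integral {0..T} (\<lambda>t. norm (u t)))"
  proof -
    have c: "(\<lambda>t. m\<^sup>2) integrable_on {0..T}" and c2: "(\<lambda>t. (2*m) * norm (u t)) integrable_on {0..T}"
      using integrable_on_mult_right[OF i(1)] by auto
    show ?thesis using T
      by (subst integral_add[OF i(2) integrable_diff[OF c c2]], subst integral_diff[OF c c2]) simp
  qed
  also have "(2 * m) * integral {0..T} (\<lambda>t. norm (u t)) = 2 * m\<^sup>2 * T"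
    using T by (simp add: m_def power2_eq_square)
  finally have "m\<^sup>2 * T * T \<le> T * integral {0..T} (\<lambda>t. (norm (u t))\<^sup>2)"
    using T by (simp add: mult.commute)
  moreover have "m\<^sup>2 * T * T = (integral {0..T} (\<lambda>t. norm (u t)))\<^sup>2"
    using T by (simp add: m_def power2_eq_square)
  ultimately show ?thesis using real_le_rsqrt by (simp add: real_sqrt_mult[symmetric])
qed simp

section \<open>Completeness of the square integrable functions\<close>

definition sqnorm :: "real \<Rightarrow> (real \<Rightarrow> 'u::real_normed_vector) \<Rightarrow> real" where
  "sqnorm T u = integral {0..T} (\<lambda>t. (norm (u t))\<^sup>2)"

lemma sqnorm_nonneg [simp]: "sqnorm T u \<ge> 0"
  unfolding sqnorm_def by (cases "(\<lambda>t. (norm (u t))\<^sup>2) integrable_on {0..T}")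
    (auto intro: integral_nonneg simp: not_integrable_integral)

lemma nn_integral_square:
  assumes "L2 T u"
  shows "(\<integral>\<^sup>+t. ennreal ((norm (u t))\<^sup>2) \<partial>lebesgue_on {0..T}) = ennreal (sqnorm T u)"
proof -
  have i: "integrable (lebesgue_on {0..T}) (\<lambda>t. (norm (u t))\<^sup>2)"
    using L2_square_integrable[OF assms] by (simp add: integrable_lebesgue_on_iff)
  thus ?thesis
    by (subst nn_integral_eq_integral) (auto simp: sqnorm_def lebesgue_integral_eq_integral)
qed

text \<open>The norms of the increments have integrals at most \<open>sqrt T * (1/2)^n\<close>, so
  their sum is integrable, hence finite almost everywhere, and the telescoping series converges
  absolutely there. The base 1/4 belongs to squared norms.\<close>

lemma L2_geometric_Cauchy_AE_convergent:
  fixes f :: "nat \<Rightarrow> real \<Rightarrow> 'u::banach"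
  assumes f: "\<And>n. L2 T (f n)" and T: "0 \<le> T"
    and geo: "\<And>n. sqnorm T (\<lambda>t. f (Suc n) t - f n t) \<le> (1/4)^n"
  shows "AE t in lebesgue_on {0..T}. convergent (\<lambda>n. f n t)"
proof -
  let ?M = "lebesgue_on {0..T}"
  define g where "g n t = norm (f (Suc n) t - f n t)" for n t
  have L2g: "L2 T (\<lambda>t. f (Suc n) t - f n t)" for n by (intro L2_diff f)
  have gi: "integrable ?M (g n)" for n
    using L2_norm_integrable[OF L2g] by (simp add: integrable_lebesgue_on_iff g_def[abs_def])
  have gint: "(\<integral>\<^sup>+t. ennreal (g n t) \<partial>?M) \<le> ennreal (sqrt T * (1/2)^n)" for n
  proof -
    have "(\<integral>\<^sup>+t. ennreal (g n t) \<partial>?M) = ennreal (integral {0..T} (g n))"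
      using gi[of n] by (subst nn_integral_eq_integral) (auto simp: lebesgue_integral_eq_integral g_def)
    also have "integral {0..T} (g n) \<le> sqrt T * sqrt (sqnorm T (\<lambda>t. f (Suc n) t - f n t))"
      using integral_norm_le_L2[OF L2g T] by (simp add: g_def[abs_def] sqnorm_def)
    also have "\<dots> \<le> sqrt T * sqrt ((1/4)^n)"
      using geo T by (intro mult_left_mono real_sqrt_le_mono) auto
    also have "sqrt ((1/4)^n) = (1/2::real)^n"
      by (simp add: real_sqrt_power real_sqrt_divide)
    finally show ?thesis by (simp add: ennreal_leI)
  qed
  have "(\<integral>\<^sup>+t. (\<Sum>n. ennreal (g n t)) \<partial>?M) = (\<Sum>n. \<integral>\<^sup>+t. ennreal (g n t) \<partial>?M)"
    using gi by (intro nn_integral_suminf) auto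
  also have "\<dots> \<le> (\<Sum>n. ennreal (sqrt T * (1/2)^n))"
    by (intro suminf_le gint) auto
  also have "\<dots> = ennreal (\<Sum>n. sqrt T * (1/2)^n)"
    using T by (intro suminf_ennreal2) (auto intro!: summable_mult summable_geometric)
  also have "\<dots> < \<infinity>" by simp
  finally have "AE t in ?M. (\<Sum>n. ennreal (g n t)) \<noteq> \<infinity>"
    using gi by (intro nn_integral_PInf_AE) auto
  thus ?thesis
  proof eventually_elim
    case (elim t)
    have "summable (\<lambda>n. g n t)"
      by (rule summable_suminf_not_top) (use elim in \<open>auto simp: g_def\<close>)
    hence "summable (\<lambda>n. f (Suc n) t - f n t)" unfolding g_def by (rule summable_norm_cancel)
    hence "convergent (\<lambda>n. \<Sum>i<n. f (Suc i) t - f i t)" by (simp add: summable_iff_convergent)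
    hence "convergent (\<lambda>n. f n t - f 0 t)" by (simp add: sum_lessThan_telescope[of "\<lambda>n. f n t"])
    from convergent_add[OF this convergent_const[of "f 0 t"]] show ?case by simp
  qed
qed

text \<open>Riesz-Fischer for functions without passing to classes: a fast subsequence converges
  almost everywhere, and Fatou's lemma transfers the Cauchy estimate to its limit. It supplies the
  limit of minimizing sequences of controls.\<close>

lemma L2_complete:
  fixes f :: "nat \<Rightarrow> real \<Rightarrow> 'u::banach"
  assumes f: "\<And>n. L2 T (f n)" and T: "0 \<le> T"
    and Cauchy: "\<And>e. e > 0 \<Longrightarrow> \<exists>N. \<forall>m\<ge>N. \<forall>n\<ge>N. sqnorm T (\<lambda>t. f m t - f n t) < e"
  shows "\<exists>F. L2 T F \<and> (\<lambda>n. sqnorm T (\<lambda>t. f n t - F t)) \<longlonglongrightarrow> 0"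
proof -
  let ?M = "lebesgue_on {0..T}"
  have "\<forall>k. \<exists>N. \<forall>m\<ge>N. \<forall>n\<ge>N. sqnorm T (\<lambda>t. f m t - f n t) < (1/4)^k"
    using Cauchy by simp
  then obtain N where N: "\<And>k m n. m \<ge> N k \<Longrightarrow> n \<ge> N k \<Longrightarrow> sqnorm T (\<lambda>t. f m t - f n t) < (1/4)^k"
    by metis
  \<comment> \<open>The sum makes \<open>r\<close> monotone and at least \<open>N k\<close>; the
    summand \<open>k\<close> makes it exceed every threshold eventually, as the Fatou argument
    requires.\<close>
  define r where "r k = (\<Sum>i\<le>k. N i) + k" for k
  have r: "N k \<le> r k" "r k \<le> r (Suc k)" "k \<le> r k" for k
    by (auto simp: r_def intro!: trans_le_add1 member_le_sum)
  have "AE t in ?M. convergent (\<lambda>k. f (r k) t)"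
  proof (rule L2_geometric_Cauchy_AE_convergent[OF f T])
    show "sqnorm T (\<lambda>t. f (r (Suc k)) t - f (r k) t) \<le> (1/4)^k" for k
      using N[of k "r (Suc k)" "r k"] r[of k] by simp
  qed
  hence lim: "AE t in ?M. (\<lambda>k. f (r k) t) \<longlonglongrightarrow> lim (\<lambda>k. f (r k) t)"
    by eventually_elim (simp add: convergent_LIMSEQ_iff)
  define F where "F t = lim (\<lambda>k. f (r k) t)" for t
  have Fm: "F measurable_on {0..T}"
    by (rule measurable_on_AE_limit[of _ "\<lambda>k. f (r k)"]) (use f lim in \<open>auto simp: L2_def F_def\<close>)
  have key: "L2 T (\<lambda>t. f n t - F t) \<and> sqnorm T (\<lambda>t. f n t - F t) \<le> (1/4)^k" if n: "n \<ge> N k" for n k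
  proof -
    have "AE t in ?M. ennreal ((norm (f n t - F t))\<^sup>2) = liminf (\<lambda>j. ennreal ((norm (f n t - f (r j) t))\<^sup>2))"
      using lim
    proof eventually_elim
      case (elim t)
      have "(\<lambda>j. ennreal ((norm (f n t - f (r j) t))\<^sup>2)) \<longlonglongrightarrow> ennreal ((norm (f n t - F t))\<^sup>2)"
        using elim by (intro tendsto_intros tendsto_ennrealI) (simp add: F_def)
      from lim_imp_Liminf[OF _ this] show ?case by simp
    qed
    hence "(\<integral>\<^sup>+t. ennreal ((norm (f n t - F t))\<^sup>2) \<partial>?M) = (\<integral>\<^sup>+t. liminf (\<lambda>j. ennreal ((norm (f n t - f (r j) t))\<^sup>2)) \<partial>?M)"
      by (rule nn_integral_cong_AE)
    also have "\<dots> \<le> liminf (\<lambda>j. \<integral>\<^sup>+t. ennreal ((norm (f n t - f (r j) t))\<^sup>2) \<partial>?M)"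
    proof (rule nn_integral_liminf)
      show "(\<lambda>t. ennreal ((norm (f n t - f (r j) t))\<^sup>2)) \<in> borel_measurable ?M" for j
        using borel_measurable_norm_diff[of "f n" "{0..T}" "f (r j)"] f by (auto simp: L2_def)
    qed
    also have "\<dots> \<le> ennreal ((1/4)^k)"
    proof -
      have "eventually (\<lambda>j. (\<integral>\<^sup>+t. ennreal ((norm (f n t - f (r j) t))\<^sup>2) \<partial>?M) \<le> ennreal ((1/4)^k)) sequentially"
        using eventually_ge_at_top[of "N k"]
      proof eventually_elim
        case (elim j)
        have "r j \<ge> N k" using r(3)[of j] elim by simp
        from N[OF n this] show ?case
          using nn_integral_square[OF L2_diff[OF f f], of n "r j"] by (simp add: ennreal_leI)
      qed
      hence "liminf (\<lambda>j. \<integral>\<^sup>+t. ennreal ((norm (f n t - f (r j) t))\<^sup>2) \<partial>?M) \<le> liminf (\<lambda>j::nat. ennreal ((1/4)^k))"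
        by (rule Liminf_mono)
      thus ?thesis by (simp add: Liminf_const)
    qed
    finally have le: "(\<integral>\<^sup>+t. ennreal ((norm (f n t - F t))\<^sup>2) \<partial>?M) \<le> ennreal ((1/4)^k)" .
    have m: "(\<lambda>t. f n t - F t) measurable_on {0..T}"
      using f Fm by (auto simp: L2_def intro: measurable_on_diff)
    have "(\<lambda>t. (norm (f n t - F t))\<^sup>2) \<in> borel_measurable ?M"
      using borel_measurable_norm_diff[of "f n" "{0..T}" F] f Fm by (auto simp: L2_def)
    hence "integrable ?M (\<lambda>t. (norm (f n t - F t))\<^sup>2)"
      using le by (intro integrableI_bounded) (auto simp: le_less_trans[OF le])
    hence L: "L2 T (\<lambda>t. f n t - F t)"
      using m by (auto simp: L2_def integrable_lebesgue_on_iff)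
    show ?thesis using le L by (simp add: nn_integral_square[OF L])
  qed
  have "L2 T (\<lambda>t. f (N 0) t - (f (N 0) t - F t))" by (rule L2_diff[OF f key[THEN conjunct1, OF order_refl]])
  moreover have "(\<lambda>t. f (N 0) t - (f (N 0) t - F t)) = F" by (intro ext) simp
  ultimately have "L2 T F" by metis
  moreover have "(\<lambda>n. sqnorm T (\<lambda>t. f n t - F t)) \<longlonglongrightarrow> 0"
  proof (rule LIMSEQ_I)
    fix e :: real assume "e > 0"
    then obtain k where "(1/4)^k < e" using real_arch_pow_inv[of e "1/4"] by auto
    thus "\<exists>no. \<forall>n\<ge>no. norm (sqnorm T (\<lambda>t. f n t - F t) - 0) < e"
      using key by (intro exI[of _ "N k"]) (auto intro: le_less_trans)
  qed
  ultimately show ?thesis by blast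
qed

section \<open>Strongly continuous semigroups\<close>

text \<open>Baire's theorem yields one ball on which all the operators are bounded by the same
  \<open>n\<close>; subtracting the value at its center and scaling moves the bound to every
  \<open>x\<close>.\<close>

lemma banach_steinhaus:
  fixes F :: "'i \<Rightarrow> 'a::banach \<Rightarrow> 'b::real_normed_vector"
  assumes lin: "\<And>i. i \<in> I \<Longrightarrow> bounded_linear (F i)" and bdd: "\<And>x. \<exists>c. \<forall>i\<in>I. norm (F i x) \<le> c"
  shows "\<exists>M. \<forall>i\<in>I. \<forall>x. norm (F i x) \<le> M * norm x"
proof -
  define E where "E n = {x. \<forall>i\<in>I. norm (F i x) \<le> real n}" for n :: nat
  have cl: "closed (E n)" for n
  proof -
    have "E n = (\<Inter>i\<in>I. {x. norm (F i x) \<le> real n})" by (auto simp: E_def)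
    moreover have "closed {x. norm (F i x) \<le> real n}" if "i \<in> I" for i
      by (intro closed_Collect_le continuous_intros linear_continuous_on lin that)
    ultimately show ?thesis by auto
  qed
  have "(\<Union>n. E n) = UNIV"
  proof -
    have "\<exists>n. x \<in> E n" for x
    proof -
      obtain c where "\<forall>i\<in>I. norm (F i x) \<le> c" using bdd by blast
      moreover obtain n :: nat where "c \<le> real n" using real_arch_simple by blast
      ultimately have "x \<in> E n" by (auto simp: E_def intro: order_trans)
      thus ?thesis ..
    qed
    thus ?thesis by blast
  qed
  have "\<exists>n. interior (E n) \<noteq> {}"
  proof (rule ccontr)
    assume "\<nexists>n. interior (E n) \<noteq> {}"
    hence "euclidean interior_of \<Union>(range E) = {}"
      by (intro Baire_category_alt) (use cl completely_metrizable_space_euclidean in auto)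
    thus False using \<open>(\<Union>n. E n) = UNIV\<close> by simp
  qed
  then obtain n x0 r where r: "r > 0" "ball x0 r \<subseteq> E n"
    by (metis ex_in_conv mem_interior)
  show ?thesis
  proof (intro exI ballI allI)
    fix i x assume i: "i \<in> I"
    interpret bounded_linear "F i" by (rule lin[OF i])
    show "norm (F i x) \<le> (4 * real n / r) * norm x"
    proof (cases "x = 0")
      case False
      define a where "a = r / (2 * norm x)"
      have a: "a > 0" using False r by (simp add: a_def)
      have "norm (a *\<^sub>R x) < r" using False r by (simp add: a_def)
      hence "x0 + a *\<^sub>R x \<in> E n" "x0 \<in> E n" using r by (auto simp: subset_iff dist_norm)
      hence "norm (F i (x0 + a *\<^sub>R x)) \<le> real n" "norm (F i x0) \<le> real n" using i by (auto simp: E_def)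
      moreover have "a *\<^sub>R F i x = F i (x0 + a *\<^sub>R x) - F i x0" by (simp add: add scaleR)
      ultimately have "a * norm (F i x) \<le> 2 * real n"
        using norm_triangle_ineq4[of "F i (x0 + a *\<^sub>R x)" "F i x0"] a
        by (metis (no_types, lifting) abs_of_pos add_mono mult_2 norm_scaleR order_trans)
      thus ?thesis using a False r by (simp add: a_def field_simps)
    qed (simp add: zero)
  qed
qed

lemmas integral_split = Henstock_Kurzweil_Integration.integral_combine

section \<open>Integrable functions and convolution with a strongly continuous family\<close>

definition L1 :: "real \<Rightarrow> (real \<Rightarrow> 'u::real_normed_vector) \<Rightarrow> bool" where
  "L1 T u \<longleftrightarrow> u measurable_on {0..T} \<and> (\<lambda>t. norm (u t)) integrable_on {0..T}"

lemma L2_imp_L1: "L2 T u \<Longrightarrow> L1 T u"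
  using L2_norm_integrable L1_def L2_def by blast

lemma L1_subinterval:
  assumes "L1 T u" "s \<le> T"
  shows "L1 s u"
  using assms measurable_on_subinterval[of u "{0..T}" "{0..s}"] integrable_subinterval_real[of "\<lambda>t. norm (u t)" 0 T 0 s]
  by (auto simp: L1_def)

lemma L1_dominated:
  assumes "u measurable_on {0..T}" "g integrable_on {0..T}" "\<And>t. t \<in> {0..T} \<Longrightarrow> norm (u t) \<le> g t"
  shows "L1 T u"
  using integrable_on_dominated[OF measurable_on_norm[OF assms(1)] assms(2)] assms by (simp add: L1_def)

lemma L1_bounded_linear:
  assumes "L1 T u" "bounded_linear F"
  shows "L1 T (\<lambda>t. F (u t))"
proof -
  obtain k where k: "\<And>x. norm (F x) \<le> norm x * k"
    using bounded_linear.bounded[OF assms(2)] by blast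
  show ?thesis
    by (rule L1_dominated[of _ _ "\<lambda>t. norm (u t) * k"])
      (use assms k in \<open>auto simp: L1_def intro: measurable_on_bounded_linear integrable_on_mult_left\<close>)
qed

lemma L1_diff:
  assumes "L1 T u" "L1 T w"
  shows "L1 T (\<lambda>t. u t - w t)"
  by (rule L1_dominated[of _ _ "\<lambda>t. norm (u t) + norm (w t)"])
    (use assms in \<open>auto simp: L1_def intro: measurable_on_diff integrable_add norm_triangle_ineq4\<close>)

lemma L1_shift:
  assumes "L1 T u" "0 \<le> s" "s \<le> T"
  shows "L1 (T - s) (\<lambda>t. u (s + t))"
  using measurable_on_shift[of u s 0 "T-s"] measurable_on_subinterval[of u "{0..T}" "{s..T}"] assms
        integral_shift_real(1)[of "\<lambda>r. norm (u r)" s "T-s"]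
        integrable_subinterval_real[of "\<lambda>r. norm (u r)" 0 T s T]
  by (auto simp: L1_def)

lemma L1_integrable:
  fixes u :: "real \<Rightarrow> 'b::banach"
  assumes "L1 T u" "t \<le> T"
  shows "u integrable_on {0..t}"
  using L1_subinterval[OF assms] by (auto simp: L1_def intro: integrable_on_dominated)

text \<open>Both the semigroup and its time integral have these properties; the locale lets
  measurability and integrability of convolutions be shown once for the two.\<close>

locale strongly_continuous_family =
  fixes W :: "real \<Rightarrow> 'a::banach \<Rightarrow> 'b::banach"
  assumes linear: "t \<ge> 0 \<Longrightarrow> bounded_linear (W t)"
    and bounded: "\<exists>M\<ge>0. \<forall>t\<in>{0..T}. \<forall>x. norm (W t x) \<le> M * norm x"
    and continuous: "continuous_on {0..} (\<lambda>t. W t x)"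
begin

lemma W_diff: "t \<ge> 0 \<Longrightarrow> W t (x - y) = W t x - W t y"
  using linear bounded_linear.linear linear_diff by blast

lemma continuous_compose:
  assumes g: "continuous_on X g" and p: "continuous_on X p" and pos: "\<And>x. x \<in> X \<Longrightarrow> p x \<ge> 0"
  shows "continuous_on X (\<lambda>s. W (p s) (g s))"
proof (unfold continuous_on_def, intro ballI)
  fix s assume s: "s \<in> X"
  obtain M where M: "M \<ge> 0" "\<And>r x. r \<in> {0..p s+1} \<Longrightarrow> norm (W r x) \<le> M * norm x"
    using bounded[of "p s+1"] by blast
  have 1: "(g \<longlongrightarrow> g s) (at s within X)" and 2: "(p \<longlongrightarrow> p s) (at s within X)"
    using g p s by (auto simp: continuous_on_def)
  have 3: "((\<lambda>r. W (p r) (g s)) \<longlongrightarrow> W (p s) (g s)) (at s within X)"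
    using continuous_on_compose2[OF continuous p, of "g s"] pos s by (auto simp: continuous_on_def)
  have "((\<lambda>r. W (p r) (g r - g s)) \<longlongrightarrow> 0) (at s within X)"
  proof (rule Lim_null_comparison)
    have "eventually (\<lambda>r. p r < p s + 1) (at s within X)" using order_tendstoD(2)[OF 2, of "p s + 1"] by simp
    moreover have "eventually (\<lambda>r. r \<in> X) (at s within X)" by (simp add: eventually_at_filter)
    ultimately show "eventually (\<lambda>r. norm (W (p r) (g r - g s)) \<le> M * norm (g r - g s)) (at s within X)"
      by eventually_elim (use M pos in auto)
    show "((\<lambda>r. M * norm (g r - g s)) \<longlongrightarrow> 0) (at s within X)"
      using tendsto_mult_right_zero[OF tendsto_norm_zero[OF LIM_zero[OF 1]]] .
  qed
  from tendsto_add[OF this 3] have "((\<lambda>r. W (p r) (g r - g s) + W (p r) (g s)) \<longlongrightarrow> W (p s) (g s)) (at s within X)" by simp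
  moreover have "eventually (\<lambda>r. W (p r) (g r - g s) + W (p r) (g s) = W (p r) (g r)) (at s within X)"
    by (simp add: eventually_at_filter W_diff pos)
  ultimately show "((\<lambda>s. W (p s) (g s)) \<longlongrightarrow> W (p s) (g s)) (at s within X)"
    by (rule Lim_transform_eventually)
qed

lemma convolution_measurable:
  assumes "f measurable_on {0..t}"
  shows "(\<lambda>s. W (t - s) (f s)) measurable_on {0..t}"
proof -
  obtain g where g: "\<And>n. continuous_on UNIV (g n)" "AE x in lebesgue_on {0..t}. (\<lambda>n. g n x) \<longlonglongrightarrow> f x"
    using measurable_on_obtain_continuous[OF assms] by (metis lmeasurable_cbox interval_cbox fmeasurableD)
  show ?thesis
  proof (rule AE_limit_continuous_measurable_on)
    \<comment> \<open>The family is controlled only for nonnegative times, so the time argument is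
      clamped to obtain a function continuous on the whole line.\<close>
    show "continuous_on UNIV (\<lambda>s. W (max 0 (t - s)) (g n s))" for n
      by (rule continuous_compose[OF g(1)]) (auto intro!: continuous_intros)
    have "AE s in lebesgue_on {0..t}. s \<in> {0..t}"
      using AE_space[of "lebesgue_on {0..t}"] by simp
    with g(2) show "AE s in lebesgue_on {0..t}. (\<lambda>n. W (max 0 (t - s)) (g n s)) \<longlonglongrightarrow> W (t - s) (f s)"
    proof eventually_elim
      case (elim s)
      hence [simp]: "max 0 (t - s) = t - s" by auto
      show ?case
        using bounded_linear.tendsto[OF linear[of "t - s"] elim(1)] elim(2) by simp
    qed
  qed simp
qed

lemma convolution_integrable:
  assumes "L1 t f"
  shows "(\<lambda>s. W (t - s) (f s)) integrable_on {0..t}"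
proof -
  obtain M where M: "M \<ge> 0" "\<And>r x. r \<in> {0..t} \<Longrightarrow> norm (W r x) \<le> M * norm x"
    using bounded[of "t"] by blast
  show ?thesis
  proof (rule integrable_on_dominated)
    show "(\<lambda>s. W (t - s) (f s)) measurable_on {0..t}"
      using assms by (intro convolution_measurable) (simp add: L1_def)
    show "(\<lambda>s. M * norm (f s)) integrable_on {0..t}"
      using assms by (intro integrable_on_mult_right) (simp add: L1_def)
  qed (use M in auto)
qed

end

section \<open>Strongly continuous semigroups, their convolutions and their integrals\<close>

locale c0_semigroup =
  fixes S :: "real \<Rightarrow> 'h::chilbert_space \<Rightarrow> 'h"
  assumes S_linear: "t \<ge> 0 \<Longrightarrow> bounded_linear (S t)"
    and S_zero [simp]: "S 0 x = x"
    and S_add: "s \<ge> 0 \<Longrightarrow> t \<ge> 0 \<Longrightarrow> S (s + t) x = S s (S t x)"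
    and S_right_limit: "((\<lambda>t. S t x) \<longlongrightarrow> x) (at_right 0)"
begin

text \<open>If bounds failed on every interval at 0, there would be times \<open>t n\<close> tending
  to 0 with operator norms above \<open>n\<close>. But \<open>S (t n) x\<close> converges for each
  \<open>x\<close>, which the uniform boundedness principle excludes.\<close>

lemma S_bounded_near_zero: "\<exists>d>0. \<exists>M\<ge>1. \<forall>t\<in>{0..d}. \<forall>x. norm (S t x) \<le> M * norm x"
proof (rule ccontr)
  assume neg: "\<not> ?thesis"
  have "\<exists>t\<in>{0..1 / Suc n}. \<exists>x. \<not> norm (S t x) \<le> Suc n * norm x" for n
  proof (rule ccontr)
    assume "\<not> (\<exists>t\<in>{0..1 / Suc n}. \<exists>x. \<not> norm (S t x) \<le> Suc n * norm x)"
    hence "\<forall>t\<in>{0..1 / Suc n}. \<forall>x. norm (S t x) \<le> Suc n * norm x" by blast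
    moreover have "1 / real (Suc n) > 0" "real (Suc n) \<ge> 1" by auto
    ultimately show False using neg by blast
  qed
  then obtain t where t: "\<And>n. t n \<in> {0..1 / Suc n}" "\<And>n. \<exists>x. \<not> norm (S (t n) x) \<le> Suc n * norm x" by metis
  have t0: "t \<longlonglongrightarrow> 0"
    by (rule tendsto_sandwich[OF _ _ tendsto_const LIMSEQ_inverse_real_of_nat])
      (use t(1) in \<open>auto simp: inverse_eq_divide\<close>)
  \<comment> \<open>Time 0 has to be ruled out because the continuity assumption speaks of times
    approaching 0 from the right.\<close>
  have tpos: "t n > 0" for n
  proof (rule ccontr)
    assume "\<not> t n > 0"
    hence "t n = 0" using t(1)[of n] by auto
    with t(2)[of n] obtain x :: 'h where "\<not> norm x \<le> Suc n * norm x" by (metis S_zero)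
    moreover have "1 * norm x \<le> Suc n * norm x" by (intro mult_right_mono) auto
    ultimately show False by simp
  qed
  have "\<exists>M. \<forall>n\<in>UNIV. \<forall>x. norm (S (t n) x) \<le> M * norm x"
  proof (rule banach_steinhaus)
    fix x
    have "filterlim t (at_right 0) sequentially"
      using t0 tpos by (intro tendsto_imp_filterlim_at_right) auto
    with S_right_limit[of x] have "(\<lambda>n. S (t n) x) \<longlonglongrightarrow> x" by (rule filterlim_compose)
    hence "Bseq (\<lambda>n. S (t n) x)" by (intro convergent_imp_Bseq convergentI)
    thus "\<exists>c. \<forall>n\<in>UNIV. norm (S (t n) x) \<le> c" by (auto simp: Bseq_def)
  qed (use S_linear t in auto)
  then obtain M where M: "\<And>n x. norm (S (t n) x) \<le> M * norm x" by auto
  obtain n where "M \<le> real n" using real_arch_simple by blast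
  with t(2)[of n] M[of n] show False
    by (smt (verit, best) mult_right_mono norm_ge_zero of_nat_Suc)
qed

lemma S_bounded: "\<exists>M\<ge>1. \<forall>t\<in>{0..T}. \<forall>x. norm (S t x) \<le> M * norm x"
proof -
  obtain d M where d: "d > 0" "M \<ge> 1" "\<And>t x. t \<in> {0..d} \<Longrightarrow> norm (S t x) \<le> M * norm x"
    using S_bounded_near_zero by blast
  have *: "\<forall>t\<in>{0..real n * d}. \<forall>x. norm (S t x) \<le> M^n * norm x" for n
  proof (induction n)
    case (Suc n)
    show ?case
    proof (intro ballI allI)
      fix t x assume t: "t \<in> {0..real (Suc n) * d}"
      show "norm (S t x) \<le> M ^ Suc n * norm x"
      proof (cases "t \<le> d")
        case True
        hence "norm (S t x) \<le> M * norm x" using d t by auto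
        also have "\<dots> \<le> M ^ Suc n * norm x"
          using d(2) power_increasing[of 1 "Suc n" M] by (intro mult_right_mono) auto
        finally show ?thesis .
      next
        case False
        have "S t x = S d (S (t - d) x)" using S_add[of d "t-d" x] False d by simp
        also have "norm \<dots> \<le> M * norm (S (t - d) x)" using d by auto
        also have "\<dots> \<le> M * (M^n * norm x)"
          using Suc[rule_format, of "t-d" x] False d t by (intro mult_left_mono) (auto simp: algebra_simps)
        finally show ?thesis by simp
      qed
    qed
  qed simp
  obtain n where "T \<le> real n * d" using reals_Archimedean3[OF d(1)] less_imp_le by blast
  with *[of n] show ?thesis using d(2) by (intro exI[of _ "M^n"]) (auto simp: one_le_power)
qed

lemma S_near: 
  assumes "e > 0"
  shows "\<exists>d>0. \<forall>h\<in>{0..d}. norm (S h x - x) < e"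
proof -
  have "eventually (\<lambda>t. dist (S t x) x < e) (at_right 0)"
    using tendstoD[OF S_right_limit assms] .
  then obtain b where b: "b > 0" "\<And>t. t > 0 \<Longrightarrow> t < b \<Longrightarrow> dist (S t x) x < e"
    unfolding eventually_at_right_field by auto
  show ?thesis
  proof (intro exI[of _ "b/2"] conjI ballI)
    fix h assume "h \<in> {0..b/2}"
    thus "norm (S h x - x) < e" using b(1) b(2)[of h] assms by (cases "h = 0") (auto simp: dist_norm)
  qed (use b in auto)
qed

lemma S_diff: "t \<ge> 0 \<Longrightarrow> S t (x - y) = S t x - S t y"
  using S_linear bounded_linear.linear linear_diff by blast

lemma S_plus: "t \<ge> 0 \<Longrightarrow> S t (x + y) = S t x + S t y"
  using S_linear bounded_linear.linear linear_add by blast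

lemma S_scaleR: "t \<ge> 0 \<Longrightarrow> S t (c *\<^sub>R y) = c *\<^sub>R S t y"
  using S_linear bounded_linear.linear linear_scale by blast

lemma S_zero_right [simp]: "t \<ge> 0 \<Longrightarrow> S t 0 = 0"
  using S_linear bounded_linear.linear linear_0 by blast

text \<open>Writing \<open>S b x - S a x = S a (S (b - a) x - x)\<close> treats continuity from the
  left like continuity from the right; the bound on \<open>S a\<close> for
  \<open>a \<le> t + 1\<close> makes the estimate uniform in \<open>a\<close>.\<close>

lemma S_continuous: "continuous_on {0..} (\<lambda>t. S t x)"
proof (unfold continuous_on_iff, intro ballI allI impI)
  fix t e :: real assume t: "t \<in> {0..}" and e: "e > 0"
  obtain M where M: "M \<ge> 1" "\<And>s x. s \<in> {0..t+1} \<Longrightarrow> norm (S s x) \<le> M * norm x"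
    using S_bounded[of "t+1"] by blast
  obtain d where d: "d > 0" "\<And>h. h\<in>{0..d} \<Longrightarrow> norm (S h x - x) < e / M" using S_near[of "e/M" x] e M by auto
  have *: "norm (S b x - S a x) < e" if "0 \<le> a" "a \<le> b" "b \<le> t + 1" "b - a \<le> d" for a b
  proof -
    have "S b x - S a x = S a (S (b - a) x - x)" using S_add[of a "b-a" x] S_diff[of a] that by simp
    also have "norm \<dots> \<le> M * norm (S (b - a) x - x)" using M that by auto
    also have "\<dots> < M * (e / M)" using d(2)[of "b-a"] M that by (intro mult_strict_left_mono) auto
    finally show ?thesis using M by simp
  qed
  show "\<exists>d>0. \<forall>s\<in>{0..}. dist s t < d \<longrightarrow> dist (S s x) (S t x) < e"
  proof (intro exI[of _ "min d 1"] conjI ballI impI)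
    fix s assume "s \<in> {0..}" "dist s t < min d 1"
    thus "dist (S s x) (S t x) < e"
      using *[of s t] *[of t s] t by (cases "s \<le> t") (auto simp: dist_norm dist_real_def norm_minus_commute abs_if split: if_splits)
  qed (use d in auto)
qed

sublocale strongly_continuous_family S
proof (rule strongly_continuous_family.intro)
  show "\<exists>M\<ge>0. \<forall>t\<in>{0..T}. \<forall>x. norm (S t x) \<le> M * norm x" for T
    using S_bounded[of T] zero_le_one order_trans by blast
  show "bounded_linear (S t)" if "t \<ge> 0" for t by (rule S_linear[OF that])
qed (rule S_continuous)

definition conv :: "real \<Rightarrow> (real \<Rightarrow> 'h) \<Rightarrow> 'h" where
  "conv t f = integral {0..t} (\<lambda>s. S (t - s) (f s))"

lemma conv_bound: "\<exists>M\<ge>1. \<forall>f. \<forall>t\<in>{0..T}. L1 t f \<longrightarrow> norm (conv t f) \<le> M * integral {0..t} (\<lambda>s. norm (f s))"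
proof -
  obtain M where M: "M \<ge> 1" "\<And>r x. r \<in> {0..T} \<Longrightarrow> norm (S r x) \<le> M * norm x"
    using S_bounded[of "T"] by blast
  have "norm (conv t f) \<le> M * integral {0..t} (\<lambda>s. norm (f s))" if "t \<in> {0..T}" "L1 t f" for t f
  proof -
    have "norm (conv t f) \<le> integral {0..t} (\<lambda>s. M * norm (f s))"
      unfolding conv_def
      by (rule integral_norm_bound_integral[OF convolution_integrable[OF that(2)]])
        (use that M in \<open>auto simp: L1_def intro!: integrable_on_mult_right\<close>)
    thus ?thesis by simp
  qed
  with M(1) show ?thesis by blast
qed

lemma conv_add:
  assumes "L1 t f" "L1 t g"
  shows "conv t (\<lambda>s. f s + g s) = conv t f + conv t g"
proof -
  have "conv t (\<lambda>s. f s + g s) = integral {0..t} (\<lambda>s. S (t - s) (f s) + S (t - s) (g s))"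
    unfolding conv_def by (intro integral_cong) (auto simp: S_plus)
  thus ?thesis using integral_add[OF convolution_integrable[OF assms(1)] convolution_integrable[OF assms(2)]]
    by (simp add: conv_def)
qed

lemma conv_scaleR: "conv t (\<lambda>s. c *\<^sub>R f s) = c *\<^sub>R conv t f"
proof -
  have "conv t (\<lambda>s. c *\<^sub>R f s) = integral {0..t} (\<lambda>s. c *\<^sub>R S (t - s) (f s))"
    unfolding conv_def by (intro integral_cong) (auto simp: S_scaleR)
  thus ?thesis by (simp add: conv_def)
qed

lemma conv_flow:
  assumes f: "L1 (s + t) f" and st: "0 \<le> s" "0 \<le> t"
  shows "conv (s + t) f = S t (conv s f) + conv t (\<lambda>r. f (s + r))"
proof -
  note i = convolution_integrable[OF f]
  have "conv (s + t) f = integral {0..s} (\<lambda>r. S (s + t - r) (f r)) + integral {s..s+t} (\<lambda>r. S (s + t - r) (f r))"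
    unfolding conv_def using st by (intro integral_split[symmetric] i) auto
  also have "integral {s..s+t} (\<lambda>r. S (s + t - r) (f r)) = conv t (\<lambda>r. f (s + r))"
    unfolding conv_def using integral_shift_real(2)[of t "\<lambda>r. S (s + t - r) (f r)" s] by simp
  also have "integral {0..s} (\<lambda>r. S (s + t - r) (f r)) = integral {0..s} (S t \<circ> (\<lambda>r. S (s - r) (f r)))"
    using st by (intro integral_cong) (auto simp: S_add[symmetric] algebra_simps)
  also have "\<dots> = S t (conv s f)"
    unfolding conv_def
    by (intro integral_linear convolution_integrable L1_subinterval[OF f] S_linear st) (use st in auto)
  finally show ?thesis .
qed

text \<open>The integrated semigroup. Formally \<open>A (S_int t x) = S t x - x\<close> for every
  \<open>x\<close>, so the unbounded generator can be expressed through bounded operators.\<close>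

definition S_int :: "real \<Rightarrow> 'h \<Rightarrow> 'h" where
  "S_int t x = integral {0..t} (\<lambda>r. S r x)"

lemma S_integrable: "0 \<le> a \<Longrightarrow> (\<lambda>r. S r x) integrable_on {a..b}"
  by (intro integrable_continuous_real continuous_on_subset[OF S_continuous]) auto

lemma S_int_bound: "\<exists>M\<ge>1. \<forall>t\<in>{0..T}. \<forall>x. norm (S_int t x) \<le> t * M * norm x"
proof -
  obtain M where M: "M \<ge> 1" "\<And>r x. r \<in> {0..T} \<Longrightarrow> norm (S r x) \<le> M * norm x"
    using S_bounded[of "T"] by blast
  have "norm (S_int t x) \<le> t * M * norm x" if "t \<in> {0..T}" for t x
  proof -
    have "norm (S_int t x) \<le> integral {0..t} (\<lambda>r. M * norm x)"
      unfolding S_int_def by (rule integral_norm_bound_integral[OF S_integrable]) (use M that in auto)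
    thus ?thesis using that by (simp add: mult_ac)
  qed
  thus ?thesis using M(1) by blast
qed

lemma S_int_bounded_linear:
  assumes "0 \<le> t"
  shows "bounded_linear (S_int t)"
proof -
  obtain M where M: "\<And>x. norm (S_int t x) \<le> t * M * norm x"
    using S_int_bound[of t] assms by (metis atLeastAtMost_iff order_refl)
  show ?thesis
  proof (rule bounded_linear_intro[of _ "t * M"])
    show "S_int t (x + y) = S_int t x + S_int t y" for x y
      unfolding S_int_def
      by (subst integral_add[symmetric]) (auto intro!: S_integrable integral_cong simp: S_plus)
    show "S_int t (c *\<^sub>R x) = c *\<^sub>R S_int t x" for c x
      unfolding S_int_def integral_cmul[symmetric] by (intro integral_cong) (auto simp: S_scaleR)
  qed (use M in \<open>simp add: mult.commute\<close>)
qed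

lemma S_S_int:
  assumes "0 \<le> s" "0 \<le> t"
  shows "S s (S_int t x) = S_int (s + t) x - S_int s x"
proof -
  have "S s (S_int t x) = integral {0..t} (S s \<circ> (\<lambda>r. S r x))"
    unfolding S_int_def by (rule integral_linear[symmetric]) (auto intro!: S_integrable S_linear assms)
  also have "\<dots> = integral {0..t} (\<lambda>r. S (s + r) x)"
    using assms by (intro integral_cong) (auto simp: S_add)
  also have "\<dots> = integral {s..s+t} (\<lambda>r. S r x)" by (rule integral_shift_real(2))
  also have "\<dots> = S_int (s + t) x - S_int s x"
    unfolding S_int_def
    using integral_split[of 0 s "s+t" "\<lambda>r. S r x"] S_integrable[of 0] assms by (simp add: algebra_simps)
  finally show ?thesis .
qed

lemma S_int_S:
  assumes "0 \<le> s" "0 \<le> t"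
  shows "S_int t (S s x) = S_int (s + t) x - S_int s x"
proof -
  have "S_int t (S s x) = integral {0..t} (\<lambda>r. S (s + r) x)"
    unfolding S_int_def using assms by (intro integral_cong) (auto simp: S_add[symmetric] add.commute)
  also have "\<dots> = integral {s..s+t} (\<lambda>r. S r x)" by (rule integral_shift_real(2))
  also have "\<dots> = S_int (s + t) x - S_int s x"
    unfolding S_int_def
    using integral_split[of 0 s "s+t" "\<lambda>r. S r x"] S_integrable[of 0] assms by (simp add: algebra_simps)
  finally show ?thesis .
qed

lemma S_int_near:
  assumes "e > 0"
  shows "\<exists>d>0. \<forall>h\<in>{0..d}. norm (S_int h x - h *\<^sub>R x) \<le> h * e"
proof -
  obtain d where d: "d > 0" "\<And>h. h\<in>{0..d} \<Longrightarrow> norm (S h x - x) < e" using S_near[OF assms] by blast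
  show ?thesis
  proof (intro exI[of _ d] conjI ballI)
    fix h assume h: "h \<in> {0..d}"
    have "S_int h x - h *\<^sub>R x = integral {0..h} (\<lambda>r. S r x - x)"
      unfolding S_int_def using h by (subst integral_diff) (auto intro: S_integrable)
    also have "norm \<dots> \<le> integral {0..h} (\<lambda>r. e)"
      by (rule integral_norm_bound_integral) (use h d in \<open>auto intro!: integrable_diff S_integrable less_imp_le\<close>)
    finally show "norm (S_int h x - h *\<^sub>R x) \<le> h * e" using h by simp
  qed (use d in auto)
qed

lemma conv_const: "0 \<le> t \<Longrightarrow> conv t (\<lambda>_. x) = S_int t x"
  unfolding conv_def S_int_def
  using Henstock_Kurzweil_Integration.integral_reflect_real[of 0 "-t" "\<lambda>r. S (t + r) x"]
        integral_shift_Icc_real[of "-t" 0 "\<lambda>r. S r x" t]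
  by (simp add: o_def)

text \<open>Strong continuity at 0, made uniform along \<open>f\<close> in the mean by dominated
  convergence.\<close>

lemma S_dominated_limit:
  assumes f: "L1 T f"
  shows "((\<lambda>h. integral {0..T} (\<lambda>s. norm (S h (f s) - f s))) \<longlongrightarrow> 0) (at_right 0)"
proof (rule tendsto_at_right_sequentially[of 0 1])
  fix h :: "nat \<Rightarrow> real" assume h: "\<And>n. 0 < h n" "\<And>n. h n < 1" "h \<longlonglongrightarrow> 0"
  obtain M where M: "M \<ge> 1" "\<And>r x. r \<in> {0..1} \<Longrightarrow> norm (S r x) \<le> M * norm x"
    using S_bounded[of 1] by blast
  have le: "norm (S (h n) (f s) - f s) \<le> (M + 1) * norm (f s)" for n s
    using norm_triangle_ineq4[of "S (h n) (f s)" "f s"] M(2)[of "h n" "f s"] h(1,2)[of n]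
    by (simp add: algebra_simps)
  have i: "(\<lambda>s. (M + 1) * norm (f s)) integrable_on {0..T}"
    using f by (intro integrable_on_mult_right) (simp add: L1_def)
  have "(\<lambda>n. integral {0..T} (\<lambda>s. norm (S (h n) (f s) - f s))) \<longlonglongrightarrow> integral {0..T} (\<lambda>s. 0::real)"
  proof (rule dominated_convergence(2)[OF _ i])
    fix n
    have "(\<lambda>s. S (h n) (f s) - f s) measurable_on {0..T}"
      using f h(1)[of n] by (intro measurable_on_diff measurable_on_bounded_linear[OF _ S_linear]) (auto simp: L1_def)
    thus "(\<lambda>s. norm (S (h n) (f s) - f s)) integrable_on {0..T}"
      using le by (intro integrable_on_dominated[OF measurable_on_norm i]) auto
  next
    fix s
    have "filterlim h (at_right 0) sequentially" using h by (intro tendsto_imp_filterlim_at_right) auto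
    from filterlim_compose[OF S_right_limit this, of "f s"]
    have "(\<lambda>n. S (h n) (f s)) \<longlonglongrightarrow> f s" .
    thus "(\<lambda>n. norm (S (h n) (f s) - f s)) \<longlonglongrightarrow> 0" by (intro tendsto_norm_zero LIM_zero)
  qed (use le in auto)
  thus "(\<lambda>n. integral {0..T} (\<lambda>s. norm (S (h n) (f s) - f s))) \<longlonglongrightarrow> 0" by simp
qed auto

text \<open>For \<open>p < q\<close>, the difference \<open>conv q f - conv p f\<close> consists of
  the contribution of \<open>{p..q}\<close>, small by continuity of \<open>N\<close>, and of
  \<open>conv p\<close> applied to \<open>S (q - p) (f s) - f s\<close>, small in the mean
  independently of \<open>p\<close>. That independence settles both one-sided limits at
  once.\<close>

lemma conv_continuous:
  assumes f: "L1 T f"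
  shows "continuous_on {0..T} (\<lambda>t. conv t f)"
proof (unfold continuous_on_iff, intro ballI allI impI)
  fix t e :: real assume t: "t \<in> {0..T}" and e: "e > 0"
  obtain M where M: "M \<ge> 1" "\<And>g r. r \<in> {0..T} \<Longrightarrow> L1 r g \<Longrightarrow> norm (conv r g) \<le> M * integral {0..r} (\<lambda>s. norm (g s))"
    using conv_bound[of T] by blast
  define N where "N t = integral {0..t} (\<lambda>s. norm (f s))" for t
  have Ni: "(\<lambda>s. norm (f s)) integrable_on {0..T}" using f by (simp add: L1_def)
  have "continuous_on {0..T} N"
    unfolding N_def by (rule indefinite_integral_continuous_1[OF Ni])
  hence "\<exists>d>0. \<forall>s\<in>{0..T}. dist s t < d \<longrightarrow> dist (N s) (N t) < e / (2*M)"
    using t e M by (auto simp: continuous_on_iff)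
  then obtain d where d: "d > 0" "\<And>s. s \<in> {0..T} \<Longrightarrow> dist s t < d \<Longrightarrow> dist (N s) (N t) < e / (2*M)" by blast
  have "eventually (\<lambda>h. integral {0..T} (\<lambda>s. norm (S h (f s) - f s)) < e / (2*M)) (at_right 0)"
    by (rule order_tendstoD(2)[OF S_dominated_limit[OF f]]) (use e M in auto)
  then obtain b where b: "b > 0" "\<And>h. h > 0 \<Longrightarrow> h < b \<Longrightarrow> integral {0..T} (\<lambda>s. norm (S h (f s) - f s)) < e / (2*M)"
    unfolding eventually_at_right_field by blast
  have *: "norm (conv q f - conv p f) < e" if p: "0 \<le> p" "p < q" "q \<le> T" and pq: "q - p < b" "dist (N q) (N p) < e / (2*M)" for p q
  proof -
    have L: "L1 q f" "L1 p f" using L1_subinterval[OF f] p by auto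
    have Ls: "L1 (q - p) (\<lambda>r. f (p + r))" using L1_shift[OF L(1), of p] p by auto
    have LD': "L1 T (\<lambda>s. S (q-p) (f s) - f s)"
      using f p by (intro L1_diff L1_bounded_linear[OF _ S_linear]) auto
    hence LD: "L1 p (\<lambda>s. S (q-p) (f s) - f s)"
      by (rule L1_subinterval) (use p in auto)
    have c: "conv p (\<lambda>s. S (q-p) (f s)) = S (q-p) (conv p f)"
    proof -
      have "conv p (\<lambda>s. S (q-p) (f s)) = integral {0..p} (S (q-p) \<circ> (\<lambda>s. S (p - s) (f s)))"
        unfolding conv_def using p by (intro integral_cong) (auto simp: S_add[symmetric] add.commute)
      also have "\<dots> = S (q-p) (conv p f)"
        unfolding conv_def using p by (intro integral_linear convolution_integrable L S_linear) auto
      finally show ?thesis .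
    qed
    have "conv q f - conv p f = conv (q - p) (\<lambda>r. f (p + r)) + conv p (\<lambda>s. S (q-p) (f s) - f s)"
      using conv_flow[of p "q-p" f] p L c conv_add[OF LD L(2)] by (simp add: algebra_simps)
    also have "norm \<dots> \<le> M * integral {0..q-p} (\<lambda>r. norm (f (p + r))) + M * integral {0..p} (\<lambda>s. norm (S (q-p) (f s) - f s))"
      using p by (intro norm_triangle_le add_mono M(2) Ls LD) auto
    also have "integral {0..q-p} (\<lambda>r. norm (f (p + r))) = integral {p..q} (\<lambda>r. norm (f r))"
      using integral_shift_real(2)[of "q-p" "\<lambda>r. norm (f r)" p] by simp
    also have "\<dots> = N q - N p"
      unfolding N_def using integral_split[of 0 p q "\<lambda>r. norm (f r)"] L p
      by (simp add: L1_def algebra_simps)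
    also have "M * (N q - N p) + M * integral {0..p} (\<lambda>s. norm (S (q-p) (f s) - f s)) < M * (e / (2*M)) + M * (e / (2*M))"
    proof (intro add_strict_mono mult_strict_left_mono)
      show "N q - N p < e / (2*M)" using pq by (auto simp: dist_real_def)
      have "integral {0..p} (\<lambda>s. norm (S (q-p) (f s) - f s)) \<le> integral {0..T} (\<lambda>s. norm (S (q-p) (f s) - f s))"
      proof (rule integral_subset_le)
      qed (use LD LD' p in \<open>auto simp: L1_def\<close>)
      also have "\<dots> < e / (2*M)" using b(2)[of "q-p"] p pq by auto
      finally show "integral {0..p} (\<lambda>s. norm (S (q-p) (f s) - f s)) < e / (2*M)" .
    qed (use M in auto)
    also have "\<dots> = e" using M by simp
    finally show ?thesis .
  qed
  show "\<exists>d>0. \<forall>s\<in>{0..T}. dist s t < d \<longrightarrow> dist (conv s f) (conv t f) < e"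
  proof (intro exI[of _ "min d b"] conjI ballI impI)
    fix s assume s: "s \<in> {0..T}" "dist s t < min d b"
    consider "s = t" | "s < t" | "t < s" by linarith
    thus "dist (conv s f) (conv t f) < e"
    proof cases
      case 2
      thus ?thesis using *[of s t] d(2)[of s] s t by (auto simp: dist_norm norm_minus_commute)
    next
      case 3
      thus ?thesis using *[of t s] d(2)[of s] s t by (auto simp: dist_norm)
    qed (use e in auto)
  qed (use d b in auto)
qed

lemma S_int_continuous: "continuous_on {0..} (\<lambda>t. S_int t x)"
proof (unfold continuous_on_def, intro ballI)
  fix t :: real assume t: "t \<in> {0..}"
  have "continuous_on {0..t+1} (\<lambda>t. S_int t x)"
    unfolding S_int_def by (rule indefinite_integral_continuous_1) (simp add: S_integrable)
  hence "((\<lambda>t. S_int t x) \<longlongrightarrow> S_int t x) (at t within {0..t+1})"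
    using t by (auto simp: continuous_on_def)
  also have "at t within {0..t+1} = at t within {0..}"
    using t by (intro at_within_nhd[of _ "{..<t+1}"]) auto
  finally show "((\<lambda>t. S_int t x) \<longlongrightarrow> S_int t x) (at t within {0..})" .
qed

sublocale int: strongly_continuous_family S_int
proof (rule strongly_continuous_family.intro)
  show "\<exists>M\<ge>0. \<forall>t\<in>{0..T}. \<forall>x. norm (S_int t x) \<le> M * norm x" for T
  proof -
    obtain M where M: "M \<ge> 1" "\<And>t x. t \<in> {0..T} \<Longrightarrow> norm (S_int t x) \<le> t * M * norm x" using S_int_bound[of T] by blast
    have "norm (S_int t x) \<le> (\<bar>T\<bar> * M) * norm x" if "t \<in> {0..T}" for t x
      using M(2)[OF that, of x] that M(1) by (intro order_trans[OF M(2)[OF that]] mult_right_mono) auto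
    thus ?thesis using M by (intro exI[of _ "\<bar>T\<bar> * M"]) auto
  qed
  show "bounded_linear (S_int t)" if "t \<ge> 0" for t by (rule S_int_bounded_linear[OF that])
qed (rule S_int_continuous)

text \<open>Both sides equal \<open>S_int (s + t) x - S_int s x - S_int t x\<close>, which is
  symmetric in \<open>s\<close> and \<open>t\<close>.\<close>

lemma S_int_identity: "0 \<le> s \<Longrightarrow> 0 \<le> t \<Longrightarrow> S s (S_int t x) - S_int t x = S_int s (S t x - x)"
  using S_S_int[of s t x] S_int_S[of t s x] int.W_diff[of s "S t x" x] by (simp add: add.commute)

text \<open>Rather than by exchanging the order of integration, the formula is obtained by
  differentiating the right-hand side in its upper limit: its increments obey a flow rule driven by
  the trajectory, and \<open>S_int h\<close> is \<open>h\<close> times the identity to first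
  order.\<close>

lemma integral_conv:
  assumes f: "L1 T f" and T: "0 \<le> T"
  shows "((\<lambda>t. S t x + conv t f) has_integral (S_int T x + integral {0..T} (\<lambda>s. S_int (T - s) (f s)))) {0..T}"
proof -
  define y where "y t = S t x + conv t f" for t
  define F where "F t = S_int t x + integral {0..t} (\<lambda>s. S_int (t - s) (f s))" for t
  have Ni: "(\<lambda>s. norm (f s)) integrable_on {0..T}" using f by (simp add: L1_def)
  define N where "N t = integral {0..t} (\<lambda>s. norm (f s))" for t
  obtain M where M: "M \<ge> 1" "\<And>t x. t \<in> {0..T} \<Longrightarrow> norm (S_int t x) \<le> t * M * norm x" using S_int_bound[of T] by blast
  have inc: "F b - F a = S_int (b - a) (y a) + integral {0..b-a} (\<lambda>s. S_int (b - a - s) (f (a + s)))"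
    if ab: "0 \<le> a" "a \<le> b" "b \<le> T" for a b
  proof -
    have L: "L1 b f" "L1 a f" using L1_subinterval[OF f] ab by auto
    have "integral {0..b} (\<lambda>s. S_int (b - s) (f s)) = integral {0..a} (\<lambda>s. S_int (b - s) (f s)) + integral {a..b} (\<lambda>s. S_int (b - s) (f s))"
      using ab by (intro integral_split[symmetric] int.convolution_integrable L) auto
    also have "integral {a..b} (\<lambda>s. S_int (b - s) (f s)) = integral {0..b-a} (\<lambda>s. S_int (b - a - s) (f (a + s)))"
      using integral_shift_real(2)[of "b-a" "\<lambda>s. S_int (b - s) (f s)" a] by (simp add: algebra_simps)
    also have "integral {0..a} (\<lambda>s. S_int (b - s) (f s)) = integral {0..a} (\<lambda>s. S_int (b - a) (S (a - s) (f s)) + S_int (a - s) (f s))"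
      using ab by (intro integral_cong) (auto simp: S_int_S)
    also have "\<dots> = integral {0..a} (\<lambda>s. S_int (b - a) (S (a - s) (f s))) + integral {0..a} (\<lambda>s. S_int (a - s) (f s))"
      using ab by (intro integral_add int.convolution_integrable L
          integrable_linear[OF convolution_integrable S_int_bounded_linear, unfolded o_def]) auto
    also have "integral {0..a} (\<lambda>s. S_int (b - a) (S (a - s) (f s))) = S_int (b - a) (conv a f)"
      unfolding conv_def using integral_linear[OF convolution_integrable[OF L(2)] S_int_bounded_linear[of "b-a"]] ab
      by (simp add: o_def)
    finally show ?thesis
      using ab S_int_S[of a "b-a" x] bounded_linear.linear[OF S_int_bounded_linear[of "b-a"], THEN linear_add]
      by (simp add: F_def y_def algebra_simps)
  qed
  \<comment> \<open>The base point \<open>c\<close> is kept apart from the left end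
    \<open>a\<close>, since the point of differentiation is the right end of the interval when the
    increment is negative.\<close>
  have est: "norm (F b - F a - (b - a) *\<^sub>R y c) \<le>
      (b - a) * (M * norm (y a - y c) + M * (N b - N a)) + norm (S_int (b - a) (y c) - (b - a) *\<^sub>R y c)"
    if ab: "0 \<le> a" "a \<le> b" "b \<le> T" for a b c
  proof -
    have L: "L1 (b - a) (\<lambda>s. f (a + s))"
      using L1_shift[OF L1_subinterval[OF f, of b], of a] ab by auto
    have "norm (integral {0..b-a} (\<lambda>s. S_int (b - a - s) (f (a + s)))) \<le> integral {0..b-a} (\<lambda>s. ((b - a) * M) * norm (f (a + s)))"
    proof (rule integral_norm_bound_integral[OF int.convolution_integrable[OF L]])
      show "(\<lambda>s. ((b - a) * M) * norm (f (a + s))) integrable_on {0..b - a}"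
        using L by (intro integrable_on_mult_right) (simp add: L1_def)
      show "norm (S_int (b - a - s) (f (a + s))) \<le> ((b - a) * M) * norm (f (a + s))" if "s \<in> {0..b-a}" for s
        using that ab M by (intro order_trans[OF M(2)] mult_right_mono) auto
    qed
    also have "\<dots> = ((b - a) * M) * integral {a..b} (\<lambda>s. norm (f s))"
      using integral_shift_real(2)[of "b-a" "\<lambda>r. norm (f r)" a] by simp
    also have "integral {a..b} (\<lambda>s. norm (f s)) = N b - N a"
      unfolding N_def using integral_split[of 0 a b "\<lambda>r. norm (f r)"] L1_subinterval[OF f, of b] ab
      by (simp add: L1_def algebra_simps)
    finally have 1: "norm (integral {0..b-a} (\<lambda>s. S_int (b - a - s) (f (a + s)))) \<le> (b - a) * (M * (N b - N a))" by simp
    have 2: "norm (S_int (b - a) (y a - y c)) \<le> (b - a) * (M * norm (y a - y c))"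
      using M(2)[of "b-a" "y a - y c"] ab by (simp add: mult.assoc)
    have "F b - F a - (b - a) *\<^sub>R y c = S_int (b - a) (y a - y c) + integral {0..b-a} (\<lambda>s. S_int (b - a - s) (f (a + s)))
       + (S_int (b - a) (y c) - (b - a) *\<^sub>R y c)"
      using inc[OF ab] int.W_diff[of "b-a" "y a" "y c"] ab by simp
    also have "norm \<dots> \<le> norm (S_int (b - a) (y a - y c)) + norm (integral {0..b-a} (\<lambda>s. S_int (b - a - s) (f (a + s))))
        + norm (S_int (b - a) (y c) - (b - a) *\<^sub>R y c)"
      by (meson add_right_mono norm_triangle_ineq order_trans)
    also have "\<dots> \<le> (b - a) * (M * norm (y a - y c) + M * (N b - N a)) + norm (S_int (b - a) (y c) - (b - a) *\<^sub>R y c)"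
      using 1 2 by (simp add: distrib_left)
    finally show ?thesis .
  qed
  have yc: "continuous_on {0..T} y"
    unfolding y_def by (intro continuous_intros conv_continuous f continuous_on_subset[OF S_continuous]) auto
  have Nc: "continuous_on {0..T} N"
    unfolding N_def by (rule indefinite_integral_continuous_1[OF Ni])
  have "(y has_integral (F T - F 0)) {0..T}"
  proof (rule fundamental_theorem_of_calculus[OF T])
    fix t assume t: "t \<in> {0..T}"
    show "(F has_vector_derivative y t) (at t within {0..T})"
      unfolding has_vector_derivative_def has_derivative_within_alt
    proof (intro conjI allI impI bounded_linear_scaleR_left)
      fix e :: real assume e: "e > 0"
      have e3: "e / (3 * M) > 0" "e / 3 > 0" using e M by auto
      obtain d1 where d1: "d1 > 0" "\<And>s. s \<in> {0..T} \<Longrightarrow> dist s t < d1 \<Longrightarrow> dist (y s) (y t) < e / (3 * M)"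
        using yc[unfolded continuous_on_iff, rule_format, OF t e3(1)] by blast
      obtain d2 where d2: "d2 > 0" "\<And>s. s \<in> {0..T} \<Longrightarrow> dist s t < d2 \<Longrightarrow> dist (N s) (N t) < e / (3 * M)"
        using Nc[unfolded continuous_on_iff, rule_format, OF t e3(1)] by blast
      obtain d3 where d3: "d3 > 0" "\<And>h. h\<in>{0..d3} \<Longrightarrow> norm (S_int h (y t) - h *\<^sub>R y t) \<le> h * (e/3)"
        using S_int_near[OF e3(2), of "y t"] by blast
      show "\<exists>d>0. \<forall>s\<in>{0..T}. norm (s - t) < d \<longrightarrow> norm (F s - F t - (s - t) *\<^sub>R y t) \<le> e * norm (s - t)"
      proof (intro exI[of _ "min d1 (min d2 d3)"] conjI ballI impI)
        fix s assume s: "s \<in> {0..T}" "norm (s - t) < min d1 (min d2 d3)"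
        define a b where "a = min s t" and "b = max s t"
        have ab: "0 \<le> a" "a \<le> b" "b \<le> T" "b - a \<le> d3" "\<bar>s - t\<bar> = b - a" using s t by (auto simp: a_def b_def)
        have "dist (y s) (y t) < e / (3 * M)" "dist (N s) (N t) < e / (3 * M)"
          using s d1(2)[of s] d2(2)[of s] by (auto simp: dist_norm)
        hence "norm (y a - y t) \<le> e / (3 * M)" "N b - N a \<le> e / (3 * M)"
          using e3 by (auto simp: a_def b_def min_def max_def dist_norm)
        hence ya: "M * norm (y a - y t) \<le> e / 3" and Nab: "M * (N b - N a) \<le> e / 3"
          using M(1) by (auto simp: pos_le_divide_eq mult.commute mult.left_commute)
        have "norm (F s - F t - (s - t) *\<^sub>R y t) = norm (F b - F a - (b - a) *\<^sub>R y t)"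
          by (cases "s \<le> t") (auto simp: a_def b_def min_def max_def norm_minus_commute algebra_simps)
        also have "\<dots> \<le> (b - a) * (M * norm (y a - y t) + M * (N b - N a)) + norm (S_int (b - a) (y t) - (b - a) *\<^sub>R y t)"
          by (rule est) (use ab in auto)
        also have "\<dots> \<le> (b - a) * (e/3 + e/3) + (b - a) * (e/3)"
          using ab ya Nab d3(2)[of "b-a"] by (intro add_mono mult_left_mono) auto
        also have "\<dots> = e * norm (s - t)" unfolding real_norm_def ab(5) by (simp add: field_simps)
        finally show "norm (F s - F t - (s - t) *\<^sub>R y t) \<le> e * norm (s - t)" .
      qed (use d1 d2 d3 in auto)
    qed
  qed
  moreover have "F 0 = 0" by (simp add: F_def S_int_def)
  ultimately show ?thesis by (simp add: F_def y_def[abs_def])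
qed

text \<open>Integrating \<open>y' = A y + f\<close> over the horizon gives
  \<open>A (integral y) = y T - x - integral f\<close>. In the integrated form the relation makes
  sense for every \<open>x\<close> and every integrable \<open>f\<close>, and this is how time
  integrals of trajectories become solutions of the static equation.\<close>

lemma integrated_equation:
  fixes x :: 'h
  assumes f: "L1 T f" and T: "0 \<le> T" and h: "0 \<le> h"
  defines "y \<equiv> \<lambda>t. S t x + conv t f"
  shows "S h (integral {0..T} y) - integral {0..T} y = S_int h (y T - x - integral {0..T} f)"
proof -
  note bl = S_int_bounded_linear[OF h]
  have y: "integral {0..T} y = S_int T x + integral {0..T} (\<lambda>s. S_int (T - s) (f s))"
    using integral_conv[OF f T, of x] unfolding y_def by (rule integral_unique)
  have i: "(\<lambda>s. S h (S_int (T - s) (f s))) integrable_on {0..T}"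
    using integrable_linear[OF int.convolution_integrable[OF f] S_linear[OF h]] by (simp add: o_def)
  have "S h (integral {0..T} (\<lambda>s. S_int (T - s) (f s))) - integral {0..T} (\<lambda>s. S_int (T - s) (f s))
     = integral {0..T} (\<lambda>s. S h (S_int (T - s) (f s)) - S_int (T - s) (f s))"
    using integral_linear[OF int.convolution_integrable[OF f] S_linear[OF h]] integral_diff[OF i int.convolution_integrable[OF f]]
    by (simp add: o_def)
  also have "\<dots> = integral {0..T} (S_int h \<circ> (\<lambda>s. S (T - s) (f s) - f s))"
    using h by (intro integral_cong) (simp add: S_int_identity)
  also have "\<dots> = S_int h (integral {0..T} (\<lambda>s. S (T - s) (f s) - f s))"
    using f by (intro integral_linear bl integrable_diff convolution_integrable L1_integrable[OF f]) auto
  also have "integral {0..T} (\<lambda>s. S (T - s) (f s) - f s) = conv T f - integral {0..T} f"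
    unfolding conv_def by (intro integral_diff convolution_integrable L1_integrable[OF f] f) auto
  finally have "S h (integral {0..T} y) - integral {0..T} y = S_int h (S T x - x) + S_int h (conv T f - integral {0..T} f)"
    using S_int_identity[OF h T, of x] S_plus[OF h] y by (simp add: algebra_simps)
  also have "\<dots> = S_int h (y T - x - integral {0..T} f)"
    unfolding y_def using bounded_linear.linear[OF bl, THEN linear_add, symmetric] by (simp add: algebra_simps)
  finally show ?thesis .
qed

end

section \<open>Trajectories and the quadratic cost\<close>

lemma quadratic_nonneg_imp_linear_zero:
  fixes a b :: real
  assumes "\<And>s. 2 * s * a + s\<^sup>2 * b \<ge> 0"
  shows "a = 0"
proof (rule ccontr)
  assume a: "a \<noteq> 0"
  define k where "k = \<bar>b\<bar> + 1"
  have k: "k > 0" "b < 2 * k" by (auto simp: k_def)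
  define s where "s = - a / k"
  have "2 * s * a + s\<^sup>2 * b = (a\<^sup>2 / k\<^sup>2) * (b - 2 * k)"
    using k(1) by (simp add: s_def power2_eq_square field_simps)
  also have "\<dots> < 0" using a k by (intro mult_pos_neg) auto
  finally show False using assms[of s] by simp
qed

lemma quadratic_nonneg_imp_discriminant:
  fixes a b c :: real
  assumes nn: "\<And>s. a + 2 * s * b + s\<^sup>2 * c \<ge> 0" and "c \<ge> 0"
  shows "b\<^sup>2 \<le> a * c"
proof (cases "c = 0")
  case True
  have "b = 0"
  proof (rule ccontr)
    assume "b \<noteq> 0"
    with nn[of "- (a + 1) / (2 * b)"] True show False by (simp add: field_simps)
  qed
  with True show ?thesis by simp
next
  case False
  hence "c > 0" using assms by simp
  with nn[of "- b / c"] show ?thesis by (simp add: power2_eq_square field_simps)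
qed

text \<open>The direct method stripped of topology: by the midpoint inequality,
  \<open>d (p m) (p n)\<close> is at most the sum of the excesses of \<open>J (p m)\<close> and
  \<open>J (p n)\<close> over the infimum. As \<open>d\<close> is an arbitrary function, the lemma
  serves functions modulo null sets as well as elements of a Hilbert space.\<close>

lemma minimizer_exists:
  fixes J :: "'p \<Rightarrow> real" and d :: "'p \<Rightarrow> 'p \<Rightarrow> real"
  assumes ne: "Z \<noteq> {}" and bdd: "\<And>p. p \<in> Z \<Longrightarrow> b \<le> J p"
    and mid: "\<And>p q. p \<in> Z \<Longrightarrow> q \<in> Z \<Longrightarrow> \<exists>r\<in>Z. 2 * J r + d p q \<le> J p + J q"
    and complete: "\<And>p :: nat \<Rightarrow> 'p. (\<And>n. p n \<in> Z) \<Longrightarrow>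
        (\<And>e. e > 0 \<Longrightarrow> \<exists>N. \<forall>m\<ge>N. \<forall>n\<ge>N. d (p m) (p n) < e) \<Longrightarrow> \<exists>q\<in>Z. (\<lambda>n. J (p n)) \<longlonglongrightarrow> J q"
  shows "\<exists>q\<in>Z. \<forall>p\<in>Z. J q \<le> J p"
proof -
  define i where "i = Inf (J ` Z)"
  have bb: "bdd_below (J ` Z)" using bdd by (auto simp: bdd_below_def)
  have i: "i \<le> J p" if "p \<in> Z" for p unfolding i_def using bb that by (rule cINF_lower)
  have "\<exists>p\<in>Z. J p < i + 1 / Suc n" for n
  proof -
    have "Inf (J ` Z) < i + 1 / Suc n" by (simp add: i_def)
    from cInf_lessD[OF _ this] ne show ?thesis by auto
  qed
  then obtain p where p: "\<And>n. p n \<in> Z" "\<And>n. J (p n) < i + 1 / Suc n" by metis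
  have le: "d (p m) (p n) \<le> 1 / Suc m + 1 / Suc n" for m n
  proof -
    obtain r where r: "r \<in> Z" "2 * J r + d (p m) (p n) \<le> J (p m) + J (p n)" using mid p(1) by blast
    from i[OF r(1)] r(2) p(2)[of m] p(2)[of n] show ?thesis by linarith
  qed
  have "\<exists>N. \<forall>m\<ge>N. \<forall>n\<ge>N. d (p m) (p n) < e" if "e > 0" for e
  proof -
    have "e / 2 > 0" using that by simp
    then obtain N where N: "1 / Suc N < e / 2" by (rule nat_approx_posE)
    have "d (p m) (p n) < e" if "m \<ge> N" "n \<ge> N" for m n
    proof -
      have "1 / real (Suc m) \<le> 1 / Suc N" "1 / real (Suc n) \<le> 1 / Suc N"
        using that by (auto simp: frac_le)
      thus ?thesis using le[of m n] N by linarith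
    qed
    thus ?thesis by blast
  qed
  then obtain q where q: "q \<in> Z" "(\<lambda>n. J (p n)) \<longlonglongrightarrow> J q" using complete[of p] p(1) by blast
  have "(\<lambda>n. i + 1 / Suc n) \<longlonglongrightarrow> i + 0"
    using LIMSEQ_inverse_real_of_nat by (intro tendsto_intros) (simp add: inverse_eq_divide)
  hence "J q \<le> i"
    using q(2) p(2) by (intro LIMSEQ_le[OF q(2), of "\<lambda>n. i + 1 / Suc n" i]) (auto intro: less_imp_le)
  with q(1) i show ?thesis by force
qed

lemma lebesgue_Icc: "{a..b::real} \<in> sets lebesgue" by simp

locale lq_system = c0_semigroup S for S :: "real \<Rightarrow> 'h::chilbert_space \<Rightarrow> 'h" +
  fixes B :: "'u::chilbert_space \<Rightarrow> 'h" and C :: "'h \<Rightarrow> 'y::chilbert_space" and K :: "'u \<Rightarrow> 'u" and m :: real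
  assumes B: "bounded_linear B" and C: "bounded_linear C" and K: "bounded_linear K"
    and m_pos: "m > 0" and K_coercive: "\<And>u. m * (norm u)\<^sup>2 \<le> (norm (K u))\<^sup>2"
begin

sublocale B: bounded_linear B by (rule B)
sublocale C: bounded_linear C by (rule C)
sublocale K: bounded_linear K by (rule K)

section \<open>State trajectories and operations on them\<close>

abbreviation "mild \<equiv> mild_solution S B"

lemma mild_eq: "mild x0 u t = S t x0 + conv t (\<lambda>s. B (u s))"
  by (simp add: mild_solution_def conv_def)

text \<open>The initial state is read off from \<open>x\<close> itself, which makes the pairs
  \<open>(x, u)\<close> closed under linear combinations, restriction, time shift and gluing at
  equal states.\<close>

definition traj :: "real \<Rightarrow> (real \<Rightarrow> 'h) \<Rightarrow> (real \<Rightarrow> 'u) \<Rightarrow> bool" where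
  "traj T x u \<longleftrightarrow> L2 T u \<and> (\<forall>t\<in>{0..T}. x t = mild (x 0) u t)"

lemma trajI:
  assumes "L2 T u" "\<And>t. 0 \<le> t \<Longrightarrow> t \<le> T \<Longrightarrow> x t = mild (x 0) u t"
  shows "traj T x u"
  unfolding traj_def using assms by (metis atLeastAtMost_iff)

lemma traj_L2: "traj T x u \<Longrightarrow> L2 T u"
  unfolding traj_def by blast

lemma trajD: "traj T x u \<Longrightarrow> 0 \<le> t \<Longrightarrow> t \<le> T \<Longrightarrow> x t = mild (x 0) u t"
  unfolding traj_def by (metis atLeastAtMost_iff)

lemma L1_B: "L2 T u \<Longrightarrow> L1 T (\<lambda>s. B (u s))"
  by (rule L2_imp_L1[OF L2_bounded_linear[OF _ B]])

lemma L1_B_subinterval: "L2 T u \<Longrightarrow> t \<le> T \<Longrightarrow> L1 t (\<lambda>s. B (u s))"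
  using L1_B L1_subinterval by blast

lemma mild_0 [simp]: "mild x0 u 0 = x0"
  by (simp add: mild_solution_def)

lemma traj_mild: "L2 T u \<Longrightarrow> traj T (mild x0 u) u"
  by (simp add: traj_def)

lemma traj_continuous:
  assumes "traj T x u"
  shows "continuous_on {0..T} x"
proof -
  have "continuous_on {0..T} (\<lambda>t. S t (x 0) + conv t (\<lambda>s. B (u s)))"
    by (intro continuous_intros conv_continuous L1_B traj_L2[OF assms] continuous_on_subset[OF S_continuous]) auto
  thus ?thesis
    by (rule continuous_on_eq) (metis assms atLeastAtMost_iff mild_eq trajD)
qed

lemma traj_add:
  assumes "traj T x u" "traj T y w"
  shows "traj T (\<lambda>t. x t + y t) (\<lambda>t. u t + w t)"
proof (rule trajI)
  fix t assume t: "0 \<le> t" "t \<le> T"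
  have "conv t (\<lambda>s. B (u s + w s)) = conv t (\<lambda>s. B (u s)) + conv t (\<lambda>s. B (w s))"
    using conv_add[OF L1_B_subinterval[OF traj_L2[OF assms(1)] t(2)] L1_B_subinterval[OF traj_L2[OF assms(2)] t(2)]]
    by (simp add: B.add)
  thus "x t + y t = mild (x 0 + y 0) (\<lambda>t. u t + w t) t"
    unfolding trajD[OF assms(1) t] trajD[OF assms(2) t] using t by (simp add: mild_eq S_plus)
qed (intro L2_add traj_L2[OF assms(1)] traj_L2[OF assms(2)])

lemma traj_scaleR:
  assumes "traj T x u"
  shows "traj T (\<lambda>t. c *\<^sub>R x t) (\<lambda>t. c *\<^sub>R u t)"
proof (rule trajI)
  fix t assume t: "0 \<le> t" "t \<le> T"
  show "c *\<^sub>R x t = mild (c *\<^sub>R x 0) (\<lambda>t. c *\<^sub>R u t) t"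
    unfolding trajD[OF assms t]
    using t conv_scaleR[of t c "\<lambda>s. B (u s)"] by (simp add: mild_eq S_scaleR B.scaleR scaleR_add_right)
qed (intro L2_scaleR traj_L2[OF assms])

lemma traj_uminus: "traj T x u \<Longrightarrow> traj T (\<lambda>t. - x t) (\<lambda>t. - u t)"
  using traj_scaleR[of T x u "-1"] by simp

lemma traj_diff: "traj T x u \<Longrightarrow> traj T y w \<Longrightarrow> traj T (\<lambda>t. x t - y t) (\<lambda>t. u t - w t)"
  using traj_add[OF _ traj_uminus, of T x u y w] by simp

lemma traj_zero: "traj T (\<lambda>_. 0) (\<lambda>_. 0)"
  using traj_scaleR[OF traj_mild[OF L2_zero], of T 0 0] by simp

lemma traj_subinterval:
  assumes "traj T x u" "s \<le> T"
  shows "traj s x u"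
  using L2_subinterval[OF traj_L2[OF assms(1)] assms(2)]
  by (rule trajI) (use assms in \<open>auto intro: trajD[OF assms(1)]\<close>)

lemma mild_flow:
  assumes "L2 (s + t) u" "0 \<le> s" "0 \<le> t"
  shows "mild x0 u (s + t) = mild (mild x0 u s) (\<lambda>r. u (s + r)) t"
  using conv_flow[OF L1_B[OF assms(1)] assms(2,3)] assms(2,3)
  by (simp add: mild_eq S_add S_plus add.commute[of s t] add.assoc)

lemma traj_shift:
  assumes "traj T x u" "0 \<le> s" "s \<le> T"
  shows "traj (T - s) (\<lambda>t. x (s + t)) (\<lambda>t. u (s + t))"
proof (rule trajI)
  fix t assume t: "0 \<le> t" "t \<le> T - s"
  hence st: "s + t \<le> T" "0 \<le> s + t" using assms by auto
  have "x (s + t) = mild (x 0) u (s + t)" "x s = mild (x 0) u s"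
    using trajD[OF assms(1) st(2,1)] trajD[OF assms(1-3)] by auto
  thus "x (s + t) = mild (x (s + 0)) (\<lambda>t. u (s + t)) t"
    using mild_flow[OF L2_subinterval[OF traj_L2[OF assms(1)] st(1)] assms(2) t(1), of "x 0"] by simp
qed (intro L2_shift traj_L2[OF assms(1)] assms)

lemma mild_cong:
  assumes "negligible N" "\<And>s. s \<in> {0..t} - N \<Longrightarrow> u s = w s"
  shows "mild x0 u t = mild x0 w t"
  unfolding mild_solution_def using assms
  by (intro arg_cong2[where f="(+)"] refl integral_spike[of N]) auto

lemma traj_spike:
  assumes "traj T x u" "negligible N" "\<And>t. t \<in> {0..T} - N \<Longrightarrow> w t = u t"
  shows "traj T x w"
proof (rule trajI)
  show "L2 T w" using L2_spike[OF traj_L2[OF assms(1)] assms(2,3)] .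
  fix t assume t: "0 \<le> t" "t \<le> T"
  have "mild (x 0) u t = mild (x 0) w t"
    by (rule mild_cong[OF assms(2)]) (use assms(3) t in auto)
  thus "x t = mild (x 0) w t" using trajD[OF assms(1) t] by simp
qed

lemma traj_concat:
  assumes x: "traj s x u" and y: "traj (T - s) y w" and j: "y 0 = x s" and s: "0 \<le> s" "s \<le> T"
  shows "traj T (concat_control s x y) (concat_control s u w)"
proof (rule trajI)
  show L: "L2 T (concat_control s u w)" using s by (intro L2_concat traj_L2[OF x] traj_L2[OF y])
  \<comment> \<open>For \<open>s = 0\<close> the initial value is already that of \<open>y\<close>,
    which agrees with \<open>x 0\<close> by \<open>j\<close>.\<close>
  have z0: "concat_control s x y 0 = x 0" using j s by (auto simp: concat_control_def)
  have 1: "mild (x 0) (concat_control s u w) t = x t" if "0 \<le> t" "t \<le> s" for t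
  proof -
    \<comment> \<open>At time \<open>s\<close> itself the glued control takes its value from
      \<open>w\<close>; a single point is negligible.\<close>
    have "mild (x 0) (concat_control s u w) t = mild (x 0) u t"
      by (rule mild_cong[of "{s}"]) (use that in \<open>auto simp: concat_control_def\<close>)
    thus ?thesis using trajD[OF x that] by simp
  qed
  fix t assume t: "0 \<le> t" "t \<le> T"
  show "concat_control s x y t = mild (concat_control s x y 0) (concat_control s u w) t"
  proof (cases "t < s")
    case True thus ?thesis using 1[of t] t z0 by (simp add: concat_control_def)
  next
    case False
    have "mild (x 0) (concat_control s u w) t = mild (x s) (\<lambda>r. concat_control s u w (s + r)) (t - s)"
      using mild_flow[of s "t - s" "concat_control s u w" "x 0"] 1[of s] L2_subinterval[OF L, of t] t False s by simp
    also have "\<dots> = mild (x s) w (t - s)"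
      by (rule mild_cong[of "{}"]) (auto simp: concat_control_def)
    also have "\<dots> = y (t - s)" using trajD[OF y, of "t - s"] t False j by simp
    finally show ?thesis using False z0 by (simp add: concat_control_def)
  qed
qed

text \<open>One constant serves all horizons up to \<open>T\<close>. The integral of
  \<open>norm (u s)\<close>, rather than of its square, is kept because the later pointwise estimate
  of the control compares terms that are linear in it.\<close>

lemma traj_bound_L1:
  "\<exists>c\<ge>1. \<forall>s\<le>T. \<forall>x u. traj s x u \<longrightarrow> (\<forall>t\<in>{0..s}. norm (x t) \<le> c * (norm (x 0) + integral {0..t} (\<lambda>s. norm (u s))))"
proof -
  obtain M1 where M1: "M1 \<ge> 1" "\<And>t x. t \<in> {0..T} \<Longrightarrow> norm (S t x) \<le> M1 * norm x"
    using S_bounded[of T] by blast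
  obtain M2 where M2: "M2 \<ge> 1" "\<And>f t. t \<in> {0..T} \<Longrightarrow> L1 t f \<Longrightarrow> norm (conv t f) \<le> M2 * integral {0..t} (\<lambda>s. norm (f s))"
    using conv_bound[of T] by blast
  obtain b where b: "b > 0" "\<And>u. norm (B u) \<le> norm u * b" using B.pos_bounded by blast
  define c where "c = max M1 (M2 * b)"
  have "norm (x t) \<le> c * (norm (x 0) + integral {0..t} (\<lambda>s. norm (u s)))" if s: "s \<le> T" and x: "traj s x u" and t': "t \<in> {0..s}" for s x u t
  proof -
    have t: "t \<in> {0..T}" using s t' by simp
    have L: "L1 t (\<lambda>s. B (u s))" "L1 t u"
      using t' L1_B_subinterval[OF traj_L2[OF x]] L1_subinterval[OF L2_imp_L1[OF traj_L2[OF x]]] by auto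
    have i: "integral {0..t} (\<lambda>s. norm (B (u s))) \<le> integral {0..t} (\<lambda>s. norm (u s) * b)"
      using L b by (intro integral_le) (auto simp: L1_def intro!: integrable_on_mult_left)
    have nn: "0 \<le> integral {0..t} (\<lambda>s. norm (u s))" using L by (intro integral_nonneg) (auto simp: L1_def)
    have "norm (x t) \<le> norm (S t (x 0)) + norm (conv t (\<lambda>s. B (u s)))"
      using trajD[OF x, of t] t' by (simp add: mild_eq norm_triangle_ineq)
    also have "\<dots> \<le> M1 * norm (x 0) + M2 * integral {0..t} (\<lambda>s. norm (B (u s)))"
      using M1 M2 t L by (intro add_mono) auto
    also have "\<dots> \<le> M1 * norm (x 0) + M2 * (integral {0..t} (\<lambda>s. norm (u s)) * b)"
      using i M2 by (intro add_left_mono mult_left_mono) auto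
    also have "\<dots> = M1 * norm (x 0) + (M2 * b) * integral {0..t} (\<lambda>s. norm (u s))" by simp
    also have "\<dots> \<le> c * norm (x 0) + c * integral {0..t} (\<lambda>s. norm (u s))"
      using nn by (intro add_mono mult_right_mono) (auto simp: c_def)
    finally show ?thesis by (simp add: distrib_left)
  qed
  thus ?thesis using M1 by (intro exI[of _ c]) (auto simp: c_def)
qed

lemma sqnorm_subinterval: "L2 T u \<Longrightarrow> 0 \<le> t \<Longrightarrow> t \<le> T \<Longrightarrow> sqnorm t u \<le> sqnorm T u"
  unfolding sqnorm_def using L2_subinterval[of T u t]
  by (intro integral_subset_le) (auto simp: L2_def)

lemma traj_bound_uniform:
  "\<exists>c\<ge>1. \<forall>s\<le>T. \<forall>x u. traj s x u \<longrightarrow> (\<forall>t\<in>{0..s}. norm (x t) \<le> c * (norm (x 0) + sqrt (sqnorm s u)))"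
proof -
  obtain c where c: "c \<ge> 1" "\<And>s x u t. s \<le> T \<Longrightarrow> traj s x u \<Longrightarrow> t \<in> {0..s} \<Longrightarrow> norm (x t) \<le> c * (norm (x 0) + integral {0..t} (\<lambda>s. norm (u s)))"
    using traj_bound_L1[of T] by blast
  have "norm (x t) \<le> (c * (sqrt \<bar>T\<bar> + 1)) * (norm (x 0) + sqrt (sqnorm s u))" if s: "s \<le> T" and x: "traj s x u" and t: "t \<in> {0..s}" for s x u t
  proof -
    have "integral {0..t} (\<lambda>s. norm (u s)) \<le> sqrt t * sqrt (sqnorm t u)"
      using integral_norm_le_L2[OF L2_subinterval[OF traj_L2[OF x]], of t] t by (simp add: sqnorm_def)
    also have "\<dots> \<le> (sqrt \<bar>T\<bar> + 1) * sqrt (sqnorm s u)"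
      using t s sqnorm_subinterval[OF traj_L2[OF x], of t]
      by (intro mult_mono) (auto intro!: order_trans[OF real_sqrt_le_mono, of t T])
    finally have "norm (x 0) + integral {0..t} (\<lambda>s. norm (u s)) \<le> (sqrt \<bar>T\<bar> + 1) * norm (x 0) + (sqrt \<bar>T\<bar> + 1) * sqrt (sqnorm s u)"
      by (intro add_mono) (auto simp: distrib_right)
    hence "c * (norm (x 0) + integral {0..t} (\<lambda>s. norm (u s))) \<le> c * ((sqrt \<bar>T\<bar> + 1) * (norm (x 0) + sqrt (sqnorm s u)))"
      using c(1) by (intro mult_left_mono) (auto simp: distrib_left)
    thus ?thesis using c(2)[OF s x t] by (simp add: mult.assoc)
  qed
  moreover have "c * (sqrt \<bar>T\<bar> + 1) \<ge> 1"
    using c(1) mult_mono[of 1 c 1 "sqrt \<bar>T\<bar> + 1"] by simp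
  ultimately show ?thesis by blast
qed

lemma traj_bound:
  "\<exists>c\<ge>1. \<forall>x u. traj T x u \<longrightarrow> (\<forall>t\<in>{0..T}. norm (x t) \<le> c * (norm (x 0) + sqrt (sqnorm T u)))"
  using traj_bound_uniform[of T] by blast

text \<open>The symmetric bilinear form whose diagonal is the quadratic part of the cost.\<close>

definition E :: "real \<Rightarrow> (real \<Rightarrow> 'h) \<Rightarrow> (real \<Rightarrow> 'u) \<Rightarrow> (real \<Rightarrow> 'h) \<Rightarrow> (real \<Rightarrow> 'u) \<Rightarrow> real" where
  "E T x u y w = integral {0..T} (\<lambda>t. inner (C (x t)) (C (y t)) + inner (K (u t)) (K (w t)))"

lemma traj_L2_C: "traj T x u \<Longrightarrow> L2 T (\<lambda>t. C (x t))"
  by (rule L2_bounded_linear[OF L2_continuous[OF traj_continuous] C])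

lemma traj_L2_K: "traj T x u \<Longrightarrow> L2 T (\<lambda>t. K (u t))"
  by (rule L2_bounded_linear[OF traj_L2 K])

lemma E_integrable:
  assumes "traj T x u" "traj T y w"
  shows "(\<lambda>t. inner (C (x t)) (C (y t)) + inner (K (u t)) (K (w t))) integrable_on {0..T}"
  using assms by (intro integrable_add L2_inner_integrable traj_L2_C traj_L2_K)

lemma E_commute: "E T x u y w = E T y w x u"
  by (simp add: E_def inner_commute)

lemma E_add_right:
  assumes "traj T x u" "traj T y w" "traj T y' w'"
  shows "E T x u (\<lambda>t. y t + y' t) (\<lambda>t. w t + w' t) = E T x u y w + E T x u y' w'"
  unfolding E_def
  by (subst integral_add[symmetric])
    (use assms in \<open>auto intro!: E_integrable integral_cong simp: C.add K.add inner_add_right\<close>)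

lemma E_scaleR_right: "E T x u (\<lambda>t. c *\<^sub>R y t) (\<lambda>t. c *\<^sub>R w t) = c * E T x u y w"
  unfolding E_def
  by (subst integral_mult_right[symmetric]) (simp add: C.scaleR K.scaleR distrib_left)

lemma E_diff_right:
  assumes "traj T x u" "traj T y w" "traj T y' w'"
  shows "E T x u (\<lambda>t. y t - y' t) (\<lambda>t. w t - w' t) = E T x u y w - E T x u y' w'"
  using E_add_right[OF assms(1,2) traj_uminus[OF assms(3)]] E_scaleR_right[of T x u "-1" y' w'] by simp

lemma E_diff_left:
  assumes "traj T x u" "traj T y w" "traj T y' w'"
  shows "E T (\<lambda>t. y t - y' t) (\<lambda>t. w t - w' t) x u = E T y w x u - E T y' w' x u"
  using E_diff_right[OF assms] by (simp add: E_commute)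

lemma E_add_left:
  assumes "traj T x u" "traj T y w" "traj T y' w'"
  shows "E T (\<lambda>t. y t + y' t) (\<lambda>t. w t + w' t) x u = E T y w x u + E T y' w' x u"
  using E_add_right[OF assms] by (simp add: E_commute)

lemma E_square: "E T x u x u = integral {0..T} (\<lambda>t. (norm (C (x t)))\<^sup>2 + (norm (K (u t)))\<^sup>2)"
  by (simp add: E_def power2_norm_eq_inner)

lemma E_coercive:
  assumes "traj T x u"
  shows "m * sqnorm T u \<le> E T x u x u"
proof -
  have "m * sqnorm T u = integral {0..T} (\<lambda>t. m * (norm (u t))\<^sup>2)" by (simp add: sqnorm_def)
  also have "\<dots> \<le> E T x u x u"
    unfolding E_square
  proof (rule integral_le)
    show "(\<lambda>t. m * (norm (u t))\<^sup>2) integrable_on {0..T}"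
      by (intro integrable_on_mult_right L2_square_integrable traj_L2[OF assms])
    show "(\<lambda>t. (norm (C (x t)))\<^sup>2 + (norm (K (u t)))\<^sup>2) integrable_on {0..T}"
      using E_integrable[OF assms assms] by (simp add: power2_norm_eq_inner)
    show "m * (norm (u t))\<^sup>2 \<le> (norm (C (x t)))\<^sup>2 + (norm (K (u t)))\<^sup>2" for t
      using K_coercive[of "u t"] zero_le_power2[of "norm (C (x t))"] by linarith
  qed
  finally show ?thesis .
qed

lemma E_nonneg: "traj T x u \<Longrightarrow> 0 \<le> E T x u x u"
  using E_coercive[of T x u] m_pos by (meson less_imp_le mult_nonneg_nonneg order_trans sqnorm_nonneg)

lemma sqnorm_le_E: "traj T x u \<Longrightarrow> sqnorm T u \<le> E T x u x u / m"
  using E_coercive[of T x u] m_pos by (simp add: field_simps)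

lemma E_add_square:
  assumes "traj T x u" "traj T y w"
  shows "E T (\<lambda>t. x t + y t) (\<lambda>t. u t + w t) (\<lambda>t. x t + y t) (\<lambda>t. u t + w t)
     = E T x u x u + 2 * E T x u y w + E T y w y w"
  using E_add_right[OF traj_add[OF assms] assms] E_add_left[OF assms(1) assms] E_add_left[OF assms(2) assms]
  by (simp add: E_commute)

lemma E_Cauchy_Schwarz:
  assumes "traj T x u" "traj T y w"
  shows "(E T x u y w)\<^sup>2 \<le> E T x u x u * E T y w y w"
proof (rule quadratic_nonneg_imp_discriminant[OF _ E_nonneg[OF assms(2)]])
  fix s
  have "0 \<le> E T (\<lambda>t. x t + s *\<^sub>R y t) (\<lambda>t. u t + s *\<^sub>R w t) (\<lambda>t. x t + s *\<^sub>R y t) (\<lambda>t. u t + s *\<^sub>R w t)"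
    by (intro E_nonneg traj_add traj_scaleR assms)
  also have "\<dots> = E T x u x u + 2 * s * E T x u y w + s\<^sup>2 * E T y w y w"
    by (subst E_add_square[OF assms(1) traj_scaleR[OF assms(2)]])
      (simp add: E_scaleR_right E_commute[of T "\<lambda>t. s *\<^sub>R y t"] power2_eq_square)
  finally show "0 \<le> E T x u x u + 2 * s * E T x u y w + s\<^sup>2 * E T y w y w" .
qed

lemma E_split:
  assumes "traj T x u" "traj T y w" "0 \<le> s" "s \<le> T"
  shows "E T x u y w = E s x u y w + E (T - s) (\<lambda>t. x (s + t)) (\<lambda>t. u (s + t)) (\<lambda>t. y (s + t)) (\<lambda>t. w (s + t))"
  unfolding E_def
  using integral_split[OF assms(3,4) E_integrable[OF assms(1,2)]]
    integral_shift_real(2)[of "T-s" "\<lambda>t. inner (C (x t)) (C (y t)) + inner (K (u t)) (K (w t))" s]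
  by simp

lemma E_cong:
  assumes "negligible N" "\<And>t. t \<in> {0..T} - N \<Longrightarrow> x t = x' t \<and> u t = u' t \<and> y t = y' t \<and> w t = w' t"
  shows "E T x u y w = E T x' u' y' w'"
  unfolding E_def using assms by (intro integral_spike[of N]) auto

definition Lin :: "'h \<Rightarrow> 'u \<Rightarrow> real \<Rightarrow> (real \<Rightarrow> 'h) \<Rightarrow> (real \<Rightarrow> 'u) \<Rightarrow> real" where
  "Lin z v T x u = integral {0..T} (\<lambda>t. inner z (x t) + inner v (u t))"

lemma Lin_integrable:
  assumes "traj T x u"
  shows "(\<lambda>t. inner z (x t) + inner v (u t)) integrable_on {0..T}"
proof (intro integrable_add)
  show "(\<lambda>t. inner z (x t)) integrable_on {0..T}"
    by (intro integrable_continuous_real continuous_intros traj_continuous[OF assms])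
  show "(\<lambda>t. inner v (u t)) integrable_on {0..T}"
    using integrable_linear[OF L1_integrable[OF L2_imp_L1[OF traj_L2[OF assms]] order_refl] bounded_linear_inner_right]
    by (simp add: o_def)
qed

lemma Lin_add:
  assumes "traj T x u" "traj T y w"
  shows "Lin z v T (\<lambda>t. x t + y t) (\<lambda>t. u t + w t) = Lin z v T x u + Lin z v T y w"
  unfolding Lin_def
  by (subst integral_add[symmetric])
    (use assms in \<open>auto intro!: Lin_integrable integral_cong simp: inner_add_right\<close>)

lemma Lin_scaleR: "Lin z v T (\<lambda>t. c *\<^sub>R x t) (\<lambda>t. c *\<^sub>R u t) = c * Lin z v T x u"
  unfolding Lin_def by (subst integral_mult_right[symmetric]) (simp add: distrib_left)

definition J :: "'h \<Rightarrow> 'u \<Rightarrow> real \<Rightarrow> (real \<Rightarrow> 'h) \<Rightarrow> (real \<Rightarrow> 'u) \<Rightarrow> real" where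
  "J z v T x u = E T x u x u + 2 * Lin z v T x u"

lemma J_cong:
  assumes "\<And>t. t \<in> {0..T} \<Longrightarrow> x t = y t"
  shows "J z v T x u = J z v T y u"
  unfolding J_def E_def Lin_def
  by (intro arg_cong2[where f="(+)"] arg_cong[where f="\<lambda>a. 2 * a"] integral_cong) (simp_all only: assms)

text \<open>All integrands are absolutely integrable, so the Lebesgue integral in the definition is
  the gauge integral, and the cost splits into its quadratic and linear parts.\<close>

lemma cost_eq_J:
  assumes "L2 T u"
  shows "cost S B C K z v T x0 u = J z v T (mild x0 u) u"
proof -
  note tr = traj_mild[OF assms, of x0]
  let ?q = "\<lambda>t. inner (C (mild x0 u t)) (C (mild x0 u t)) + inner (K (u t)) (K (u t))"
  let ?l = "\<lambda>t. inner z (mild x0 u t) + inner v (u t)"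
  have "(\<lambda>t. norm z * norm (mild x0 u t) + norm v * norm (u t)) integrable_on {0..T}"
    by (intro integrable_add integrable_on_mult_right L2_norm_integrable L2_continuous traj_continuous[OF tr] assms)
  moreover have "norm (?l t) \<le> norm z * norm (mild x0 u t) + norm v * norm (u t)" for t
    unfolding real_norm_def by (intro order_trans[OF abs_triangle_ineq] add_mono Cauchy_Schwarz_ineq2)
  ultimately have l: "integrable (lebesgue_on {0..T}) ?l"
    by (intro absolutely_integrable_imp_integrable absolutely_integrable_integrable_bound[OF _ Lin_integrable[OF tr]]) auto
  have q: "integrable (lebesgue_on {0..T}) ?q"
    using E_integrable[OF tr tr] by (subst integrable_lebesgue_on_iff) auto
  have "cost S B C K z v T x0 u = (LINT t|lebesgue_on {0..T}. ?q t + 2 * ?l t)"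
    unfolding cost_def running_cost_def
    by (simp add: power2_norm_eq_inner[symmetric] inner_eq_Re_cinner[symmetric] distrib_left add.assoc)
  also have "\<dots> = (LINT t|lebesgue_on {0..T}. ?q t) + (LINT t|lebesgue_on {0..T}. 2 * ?l t)"
    by (intro Bochner_Integration.integral_add q integrable_mult_right l)
  also have "\<dots> = J z v T (mild x0 u) u"
    unfolding Bochner_Integration.integral_mult_right[OF l] J_def E_def Lin_def
      lebesgue_integral_eq_integral[OF q lebesgue_Icc] lebesgue_integral_eq_integral[OF l lebesgue_Icc] ..
  finally show ?thesis .
qed

lemma J_add:
  assumes "traj T x u" "traj T y w"
  shows "J z v T (\<lambda>t. x t + y t) (\<lambda>t. u t + w t) = J z v T x u + 2 * (E T x u y w + Lin z v T y w) + E T y w y w"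
  unfolding J_def using E_add_square[OF assms] Lin_add[OF assms] by simp

lemma J_add_scaleR:
  assumes "traj T x u" "traj T y w"
  shows "J z v T (\<lambda>t. x t + s *\<^sub>R y t) (\<lambda>t. u t + s *\<^sub>R w t)
    = J z v T x u + 2 * s * (E T x u y w + Lin z v T y w) + s\<^sup>2 * E T y w y w"
  using J_add[OF assms(1) traj_scaleR[OF assms(2)], of z v s]
  by (simp add: E_scaleR_right Lin_scaleR E_commute[of T "\<lambda>t. s *\<^sub>R y t"] power2_eq_square algebra_simps)

text \<open>The Euler-Lagrange equation in weak form: half the first variation of \<open>J\<close>
  vanishes in all directions that keep the initial state.\<close>

definition stationary :: "'h \<Rightarrow> 'u \<Rightarrow> real \<Rightarrow> (real \<Rightarrow> 'h) \<Rightarrow> (real \<Rightarrow> 'u) \<Rightarrow> bool" where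
  "stationary z v T x u \<longleftrightarrow> traj T x u \<and>
     (\<forall>y w. traj T y w \<longrightarrow> y 0 = 0 \<longrightarrow> E T x u y w + Lin z v T y w = 0)"

lemma optimal_imp_stationary:
  assumes opt: "optimal_pair S B C K z v T x0 x u" and T: "0 \<le> T"
  shows "stationary z v T x u \<and> x 0 = x0"
proof -
  have L: "L2 T u" and x: "\<And>t. t \<in> {0..T} \<Longrightarrow> x t = mild x0 u t"
    and min: "\<And>w. L2 T w \<Longrightarrow> cost S B C K z v T x0 u \<le> cost S B C K z v T x0 w"
    using opt by (auto simp: optimal_pair_def L2_controls_iff)
  have x0: "x 0 = x0" using x[of 0] T by simp
  have tr: "traj T x u" using L x x0 by (intro trajI) auto
  have Jx: "J z v T x u = J z v T (mild x0 u) u"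
    by (rule J_cong[OF x])
  have "E T x u y w + Lin z v T y w = 0" if y: "traj T y w" "y 0 = 0" for y w
  proof (rule quadratic_nonneg_imp_linear_zero)
    fix s
    let ?x = "\<lambda>t. x t + s *\<^sub>R y t" and ?u = "\<lambda>t. u t + s *\<^sub>R w t"
    have tr': "traj T ?x ?u" by (intro traj_add traj_scaleR tr y)
    have xm: "?x t = mild x0 ?u t" if "t \<in> {0..T}" for t
      using trajD[OF tr', of t] that x0 y(2) by simp
    have "J z v T ?x ?u = J z v T (mild x0 ?u) ?u"
      by (rule J_cong[OF xm])
    hence "J z v T x u \<le> J z v T ?x ?u"
      using min[OF traj_L2[OF tr']] cost_eq_J[OF L] cost_eq_J[OF traj_L2[OF tr']] Jx by simp
    thus "0 \<le> 2 * s * (E T x u y w + Lin z v T y w) + s\<^sup>2 * E T y w y w"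
      unfolding J_add_scaleR[OF tr y(1)] by simp
  qed
  thus ?thesis using tr x0 by (simp add: stationary_def)
qed

text \<open>The difference of two solutions is an admissible test and orthogonal to itself, so
  coercivity makes its control vanish in the mean. The states then agree at each time, the controls
  almost everywhere.\<close>

lemma stationary_unique:
  assumes "stationary z v T x u" "stationary z v T x' u'" "x 0 = x' 0"
  shows "sqnorm T (\<lambda>t. u' t - u t) = 0" "\<And>t. t \<in> {0..T} \<Longrightarrow> x' t = x t"
proof -
  have tr: "traj T x u" "traj T x' u'" using assms by (auto simp: stationary_def)
  let ?y = "\<lambda>t. x' t - x t" and ?w = "\<lambda>t. u' t - u t"
  have y: "traj T ?y ?w" by (intro traj_diff tr)
  have "E T x u ?y ?w + Lin z v T ?y ?w = 0" "E T x' u' ?y ?w + Lin z v T ?y ?w = 0"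
    using assms y by (auto simp: stationary_def)
  hence "E T ?y ?w ?y ?w = 0" using E_diff_left[OF y tr(2,1)] by simp
  hence "m * sqnorm T ?w \<le> 0" using E_coercive[OF y] by simp
  thus 0: "sqnorm T ?w = 0" using m_pos sqnorm_nonneg[of T ?w] by (simp add: mult_le_0_iff antisym)
  fix t assume t: "t \<in> {0..T}"
  obtain c where "norm (?y t) \<le> c * (norm (?y 0) + sqrt (sqnorm T ?w))"
    using traj_bound[of T] y t by blast
  thus "x' t = x t" using 0 assms(3) by simp
qed

lemma sqnorm_zero_AE:
  assumes "L2 T w" "sqnorm T w = 0"
  shows "AE t in lebesgue_on {0..T}. w t = 0"
proof -
  have "(\<lambda>t. (norm (w t))\<^sup>2) \<in> borel_measurable (lebesgue_on {0..T})"
    using L2_square_integrable[OF assms(1)] by (rule integrable_imp_measurable)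
  hence "AE t in lebesgue_on {0..T}. ennreal ((norm (w t))\<^sup>2) = 0"
    using nn_integral_square[OF assms(1)] assms(2) by (subst nn_integral_0_iff_AE[symmetric]) auto
  thus ?thesis by eventually_elim simp
qed

text \<open>The expansion of \<open>J\<close> about a stationary pair has no linear term and a
  nonnegative quadratic one, so the variational equation is sufficient as well as necessary.\<close>

lemma stationary_imp_the_optimal:
  assumes st: "stationary z v T x u" and x0: "x 0 = x0" and T: "0 \<le> T"
  shows "the_optimal_pair S B C K z v T x0 x u"
proof -
  have tr: "traj T x u" using st by (simp add: stationary_def)
  hence L: "L2 T u" and x: "\<And>t. t \<in> {0..T} \<Longrightarrow> x t = mild x0 u t"
    using x0 trajD[OF tr] traj_L2[OF tr] by (metis atLeastAtMost_iff)+
  have Jx: "J z v T x u = J z v T (mild x0 u) u"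
    by (rule J_cong[OF x])
  have "cost S B C K z v T x0 u \<le> cost S B C K z v T x0 w" if w: "L2 T w" for w
  proof -
    let ?y = "\<lambda>t. mild x0 w t - x t" and ?d = "\<lambda>t. w t - u t"
    have y: "traj T ?y ?d" by (intro traj_diff tr traj_mild w)
    have "J z v T (mild x0 w) w = J z v T x u + 2 * (E T x u ?y ?d + Lin z v T ?y ?d) + E T ?y ?d ?y ?d"
      using J_add[OF tr y, of z v] by simp
    moreover have "E T x u ?y ?d + Lin z v T ?y ?d = 0" using st y x0 by (simp add: stationary_def)
    ultimately show ?thesis using E_nonneg[OF y] cost_eq_J[OF L] cost_eq_J[OF w] Jx by simp
  qed
  hence "optimal_pair S B C K z v T x0 x u"
    using L x by (auto simp: optimal_pair_def L2_controls_iff)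
  moreover have "(\<forall>t\<in>{0..T}. x' t = x t) \<and> (AE t in lebesgue_on {0..T}. u' t = u t)"
    if o: "optimal_pair S B C K z v T x0 x' u'" for x' u'
  proof -
    have st': "stationary z v T x' u'" "x' 0 = x0" using optimal_imp_stationary[OF o T] by auto
    have "L2 T (\<lambda>t. u' t - u t)" using st' st by (intro L2_diff) (auto simp: stationary_def intro: traj_L2)
    from sqnorm_zero_AE[OF this] stationary_unique[OF st st'(1)] st'(2) x0 show ?thesis by auto
  qed
  ultimately show ?thesis by (auto simp: the_optimal_pair_def)
qed

end

section \<open>Adjoints and existence of minimizers\<close>

text \<open>Lax-Milgram on a closed subspace. With \<open>Z\<close> the whole space it gives the
  Riesz representation; with \<open>Z\<close> the steady pairs, on which the static cost is
  coercive, it gives the optimal steady state.\<close>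

lemma coercive_minimizer:
  fixes Q :: "'a::{real_inner,complete_space} \<Rightarrow> 'b::real_inner" and l :: "'a \<Rightarrow> real"
  assumes Z: "subspace Z" "closed Z" and Q: "bounded_linear Q" and l: "bounded_linear l"
    and c: "c > 0" "\<And>p. p \<in> Z \<Longrightarrow> c * (norm p)\<^sup>2 \<le> (norm (Q p))\<^sup>2"
  shows "\<exists>p\<in>Z. \<forall>q\<in>Z. inner (Q p) (Q q) = l q"
proof -
  interpret Q: bounded_linear Q by fact
  interpret l: bounded_linear l by fact
  define J where "J p = inner (Q p) (Q p) - 2 * l p" for p
  have J_add: "J (p + q) = J p + 2 * (inner (Q p) (Q q) - l q) + inner (Q q) (Q q)" for p q
    by (simp add: J_def Q.add l.add inner_add inner_commute[of "Q q" "Q p"])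
  obtain k where k: "\<And>p. norm (l p) \<le> norm p * k" using l.bounded by blast
  have "\<exists>p\<in>Z. \<forall>q\<in>Z. J p \<le> J q"
  \<comment> \<open>\<open>d\<close> is what the parallelogram law leaves over at the midpoint,
    bounded below by coercivity; \<open>b\<close> comes from completing the square in
    \<open>c * (norm p)\<^sup>2 - 2 * k * norm p\<close>.\<close>
  proof (rule minimizer_exists[where d = "\<lambda>p q. c * (norm (p - q))\<^sup>2 / 2" and b = "- k\<^sup>2 / c"])
    show "Z \<noteq> {}" using subspace_0[OF Z(1)] by auto
    show "- k\<^sup>2 / c \<le> J p" if p: "p \<in> Z" for p
    proof -
      have "0 \<le> c * (norm p - k / c)\<^sup>2" using c by simp
      also have "\<dots> = c * (norm p)\<^sup>2 - 2 * (norm p * k) + k\<^sup>2 / c"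
        using c(1) by (simp add: power2_diff field_simps power2_eq_square)
      also have "c * (norm p)\<^sup>2 - 2 * (norm p * k) \<le> J p"
        using c(2)[OF p] k[of p] unfolding J_def power2_norm_eq_inner[symmetric] real_norm_def by linarith
      finally show ?thesis by simp
    qed
    show "\<exists>r\<in>Z. 2 * J r + c * (norm (p - q))\<^sup>2 / 2 \<le> J p + J q" if pq: "p \<in> Z" "q \<in> Z" for p q
    proof
      define r d where "r = (1/2) *\<^sub>R (p + q)" and "d = (1/2) *\<^sub>R (p - q)"
      show "r \<in> Z" unfolding r_def using pq Z by (intro subspace_scale subspace_add)
      have "p = r + d" "q = r + (-1) *\<^sub>R d"
        by (simp_all add: r_def d_def algebra_simps flip: scaleR_add_left)
      hence "J p + J q = 2 * J r + 2 * inner (Q d) (Q d)"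
        by (simp only: J_add Q.scaleR l.scaleR) simp
      moreover have "2 * inner (Q d) (Q d) = (norm (Q (p - q)))\<^sup>2 / 2"
        by (simp add: d_def Q.scaleR power2_norm_eq_inner)
      moreover have "c * (norm (p - q))\<^sup>2 \<le> (norm (Q (p - q)))\<^sup>2"
        using pq Z by (intro c subspace_diff)
      ultimately show "2 * J r + c * (norm (p - q))\<^sup>2 / 2 \<le> J p + J q" by linarith
    qed
  next
    fix p :: "nat \<Rightarrow> 'a" assume p: "\<And>n. p n \<in> Z"
      and C: "\<And>e. e > 0 \<Longrightarrow> \<exists>N. \<forall>m\<ge>N. \<forall>n\<ge>N. c * (norm (p m - p n))\<^sup>2 / 2 < e"
    have "Cauchy p"
    proof (rule metric_CauchyI)
      fix e :: real assume e: "e > 0"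
      obtain N where N: "\<forall>m\<ge>N. \<forall>n\<ge>N. c * (norm (p m - p n))\<^sup>2 / 2 < c * e\<^sup>2 / 2"
        using C[of "c * e\<^sup>2 / 2"] e c by auto
      have "dist (p m) (p n) < e" if "m \<ge> N" "n \<ge> N" for m n
        using N that c(1) e by (auto simp: dist_norm intro: power2_less_imp_less)
      thus "\<exists>M. \<forall>m\<ge>M. \<forall>n\<ge>M. dist (p m) (p n) < e" by blast
    qed
    then obtain q where q: "p \<longlonglongrightarrow> q" using Cauchy_convergent_iff convergent_def by blast
    have "q \<in> Z" using closed_sequentially[OF Z(2) p q] .
    moreover have "(\<lambda>n. J (p n)) \<longlonglongrightarrow> J q"
      unfolding J_def by (intro tendsto_intros Q.tendsto l.tendsto q)
    ultimately show "\<exists>q\<in>Z. (\<lambda>n. J (p n)) \<longlonglongrightarrow> J q" by blast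
  qed
  then obtain p where p: "p \<in> Z" "\<And>q. q \<in> Z \<Longrightarrow> J p \<le> J q" by blast
  have "inner (Q p) (Q q) - l q = 0" if q: "q \<in> Z" for q
  proof (rule quadratic_nonneg_imp_linear_zero)
    fix s
    have "J p \<le> J (p + s *\<^sub>R q)" using p q Z by (intro p subspace_add subspace_scale)
    thus "0 \<le> 2 * s * (inner (Q p) (Q q) - l q) + s\<^sup>2 * inner (Q q) (Q q)"
      by (simp add: J_add Q.scaleR l.scaleR power2_eq_square algebra_simps)
  qed
  with p(1) show ?thesis by auto
qed

lemma Riesz_representation:
  fixes l :: "'a::{real_inner,complete_space} \<Rightarrow> real"
  assumes "bounded_linear l"
  shows "\<exists>g. \<forall>x. inner g x = l x"
  using coercive_minimizer[of UNIV "\<lambda>x. x" l 1] assms bounded_linear_ident by auto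

text \<open>Real inner products determine complex ones once the first argument may be rotated: the
  factor \<open>-\<i>\<close> moves the imaginary part to the real part.\<close>

lemma cinner_eqI:
  fixes x y :: "'a::chilbert_space"
  assumes "\<And>c. inner (c *\<^sub>C x) y = inner (c *\<^sub>C x') y'"
  shows "cinner x y = cinner x' y'"
proof (rule complex_eqI)
  have scale_1: "1 *\<^sub>C a = a" for a :: "'b::chilbert_space"
    using scaleR_scaleC[of 1 a] by simp
  show "Re (cinner x y) = Re (cinner x' y')"
    using assms[of 1] by (simp add: inner_eq_Re_cinner cinner_scaleC_left)
  show "Im (cinner x y) = Im (cinner x' y')"
    using assms[of "-\<i>"] by (simp add: inner_eq_Re_cinner cinner_scaleC_left)
qed

text \<open>This makes the definite description meaningful: Riesz representation of real functionals
  gives a candidate, complex linearity of \<open>F\<close> lifts the identity from real to complex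
  inner products, and nondegeneracy gives uniqueness.\<close>

lemma cadjoint_cinner:
  fixes F :: "'a::chilbert_space \<Rightarrow> 'b::chilbert_space"
  assumes "bounded_clinear F"
  shows "cinner (F x) y = cinner x (cadjoint F y)"
proof -
  have F: "bounded_linear F" "\<And>c x. F (c *\<^sub>C x) = c *\<^sub>C F x"
    using assms by (auto simp: bounded_clinear_def)
  have "\<exists>g. \<forall>x. inner g x = inner (F x) y" for y
    by (intro Riesz_representation bounded_linear_compose[OF bounded_linear_inner_left F(1)])
  then obtain G where G: "\<And>x y. inner (G y) x = inner (F x) y" by metis
  have ex: "cinner (F x) y = cinner x (G y)" for x y
    by (rule cinner_eqI) (metis F(2) G inner_commute)
  have "cadjoint F = G"
    unfolding cadjoint_def
  proof (rule the_equality)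
    show "\<forall>x y. cinner (F x) y = cinner x (G y)" using ex by blast
    fix G' assume G': "\<forall>x y. cinner (F x) y = cinner x (G' y)"
    show "G' = G"
    proof
      fix y
      have "inner x (G' y) = inner x (G y)" for x
        using G' ex by (simp add: inner_eq_Re_cinner)
      thus "G' y = G y" by (metis inner_commute vector_eq_rdot)
    qed
  qed
  with ex show ?thesis by simp
qed

lemma coercive_lower_bound:
  assumes "bounded_clinear K" "coercive K"
  obtains m where "m > 0" "\<And>u. m * (norm u)\<^sup>2 \<le> (norm (K u))\<^sup>2"
proof -
  obtain m where m: "m > 0" "\<And>u. Re (cinner (cadjoint K (K u)) u) \<ge> m * (norm u)\<^sup>2"
    using assms(2) by (auto simp: coercive_def)
  have "Re (cinner (cadjoint K (K u)) u) = (norm (K u))\<^sup>2" for u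
    using cadjoint_cinner[OF assms(1), of u "K u"] cinner_commute[of "cadjoint K (K u)" u]
    by (simp add: power2_norm_eq_inner inner_eq_Re_cinner)
  with m that show ?thesis by metis
qed

section \<open>Existence of optimal pairs\<close>

context lq_system
begin

lemma E_bound:
  assumes "0 \<le> T"
  shows "\<exists>c\<ge>0. \<forall>x u. traj T x u \<longrightarrow> E T x u x u \<le> c * (norm (x 0) + sqrt (sqnorm T u))\<^sup>2"
proof -
  obtain c1 where c1: "c1 \<ge> 1" "\<And>x u t. traj T x u \<Longrightarrow> t \<in> {0..T} \<Longrightarrow> norm (x t) \<le> c1 * (norm (x 0) + sqrt (sqnorm T u))"
    using traj_bound[of T] by blast
  obtain k1 where k1: "k1 \<ge> 0" "\<And>x. norm (C x) \<le> norm x * k1" using C.nonneg_bounded by blast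
  obtain k2 where k2: "k2 \<ge> 0" "\<And>x. norm (K x) \<le> norm x * k2" using K.nonneg_bounded by blast
  have "E T x u x u \<le> ((c1 * k1)\<^sup>2 * T + k2\<^sup>2) * (norm (x 0) + sqrt (sqnorm T u))\<^sup>2" if x: "traj T x u" for x u
  proof -
    define r where "r = norm (x 0) + sqrt (sqnorm T u)"
    have i: "(\<lambda>t. k2\<^sup>2 * (norm (u t))\<^sup>2) integrable_on {0..T}"
      by (intro integrable_on_mult_right L2_square_integrable traj_L2[OF x])
    have "E T x u x u \<le> integral {0..T} (\<lambda>t. (c1 * k1 * r)\<^sup>2 + k2\<^sup>2 * (norm (u t))\<^sup>2)"
      unfolding E_square
    proof (rule integral_le)
      show "(\<lambda>t. (norm (C (x t)))\<^sup>2 + (norm (K (u t)))\<^sup>2) integrable_on {0..T}"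
        using E_integrable[OF x x] by (simp add: power2_norm_eq_inner)
      show "(\<lambda>t. (c1 * k1 * r)\<^sup>2 + k2\<^sup>2 * (norm (u t))\<^sup>2) integrable_on {0..T}"
        by (intro integrable_add i) auto
      fix t assume t: "t \<in> {0..T}"
      have "norm (C (x t)) \<le> c1 * r * k1"
        using c1(2)[OF x t] k1 by (intro order_trans[OF k1(2)] mult_right_mono) (auto simp: r_def)
      hence "(norm (C (x t)))\<^sup>2 \<le> (c1 * k1 * r)\<^sup>2"
        by (intro power_mono) (auto simp: mult_ac)
      moreover have "(norm (K (u t)))\<^sup>2 \<le> k2\<^sup>2 * (norm (u t))\<^sup>2"
        using power_mono[OF k2(2)[of "u t"], of 2] by (simp add: power_mult_distrib mult.commute)
      ultimately show "(norm (C (x t)))\<^sup>2 + (norm (K (u t)))\<^sup>2 \<le> (c1 * k1 * r)\<^sup>2 + k2\<^sup>2 * (norm (u t))\<^sup>2" by simp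
    qed
    also have "\<dots> = (c1 * k1)\<^sup>2 * T * r\<^sup>2 + k2\<^sup>2 * sqnorm T u"
      using assms by (subst integral_add[OF _ i]) (auto simp: sqnorm_def power_mult_distrib)
    also have "sqnorm T u = (sqrt (sqnorm T u))\<^sup>2" by simp
    also have "\<dots> \<le> r\<^sup>2" by (intro power_mono) (auto simp: r_def)
    finally show ?thesis by (simp add: r_def distrib_right mult_left_mono)
  qed
  thus ?thesis using assms by (intro exI[of _ "(c1 * k1)\<^sup>2 * T + k2\<^sup>2"]) auto
qed

lemma Lin_bound:
  assumes "0 \<le> T"
  shows "\<exists>c\<ge>0. \<forall>x u. traj T x u \<longrightarrow> \<bar>Lin z v T x u\<bar> \<le> c * (norm (x 0) + sqrt (sqnorm T u))"
proof -
  obtain c1 where c1: "c1 \<ge> 1" "\<And>x u t. traj T x u \<Longrightarrow> t \<in> {0..T} \<Longrightarrow> norm (x t) \<le> c1 * (norm (x 0) + sqrt (sqnorm T u))"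
    using traj_bound[of T] by blast
  have "\<bar>Lin z v T x u\<bar> \<le> (norm z * c1 * T + norm v * sqrt T) * (norm (x 0) + sqrt (sqnorm T u))" if x: "traj T x u" for x u
  proof -
    define r where "r = norm (x 0) + sqrt (sqnorm T u)"
    have i: "(\<lambda>t. norm v * norm (u t)) integrable_on {0..T}"
      by (intro integrable_on_mult_right L2_norm_integrable traj_L2[OF x])
    have "norm (Lin z v T x u) \<le> integral {0..T} (\<lambda>t. norm z * (c1 * r) + norm v * norm (u t))"
      unfolding Lin_def
    proof (rule integral_norm_bound_integral[OF Lin_integrable[OF x]])
      show "(\<lambda>t. norm z * (c1 * r) + norm v * norm (u t)) integrable_on {0..T}"
        by (intro integrable_add i) auto
      fix t assume t: "t \<in> {0..T}"
      have "\<bar>inner z (x t)\<bar> \<le> norm z * (c1 * r)"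
        using c1(2)[OF x t] by (intro order_trans[OF Cauchy_Schwarz_ineq2] mult_left_mono) (auto simp: r_def)
      thus "norm (inner z (x t) + inner v (u t)) \<le> norm z * (c1 * r) + norm v * norm (u t)"
        using Cauchy_Schwarz_ineq2[of v "u t"] by simp
    qed
    also have "\<dots> = norm z * c1 * T * r + norm v * integral {0..T} (\<lambda>t. norm (u t))"
      using assms by (subst integral_add[OF _ i]) auto
    also have "\<dots> \<le> norm z * c1 * T * r + norm v * (sqrt T * r)"
      using integral_norm_le_L2[OF traj_L2[OF x] assms]
      by (intro add_left_mono mult_left_mono)
        (auto simp: r_def sqnorm_def[symmetric] assms intro!: order_trans[OF _ mult_left_mono[of "sqrt (sqnorm T u)"]])
    finally show ?thesis by (simp add: r_def distrib_right mult.assoc)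
  qed
  thus ?thesis using assms c1(1) by (intro exI[of _ "norm z * c1 * T + norm v * sqrt T"]) auto
qed

lemma J_L2_continuous:
  assumes T: "0 \<le> T" and tr: "traj T x u" and trn: "\<And>n. traj T (xn n) (un n)" and init: "\<And>n. xn n 0 = x 0"
    and lim: "(\<lambda>n. sqnorm T (\<lambda>t. un n t - u t)) \<longlonglongrightarrow> 0"
  shows "(\<lambda>n. J z v T (xn n) (un n)) \<longlonglongrightarrow> J z v T x u"
proof -
  let ?y = "\<lambda>n t. xn n t - x t" and ?w = "\<lambda>n t. un n t - u t"
  have y: "traj T (?y n) (?w n)" for n by (intro traj_diff tr trn)
  obtain c where c: "c \<ge> 0" "\<And>x u. traj T x u \<Longrightarrow> E T x u x u \<le> c * (norm (x 0) + sqrt (sqnorm T u))\<^sup>2"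
    using E_bound[OF T] by blast
  obtain c' where c': "c' \<ge> 0" "\<And>x u. traj T x u \<Longrightarrow> \<bar>Lin z v T x u\<bar> \<le> c' * (norm (x 0) + sqrt (sqnorm T u))"
    using Lin_bound[OF T] by blast
  have Ey: "E T (?y n) (?w n) (?y n) (?w n) \<le> c * sqnorm T (?w n)" for n
    using c(2)[OF y[of n]] init by simp
  have E0: "(\<lambda>n. E T (?y n) (?w n) (?y n) (?w n)) \<longlonglongrightarrow> 0"
  proof (rule Lim_null_comparison)
    show "\<forall>\<^sub>F n in sequentially. norm (E T (?y n) (?w n) (?y n) (?w n)) \<le> c * sqnorm T (?w n)"
      using Ey E_nonneg[OF y] by (intro always_eventually) auto
    show "(\<lambda>n. c * sqnorm T (?w n)) \<longlonglongrightarrow> 0" using tendsto_mult_right_zero[OF lim] .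
  qed
  have L0: "(\<lambda>n. Lin z v T (?y n) (?w n)) \<longlonglongrightarrow> 0"
  proof (rule Lim_null_comparison)
    show "\<forall>\<^sub>F n in sequentially. norm (Lin z v T (?y n) (?w n)) \<le> c' * sqrt (sqnorm T (?w n))"
      using c'(2)[OF y] init by (intro always_eventually) simp
    show "(\<lambda>n. c' * sqrt (sqnorm T (?w n))) \<longlonglongrightarrow> 0"
      using tendsto_mult_right_zero[OF tendsto_real_sqrt[OF lim, simplified]] .
  qed
  have X0: "(\<lambda>n. E T x u (?y n) (?w n)) \<longlonglongrightarrow> 0"
  proof (rule Lim_null_comparison)
    show "\<forall>\<^sub>F n in sequentially. norm (E T x u (?y n) (?w n)) \<le> sqrt (E T x u x u * E T (?y n) (?w n) (?y n) (?w n))"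
      using E_Cauchy_Schwarz[OF tr y] by (intro always_eventually) (simp add: real_le_rsqrt)
    show "(\<lambda>n. sqrt (E T x u x u * E T (?y n) (?w n) (?y n) (?w n))) \<longlonglongrightarrow> 0"
      using tendsto_real_sqrt[OF tendsto_mult_right_zero[OF E0, of "E T x u x u"]] by simp
  qed
  have "J z v T (xn n) (un n) = J z v T x u + 2 * (E T x u (?y n) (?w n) + Lin z v T (?y n) (?w n)) + E T (?y n) (?w n) (?y n) (?w n)" for n
    using J_add[OF tr y[of n], of z v] by simp
  moreover have "(\<lambda>n. J z v T x u + 2 * (E T x u (?y n) (?w n) + Lin z v T (?y n) (?w n)) + E T (?y n) (?w n) (?y n) (?w n))
      \<longlonglongrightarrow> J z v T x u + 2 * (0 + 0) + 0"
    by (intro tendsto_intros E0 L0 X0)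
  ultimately show ?thesis by simp
qed

text \<open>Direct method over controls: \<open>J\<close> is uniformly convex with respect to the
  energy of differences, and the energy dominates \<open>sqnorm\<close>, so minimizing sequences
  converge in the mean.\<close>

lemma stationary_exists:
  assumes T: "0 \<le> T"
  shows "\<exists>x u. stationary z v T x u \<and> x 0 = x0"
proof -
  let ?J = "\<lambda>u. J z v T (mild x0 u) u"
  let ?d = "\<lambda>u w. E T (\<lambda>t. mild x0 u t - mild x0 w t) (\<lambda>t. u t - w t) (\<lambda>t. mild x0 u t - mild x0 w t) (\<lambda>t. u t - w t) / 2"
  obtain c where c: "c \<ge> 0" "\<And>x u. traj T x u \<Longrightarrow> \<bar>Lin z v T x u\<bar> \<le> c * (norm (x 0) + sqrt (sqnorm T u))"
    using Lin_bound[OF T] by blast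
  have "\<exists>u\<in>{u. L2 T u}. \<forall>w\<in>{u. L2 T u}. ?J u \<le> ?J w"
  \<comment> \<open>The lower bound completes the square in \<open>r = sqrt (sqnorm T u)\<close>:
    the quadratic part contributes at least \<open>m * r\<^sup>2\<close>, the linear part at least
    \<open>- 2 * c * (norm x0 + r)\<close>.\<close>
  proof (rule minimizer_exists[where d = ?d and b = "- 2 * c * norm x0 - c\<^sup>2 / m"])
    show "{u. L2 T u} \<noteq> ({} :: (real \<Rightarrow> 'u) set)" using L2_zero by blast
  next
    fix u :: "real \<Rightarrow> 'u" assume "u \<in> {u. L2 T u}"
    hence tr: "traj T (mild x0 u) u" by (simp add: traj_mild)
    define r where "r = sqrt (sqnorm T u)"
    have r: "r\<^sup>2 = sqnorm T u" by (simp add: r_def)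
    have "0 \<le> m * (r - c / m)\<^sup>2" using m_pos by simp
    also have "\<dots> = m * r\<^sup>2 - 2 * c * r + c\<^sup>2 / m"
      using m_pos by (simp add: power2_diff field_simps power2_eq_square)
    finally have "- 2 * c * norm x0 - c\<^sup>2 / m \<le> m * r\<^sup>2 - 2 * (c * (norm x0 + r))"
      by (simp add: algebra_simps)
    also have "\<dots> \<le> ?J u"
      using E_coercive[OF tr] c(2)[OF tr] unfolding J_def r by (simp add: r_def[symmetric])
    finally show "- 2 * c * norm x0 - c\<^sup>2 / m \<le> ?J u" .
  next
    fix u w :: "real \<Rightarrow> 'u" assume "u \<in> {u. L2 T u}" "w \<in> {u. L2 T u}"
    hence L: "L2 T u" "L2 T w" by auto
    let ?r = "\<lambda>t. (1/2) *\<^sub>R (u t + w t)"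
    have Lr: "L2 T ?r" by (intro L2_scaleR L2_add L)
    let ?e = "\<lambda>t. mild x0 u t - mild x0 w t" and ?f = "\<lambda>t. u t - w t"
    let ?s = "\<lambda>t. (1/2) *\<^sub>R (mild x0 u t + mild x0 w t)"
    have half: "(1/2::real) *\<^sub>R (a + b) + (1/2::real) *\<^sub>R (a - b) = a" "(1/2::real) *\<^sub>R (a + b) + (-1/2::real) *\<^sub>R (a - b) = b"
      for a b :: "'z::real_vector"
      by (simp_all add: algebra_simps flip: scaleR_add_left)
    have ts: "traj T ?s ?r" and te: "traj T ?e ?f"
      by (intro traj_scaleR traj_add traj_diff traj_mild L)+
    have "?s 0 = x0" by (simp flip: scaleR_add_left scaleR_2)
    hence sr: "?s t = mild x0 ?r t" if "t \<in> {0..T}" for t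
      using trajD[OF ts, of t] that by simp
    have Js: "J z v T ?s ?r = ?J ?r"
      by (rule J_cong[OF sr])
    have "?J u = J z v T ?s ?r + (E T ?s ?r ?e ?f + Lin z v T ?e ?f) + E T ?e ?f ?e ?f / 4"
      using J_add_scaleR[OF ts te, of z v "1/2"] unfolding half by (simp add: power2_eq_square)
    moreover have "?J w = J z v T ?s ?r - (E T ?s ?r ?e ?f + Lin z v T ?e ?f) + E T ?e ?f ?e ?f / 4"
      using J_add_scaleR[OF ts te, of z v "-1/2"] unfolding half by (simp add: power2_eq_square)
    ultimately have "2 * ?J ?r + ?d u w \<le> ?J u + ?J w" using Js by linarith
    thus "\<exists>r\<in>{u. L2 T u}. 2 * ?J r + ?d u w \<le> ?J u + ?J w" using Lr by blast
  next
    fix p :: "nat \<Rightarrow> real \<Rightarrow> 'u" assume p: "\<And>n. p n \<in> {u. L2 T u}"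
      and Cau: "\<And>e. e > 0 \<Longrightarrow> \<exists>N. \<forall>m\<ge>N. \<forall>n\<ge>N. ?d (p m) (p n) < e"
    have L: "L2 T (p n)" for n using p by simp
    have "\<exists>F. L2 T F \<and> (\<lambda>n. sqnorm T (\<lambda>t. p n t - F t)) \<longlonglongrightarrow> 0"
    proof (rule L2_complete[OF L T])
      fix e :: real assume e: "e > 0"
      then obtain N where N: "\<And>i n. i \<ge> N \<Longrightarrow> n \<ge> N \<Longrightarrow> ?d (p i) (p n) < e * m / 2" using Cau[of "e * m / 2"] m_pos by auto
      have "sqnorm T (\<lambda>t. p i t - p n t) < e" if "i \<ge> N" "n \<ge> N" for i n
      proof -
        have "traj T (\<lambda>t. mild x0 (p i) t - mild x0 (p n) t) (\<lambda>t. p i t - p n t)" by (intro traj_diff traj_mild L)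
        from E_coercive[OF this] N[OF that] have "m * sqnorm T (\<lambda>t. p i t - p n t) < m * e" by (simp add: mult.commute)
        thus ?thesis using m_pos by simp
      qed
      thus "\<exists>N. \<forall>m\<ge>N. \<forall>n\<ge>N. sqnorm T (\<lambda>t. p m t - p n t) < e" by blast
    qed
    then obtain F where F: "L2 T F" "(\<lambda>n. sqnorm T (\<lambda>t. p n t - F t)) \<longlonglongrightarrow> 0" by blast
    have "(\<lambda>n. ?J (p n)) \<longlonglongrightarrow> ?J F"
      by (rule J_L2_continuous[OF T traj_mild[OF F(1)] traj_mild[OF L] _ F(2)]) simp
    thus "\<exists>q\<in>{u. L2 T u}. (\<lambda>n. ?J (p n)) \<longlonglongrightarrow> ?J q" using F(1) by blast
  qed
  then obtain u where u: "L2 T u" "\<And>w. L2 T w \<Longrightarrow> ?J u \<le> ?J w" by blast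
  hence "optimal_pair S B C K z v T x0 (mild x0 u) u"
    by (auto simp: optimal_pair_def L2_controls_iff cost_eq_J)
  from optimal_imp_stationary[OF this T] show ?thesis by blast
qed

end

section \<open>Optimal trajectories of the homogeneous problem\<close>

context lq_system
begin

lemma Lin_zero [simp]: "Lin 0 0 T x u = 0"
  by (simp add: Lin_def)

lemma stationary_traj: "stationary z v T x u \<Longrightarrow> traj T x u"
  by (simp add: stationary_def)

lemma stationary_diff:
  assumes "stationary z v T x u" "stationary z v T x' u'"
  shows "stationary 0 0 T (\<lambda>t. x t - x' t) (\<lambda>t. u t - u' t)"
  unfolding stationary_def
proof (intro conjI allI impI)
  show "traj T (\<lambda>t. x t - x' t) (\<lambda>t. u t - u' t)" by (intro traj_diff stationary_traj[OF assms(1)] stationary_traj[OF assms(2)])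
  fix y w assume y: "traj T y w" "y 0 = 0"
  have "E T x u y w + Lin z v T y w = 0" "E T x' u' y w + Lin z v T y w = 0"
    using assms y by (auto simp: stationary_def)
  thus "E T (\<lambda>t. x t - x' t) (\<lambda>t. u t - u' t) y w + Lin 0 0 T y w = 0"
    using E_diff_left[OF y(1) stationary_traj[OF assms(1)] stationary_traj[OF assms(2)]] by simp
qed

lemma stationary_scaleR:
  assumes "stationary 0 0 T x u"
  shows "stationary 0 0 T (\<lambda>t. c *\<^sub>R x t) (\<lambda>t. c *\<^sub>R u t)"
  using assms by (simp add: stationary_def traj_scaleR E_scaleR_right E_commute[of T "\<lambda>t. c *\<^sub>R x t"])
    (simp add: E_commute)

lemma stationary_zero: "stationary 0 0 T (\<lambda>_. 0) (\<lambda>_. 0)"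
  by (simp add: stationary_def traj_zero E_def C.zero K.zero)

lemma stationary_spike:
  assumes st: "stationary z v T x u" and N: "negligible N" and eq: "\<And>t. t \<in> {0..T} - N \<Longrightarrow> w t = u t"
  shows "stationary z v T x w"
  unfolding stationary_def
proof (intro conjI allI impI)
  show "traj T x w" using traj_spike[OF stationary_traj[OF st] N eq] .
  fix y w' assume y: "traj T y w'" "y 0 = 0"
  have "E T x w y w' = E T x u y w'" by (rule E_cong[OF N]) (use eq in auto)
  thus "E T x w y w' + Lin z v T y w' = 0" using st y by (simp add: stationary_def)
qed

text \<open>The optimal pairs from \<open>xe + y0\<close> and from \<open>xe\<close> obey the same
  bound, both initial states lying in the translated neighborhood. Their difference starts at
  \<open>y0\<close>; the constant doubles and the rate is unchanged.\<close>

lemma exponential_turnpike_LQ: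
  assumes tp: "exponential_turnpike S B C K z v xe ue"
  shows "exponential_turnpike S B C K 0 0 0 0"
  unfolding exponential_turnpike_def
proof (intro allI impI)
  fix N :: "'h set" assume N: "bounded N \<and> 0 \<in> interior N"
  let ?N = "(+) xe ` N"
  have "bounded ?N" using N by (simp add: bounded_translation)
  moreover have int: "xe \<in> interior ?N"
    using N interior_translation[of xe N] by force
  ultimately obtain M k where Mk: "M > 0" "k > 0" and
    est: "\<And>x0 T. x0 \<in> ?N \<Longrightarrow> T > 0 \<Longrightarrow> \<exists>x u. the_optimal_pair S B C K z v T x0 x u \<and>
             (\<forall>t\<in>{0..T}. norm (x t - xe) + norm (u t - ue) \<le> M * (exp (- k * t) + exp (- k * (T - t))))"
    using tp[unfolded exponential_turnpike_def, rule_format, OF conjI, of ?N] by blast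
  show "\<exists>M>0. \<exists>k>0. \<forall>x0\<in>N. \<forall>T>0. \<exists>x u. the_optimal_pair S B C K 0 0 T x0 x u \<and>
             (\<forall>t\<in>{0..T}. norm (x t - 0) + norm (u t - 0) \<le> M * (exp (- k * t) + exp (- k * (T - t))))"
  proof (rule exI[of _ "2 * M"], rule conjI[rotated], rule exI[of _ k], intro conjI ballI allI impI)
    fix y0 T assume y0: "y0 \<in> N" and T: "(T::real) > 0"
    have xeN: "xe \<in> ?N" using int interior_subset by blast
    obtain x u where x: "the_optimal_pair S B C K z v T (xe + y0) x u"
      "\<And>t. t \<in> {0..T} \<Longrightarrow> norm (x t - xe) + norm (u t - ue) \<le> M * (exp (- k * t) + exp (- k * (T - t)))"
      using est[of "xe + y0" T] y0 T by auto
    obtain x' u' where x': "the_optimal_pair S B C K z v T xe x' u'"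
      "\<And>t. t \<in> {0..T} \<Longrightarrow> norm (x' t - xe) + norm (u' t - ue) \<le> M * (exp (- k * t) + exp (- k * (T - t)))"
      using est[OF xeN T] by auto
    have st: "stationary z v T x u \<and> x 0 = xe + y0" "stationary z v T x' u' \<and> x' 0 = xe"
      using optimal_imp_stationary[OF _ less_imp_le[OF T]] x(1) x'(1) unfolding the_optimal_pair_def by blast+
    show "\<exists>x u. the_optimal_pair S B C K 0 0 T y0 x u \<and>
             (\<forall>t\<in>{0..T}. norm (x t - 0) + norm (u t - 0) \<le> 2 * M * (exp (- k * t) + exp (- k * (T - t))))"
    proof (intro exI conjI ballI)
      show "the_optimal_pair S B C K 0 0 T y0 (\<lambda>t. x t - x' t) (\<lambda>t. u t - u' t)"
        by (rule stationary_imp_the_optimal[OF stationary_diff]) (use st T in auto)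
      fix t assume t: "t \<in> {0..T}"
      have "norm (x t - x' t) \<le> norm (x t - xe) + norm (x' t - xe)"
        "norm (u t - u' t) \<le> norm (u t - ue) + norm (u' t - ue)"
        using dist_triangle2[of "x t" "x' t" xe] dist_triangle2[of "u t" "u' t" ue] by (auto simp: dist_norm)
      thus "norm (x t - x' t - 0) + norm (u t - u' t - 0) \<le> 2 * M * (exp (- k * t) + exp (- k * (T - t)))"
        using x(2)[OF t] x'(2)[OF t] by simp
    qed
  qed (use Mk in auto)
qed

text \<open>Homogeneous optima scale with the initial state, so the estimate on the unit ball alone
  yields constants valid for all states, with a bound proportional to \<open>norm y\<close>.\<close>

lemma exponential_turnpike_LQ_uniform:
  assumes tp: "exponential_turnpike S B C K 0 0 0 0"
  shows "\<exists>M>0. \<exists>k>0. \<forall>y. \<forall>T>0. \<exists>x u. stationary 0 0 T x u \<and> x 0 = y \<and>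
     (\<forall>t\<in>{0..T}. norm (x t) + norm (u t) \<le> M * norm y * (exp (- k * t) + exp (- k * (T - t))))"
proof -
  have "bounded (cball (0::'h) 1)" "(0::'h) \<in> interior (cball 0 1)" by (auto simp: mem_interior intro!: exI[of _ 1])
  hence "\<exists>M>0. \<exists>k>0. \<forall>x0\<in>cball 0 1. \<forall>T>0. \<exists>x u. the_optimal_pair S B C K 0 0 T x0 x u \<and>
             (\<forall>t\<in>{0..T}. norm (x t - 0) + norm (u t - 0) \<le> M * (exp (- k * t) + exp (- k * (T - t))))"
    using tp unfolding exponential_turnpike_def by (elim allE[of _ "cball 0 1"] impE) (rule conjI)
  then obtain M k where Mk: "M > 0" "k > 0" and
    est: "\<And>x0 T. norm x0 \<le> 1 \<Longrightarrow> T > 0 \<Longrightarrow> \<exists>x u. the_optimal_pair S B C K 0 0 T x0 x u \<and>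
             (\<forall>t\<in>{0..T}. norm (x t) + norm (u t) \<le> M * (exp (- k * t) + exp (- k * (T - t))))"
    unfolding diff_zero Ball_def mem_cball_0 by blast
  have "\<exists>x u. stationary 0 0 T x u \<and> x 0 = y \<and>
     (\<forall>t\<in>{0..T}. norm (x t) + norm (u t) \<le> M * norm y * (exp (- k * t) + exp (- k * (T - t))))" if T: "T > 0" for y T
  proof (cases "y = 0")
    case True
    thus ?thesis using stationary_zero by (intro exI[of _ "\<lambda>_. 0"]) auto
  next
    case False
    obtain x u where x: "the_optimal_pair S B C K 0 0 T (y /\<^sub>R norm y) x u"
      "\<And>t. t \<in> {0..T} \<Longrightarrow> norm (x t) + norm (u t) \<le> M * (exp (- k * t) + exp (- k * (T - t)))"
      using est[of "y /\<^sub>R norm y" T] T False by auto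
    have st: "stationary 0 0 T x u \<and> x 0 = y /\<^sub>R norm y"
      using optimal_imp_stationary[OF _ less_imp_le[OF T]] x(1) unfolding the_optimal_pair_def by blast
    show ?thesis
    proof (intro exI conjI ballI)
      show "stationary 0 0 T (\<lambda>t. norm y *\<^sub>R x t) (\<lambda>t. norm y *\<^sub>R u t)" using st by (intro stationary_scaleR) auto
      show "norm y *\<^sub>R x 0 = y" using st False by simp
      fix t assume t: "t \<in> {0..T}"
      have "norm (norm y *\<^sub>R x t) + norm (norm y *\<^sub>R u t) = norm y * (norm (x t) + norm (u t))"
        by (simp add: distrib_left)
      also have "\<dots> \<le> norm y * (M * (exp (- k * t) + exp (- k * (T - t))))"
        by (intro mult_left_mono x(2) t) auto
      finally show "norm (norm y *\<^sub>R x t) + norm (norm y *\<^sub>R u t) \<le> M * norm y * (exp (- k * t) + exp (- k * (T - t)))"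
        by (simp add: mult_ac)
    qed
  qed
  with Mk show ?thesis by blast
qed

lemma E_concat:
  assumes a: "traj T a b" and x: "traj s x u" and y: "traj (T - s) y w" and j: "y 0 = x s" and s: "0 \<le> s" "s \<le> T"
  shows "E T a b (concat_control s x y) (concat_control s u w) =
    E s a b x u + E (T - s) (\<lambda>t. a (s + t)) (\<lambda>t. b (s + t)) y w"
proof -
  have "E s a b (concat_control s x y) (concat_control s u w) = E s a b x u"
    by (rule E_cong[of "{s}"]) (auto simp: concat_control_def)
  moreover have "E (T - s) (\<lambda>t. a (s + t)) (\<lambda>t. b (s + t)) (\<lambda>t. concat_control s x y (s + t)) (\<lambda>t. concat_control s u w (s + t))
     = E (T - s) (\<lambda>t. a (s + t)) (\<lambda>t. b (s + t)) y w"
    by (rule E_cong[of "{}"]) (auto simp: concat_control_def)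
  ultimately show ?thesis using E_split[OF a traj_concat[OF x y j s] s] by simp
qed

lemma E_zero_right [simp]: "E T x u (\<lambda>_. 0) (\<lambda>_. 0) = 0"
  by (simp add: E_def C.zero K.zero)

text \<open>Variational equation for the homogeneous running cost with the terminal term
  \<open>- 2 * l (x T)\<close> added.\<close>

definition terminal_stationary :: "('h \<Rightarrow> real) \<Rightarrow> real \<Rightarrow> (real \<Rightarrow> 'h) \<Rightarrow> (real \<Rightarrow> 'u) \<Rightarrow> bool" where
  "terminal_stationary l T x u \<longleftrightarrow> traj T x u \<and> (\<forall>y w. traj T y w \<longrightarrow> y 0 = 0 \<longrightarrow> E T x u y w = l (y T))"

lemma stationary_iff_terminal: "stationary 0 0 T x u \<longleftrightarrow> terminal_stationary (\<lambda>_. 0) T x u"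
  by (simp add: stationary_def terminal_stationary_def)

lemma terminal_stationary_traj: "terminal_stationary l T x u \<Longrightarrow> traj T x u"
  by (simp add: terminal_stationary_def)

lemma concat_control_end: "s \<le> T \<Longrightarrow> concat_control s x y T = y (T - s)"
  by (simp add: concat_control_def)

text \<open>Bellman's principle: a test trajectory of the tail vanishes at its start, so it can be
  preceded by zero and tested over the whole horizon.\<close>

lemma terminal_stationary_shift:
  assumes x: "terminal_stationary l T x u" and s: "0 \<le> s" "s \<le> T"
  shows "terminal_stationary l (T - s) (\<lambda>t. x (s + t)) (\<lambda>t. u (s + t))"
  unfolding terminal_stationary_def
proof (intro conjI allI impI)
  have tr: "traj T x u" using x by (rule terminal_stationary_traj)
  show "traj (T - s) (\<lambda>t. x (s + t)) (\<lambda>t. u (s + t))" using tr s by (rule traj_shift)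
  fix y w assume y: "traj (T - s) y w" "y 0 = 0"
  have "traj T (concat_control s (\<lambda>_. 0) y) (concat_control s (\<lambda>_. 0) w)"
    by (rule traj_concat[OF traj_zero y(1) y(2) s])
  moreover have "concat_control s (\<lambda>_. 0) y 0 = 0" using y(2) s by (auto simp: concat_control_def)
  ultimately have "E T x u (concat_control s (\<lambda>_. 0) y) (concat_control s (\<lambda>_. 0) w) = l (y (T - s))"
    using x s by (simp add: terminal_stationary_def concat_control_end)
  thus "E (T - s) (\<lambda>t. x (s + t)) (\<lambda>t. u (s + t)) y w = l (y (T - s))"
    using E_concat[OF tr traj_zero y(1) y(2) s] by simp
qed

lemma stationary_shift:
  "stationary 0 0 T x u \<Longrightarrow> 0 \<le> s \<Longrightarrow> s \<le> T \<Longrightarrow> stationary 0 0 (T - s) (\<lambda>t. x (s + t)) (\<lambda>t. u (s + t))"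
  unfolding stationary_iff_terminal by (rule terminal_stationary_shift)

text \<open>Pairing with a homogeneous optimum sees only the initial state of the other factor. This
  permits exchanging an uncontrolled trajectory for a well estimated one from the same
  state.\<close>

lemma stationary_E:
  assumes st: "stationary 0 0 T x u" and y: "traj T y w" "traj T y' w'" "y 0 = y' 0"
  shows "E T x u y w = E T x u y' w'"
proof -
  have "E T x u (\<lambda>t. y t - y' t) (\<lambda>t. w t - w' t) = 0"
    using st traj_diff[OF y(1,2)] y(3) by (simp add: stationary_def)
  thus ?thesis using E_diff_right[OF stationary_traj[OF st] y(1,2)] by simp
qed

end

section \<open>Contraction, energy bounds and detectability from the homogeneous turnpike\<close>

locale stable_lq_system = lq_system S B C K m
  for S :: "real \<Rightarrow> 'h::chilbert_space \<Rightarrow> 'h" and B :: "'u::chilbert_space \<Rightarrow> 'h"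
    and C :: "'h \<Rightarrow> 'y::chilbert_space" and K :: "'u \<Rightarrow> 'u" and m +
  fixes M k :: real
  assumes M_pos: "M > 0" and k_pos: "k > 0"
    and LQ_turnpike: "T > 0 \<Longrightarrow> \<exists>x u. stationary 0 0 T x u \<and> x 0 = y \<and>
     (\<forall>t\<in>{0..T}. norm (x t) + norm (u t) \<le> M * norm y * (exp (- k * t) + exp (- k * (T - t))))"
begin

text \<open>States of stationary pairs with equal initial state coincide at every time, so the bound
  known for one pair carries over; controls coincide only almost everywhere, hence the restriction
  to the state.\<close>

lemma stationary_bound:
  assumes st: "stationary 0 0 T x u" and t: "t \<in> {0..T}" and T: "T > 0"
  shows "norm (x t) \<le> M * norm (x 0) * (exp (- k * t) + exp (- k * (T - t)))"
proof -
  obtain x' u' where x': "stationary 0 0 T x' u'" "x' 0 = x 0"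
     "\<And>t. t \<in> {0..T} \<Longrightarrow> norm (x' t) + norm (u' t) \<le> M * norm (x 0) * (exp (- k * t) + exp (- k * (T - t)))"
    using LQ_turnpike[OF T, of "x 0"] by blast
  have "x t = x' t" using stationary_unique(2)[OF x'(1) st x'(2) t] .
  thus ?thesis using x'(3)[OF t] norm_ge_zero[of "u' t"] by (metis add_increasing2 order_trans order_refl)
qed

text \<open>Each half of the horizon contributes a factor \<open>2 * M\<close>; the maximum with 1
  covers the horizon 0.\<close>

definition decay_const :: real where "decay_const = max 1 (4 * M\<^sup>2)"

lemma decay_const_ge_1: "decay_const \<ge> 1" by (simp add: decay_const_def)

text \<open>Restarting at the midpoint makes both boundary layers small.\<close>

lemma stationary_terminal_decay:
  assumes st: "stationary 0 0 T x u" and T: "T \<ge> 0"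
  shows "norm (x T) \<le> decay_const * exp (- (k / 2) * T) * norm (x 0)"
proof (cases "T = 0")
  case True
  thus ?thesis using decay_const_ge_1 mult_right_mono[OF decay_const_ge_1 norm_ge_zero[of "x 0"]] by simp
next
  case False
  hence T: "T > 0" using T by simp
  have "norm (x (T/2)) \<le> M * norm (x 0) * (exp (- k * (T/2)) + exp (- k * (T - T/2)))"
    using T by (intro stationary_bound[OF st]) auto
  hence 1: "norm (x (T/2)) \<le> 2 * M * norm (x 0) * exp (- (k / 2) * T)"
    by simp
  have "norm (x (T/2 + (T - T/2))) \<le> M * norm (x (T/2 + 0)) * (exp (- k * (T - T/2)) + exp (- k * ((T - T/2) - (T - T/2))))"
    using T by (intro stationary_bound[OF stationary_shift[OF st]]) auto
  also have "\<dots> \<le> M * norm (x (T/2 + 0)) * (1 + 1)"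
    using T M_pos k_pos by (intro mult_left_mono add_mono) auto
  finally have "norm (x T) \<le> 2 * M * norm (x (T/2))" by simp
  also have "\<dots> \<le> 2 * M * (2 * M * norm (x 0) * exp (- (k / 2) * T))"
    using 1 M_pos by (intro mult_left_mono) auto
  also have "\<dots> = (4 * M\<^sup>2) * (exp (- (k / 2) * T) * norm (x 0))"
    by (simp add: power2_eq_square)
  also have "\<dots> \<le> decay_const * (exp (- (k / 2) * T) * norm (x 0))"
    by (intro mult_right_mono) (auto simp: decay_const_def)
  finally show ?thesis by (simp add: mult_ac)
qed

text \<open>The squares of the two exponential boundary layers together have integral at most
  \<open>1 / k\<close> over any horizon, which makes the energy bound independent of
  \<open>T\<close>.\<close>

lemma stationary_E_uniform_bound:
  "\<exists>c\<ge>0. \<forall>T\<ge>0. \<forall>x u. stationary 0 0 T x u \<longrightarrow> E T x u x u \<le> c * (norm (x 0))\<^sup>2"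
proof -
  obtain k1 where k1: "k1 \<ge> 0" "\<And>x. norm (C x) \<le> norm x * k1" using C.nonneg_bounded by blast
  obtain k2 where k2: "k2 \<ge> 0" "\<And>x. norm (K x) \<le> norm x * k2" using K.nonneg_bounded by blast
  define c where "c = (k1\<^sup>2 + k2\<^sup>2) * M\<^sup>2 * 2 * (1 / k)"
  have "E T x u x u \<le> c * (norm (x 0))\<^sup>2" if T: "T \<ge> 0" and st: "stationary 0 0 T x u" for T x u
  proof (cases "T = 0")
    case True
    thus ?thesis using k_pos by (simp add: E_def c_def)
  next
    case False
    hence T: "T > 0" using T by simp
    obtain x' u' where x': "stationary 0 0 T x' u'" "x' 0 = x 0"
       "\<And>t. t \<in> {0..T} \<Longrightarrow> norm (x' t) + norm (u' t) \<le> M * norm (x 0) * (exp (- k * t) + exp (- k * (T - t)))"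
      using LQ_turnpike[OF T, of "x 0"] by blast
    note tr = stationary_traj[OF st] stationary_traj[OF x'(1)]
    define g where "g t = exp (- (2 * k) * t) + exp (- (2 * k) * (T - t))" for t
    have gi: "(g has_integral (((- exp (- (2 * k) * T) + exp (- (2 * k) * (T - T))) / (2 * k)) - ((- exp (- (2 * k) * 0) + exp (- (2 * k) * (T - 0))) / (2 * k)))) {0..T}"
    proof (rule fundamental_theorem_of_calculus)
      show "((\<lambda>t. (- exp (- (2 * k) * t) + exp (- (2 * k) * (T - t))) / (2 * k)) has_vector_derivative g t) (at t within {0..T})" for t
        unfolding has_real_derivative_iff_has_vector_derivative[symmetric] g_def
        using k_pos by (auto intro!: derivative_eq_intros simp: field_simps)
    qed (use T in auto)
    have gI: "integral {0..T} g \<le> 1 / k"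
      unfolding integral_unique[OF gi] using k_pos by (simp add: field_simps)
    let ?A = "(k1\<^sup>2 + k2\<^sup>2) * (M * norm (x 0))\<^sup>2 * 2"
    \<comment> \<open>The pair is exchanged for \<open>(x', u')\<close>, whose control obeys the
      bound at every time, by replacing one argument of the form after the other.\<close>
    have "E T x u x u = E T x u x' u'" using stationary_E[OF st tr] x'(2) by simp
    also have "\<dots> = E T x' u' x u" by (rule E_commute)
    also have "\<dots> = E T x' u' x' u'" using stationary_E[OF x'(1) tr] x'(2) by simp
    also have "\<dots> \<le> integral {0..T} (\<lambda>t. ?A * g t)"
      unfolding E_square
    proof (rule integral_le)
      show "(\<lambda>t. (norm (C (x' t)))\<^sup>2 + (norm (K (u' t)))\<^sup>2) integrable_on {0..T}"
        using E_integrable[OF tr(2) tr(2)] by (simp add: power2_norm_eq_inner)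
      show "(\<lambda>t. ?A * g t) integrable_on {0..T}"
        using gi by (intro integrable_on_mult_right) blast
      fix t assume t: "t \<in> {0..T}"
      define b where "b = M * norm (x 0) * (exp (- k * t) + exp (- k * (T - t)))"
      have b: "norm (x' t) \<le> b" "norm (u' t) \<le> b" "b \<ge> 0"
        using x'(3)[OF t] norm_ge_zero[of "u' t"] norm_ge_zero[of "x' t"] unfolding b_def by linarith+
      have "norm (C (x' t)) \<le> b * k1" "norm (K (u' t)) \<le> b * k2"
        using b k1 k2 by (meson mult_right_mono order_trans)+
      hence "(norm (C (x' t)))\<^sup>2 \<le> (b * k1)\<^sup>2" "(norm (K (u' t)))\<^sup>2 \<le> (b * k2)\<^sup>2"
        by (auto intro: power_mono)
      hence "(norm (C (x' t)))\<^sup>2 + (norm (K (u' t)))\<^sup>2 \<le> (k1\<^sup>2 + k2\<^sup>2) * b\<^sup>2"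
        by (simp add: power_mult_distrib algebra_simps)
      also have "b\<^sup>2 \<le> (M * norm (x 0))\<^sup>2 * (2 * g t)"
      proof -
        have "(exp (- k * t) + exp (- k * (T - t)))\<^sup>2 \<le> 2 * (exp (- k * t))\<^sup>2 + 2 * (exp (- k * (T - t)))\<^sup>2"
          using sum_squares_bound[of "exp (- k * t)" "exp (- k * (T - t))"] by (simp add: power2_sum)
        also have "\<dots> = 2 * g t" by (simp add: g_def exp_double[symmetric] mult.assoc)
        finally show ?thesis unfolding b_def power_mult_distrib[of "M * norm (x 0)"]
          by (intro mult_left_mono) auto
      qed
      finally show "(norm (C (x' t)))\<^sup>2 + (norm (K (u' t)))\<^sup>2 \<le> ?A * g t"
        by (simp add: mult_left_mono mult.assoc)
    qed
    also have "\<dots> = ?A * integral {0..T} g" by simp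
    also have "\<dots> \<le> ?A * (1 / k)" using gI by (intro mult_left_mono) auto
    also have "\<dots> = c * (norm (x 0))\<^sup>2" by (simp add: c_def power_mult_distrib)
    finally show ?thesis .
  qed
  thus ?thesis using k_pos by (intro exI[of _ c]) (auto simp: c_def)
qed

text \<open>By the variational equation, the difference to the optimum from the same initial state
  is orthogonal to that optimum. Its energy is therefore at most that of \<open>(y, w)\<close>, and
  as it starts at 0 it is responsible only for the second term.\<close>

lemma window_estimate:
  "\<exists>T>0. \<exists>c\<ge>0. (\<forall>x u. stationary 0 0 T x u \<longrightarrow> norm (x T) \<le> norm (x 0) / 2) \<and>
    (\<forall>y w. traj T y w \<longrightarrow> norm (y T) \<le> norm (y 0) / 2 + c * sqrt (E T y w y w))"
proof -
  \<comment> \<open>Chosen so that the decay factor at the end of the window is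
    \<open>1 / 4\<close>, below the required \<open>1 / 2\<close>.\<close>
  define T where "T = (2 / k) * ln (4 * decay_const)"
  have "decay_const * exp (- (k / 2) * T) = decay_const * exp (- ln (4 * decay_const))" using k_pos by (simp add: T_def)
  also have "\<dots> < 1/2" using decay_const_ge_1 by (simp add: exp_minus field_simps)
  finally have T: "decay_const * exp (- (k / 2) * T) < 1/2" "T > 0" using decay_const_ge_1 k_pos by (auto simp: T_def)
  obtain c where c: "c \<ge> 1" "\<And>x u t. traj T x u \<Longrightarrow> t \<in> {0..T} \<Longrightarrow> norm (x t) \<le> c * (norm (x 0) + sqrt (sqnorm T u))"
    using traj_bound[of T] by blast
  have half: "norm (x T) \<le> norm (x 0) / 2" if "stationary 0 0 T x u" for x u
    using stationary_terminal_decay[OF that] T mult_right_mono[of "decay_const * exp (- (k / 2) * T)" "1/2" "norm (x 0)"] by simp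
  have "norm (y T) \<le> norm (y 0) / 2 + (c / sqrt m) * sqrt (E T y w y w)" if y: "traj T y w" for y w
  proof -
    obtain x u where st: "stationary 0 0 T x u" "x 0 = y 0" using stationary_exists[of T 0 0 "y 0"] T by auto
    note x = stationary_traj[OF st(1)]
    let ?d = "\<lambda>t. y t - x t" and ?e = "\<lambda>t. w t - u t"
    have d: "traj T ?d ?e" by (intro traj_diff x y)
    have "E T x u ?d ?e = 0" using st d by (simp add: stationary_def)
    hence "E T y w y w = E T x u x u + E T ?d ?e ?d ?e"
      using E_add_square[OF x d] by simp
    hence "sqnorm T ?e \<le> E T y w y w / m"
      using sqnorm_le_E[OF d] E_nonneg[OF x] m_pos by (simp add: field_simps)
    hence "sqrt (sqnorm T ?e) \<le> sqrt (E T y w y w) / sqrt m"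
      by (metis real_sqrt_divide real_sqrt_le_mono)
    moreover have "norm (?d T) \<le> c * (norm (?d 0) + sqrt (sqnorm T ?e))"
      using c(2)[OF d, of T] T by simp
    moreover have "norm (?d 0) = 0" using st by simp
    ultimately have "norm (?d T) \<le> c * (sqrt (E T y w y w) / sqrt m)"
      using c(1) by (smt (verit) mult_left_mono)
    moreover have "norm (y T) \<le> norm (x T) + norm (?d T)" using norm_triangle_sub[of "y T" "x T"] by simp
    ultimately show ?thesis using half[OF st(1)] st(2) by simp
  qed
  moreover have "c / sqrt m \<ge> 0" using c m_pos by simp
  ultimately show ?thesis using half T by blast
qed

text \<open>Windows are peeled off at the right end. If the state at the start of the last window is
  at most \<open>b\<close> times the root of the energy, it is at most \<open>b / 2 + c\<close>
  times it at the end, and \<open>b = 2 * c\<close> is preserved; hence the constant does not grow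
  with \<open>s\<close>.\<close>

lemma detectability:
  "\<exists>c\<ge>0. \<forall>s\<ge>0. \<forall>y w. traj s y w \<longrightarrow> y 0 = 0 \<longrightarrow> norm (y s) \<le> c * sqrt (E s y w y w)"
proof -
  obtain T c1 where T: "T > 0" "c1 \<ge> 0"
    "\<And>y w. traj T y w \<Longrightarrow> norm (y T) \<le> norm (y 0) / 2 + c1 * sqrt (E T y w y w)"
    using window_estimate by blast
  obtain c0 where c0: "c0 \<ge> 1" "\<And>s x u t. s \<le> T \<Longrightarrow> traj s x u \<Longrightarrow> t \<in> {0..s} \<Longrightarrow> norm (x t) \<le> c0 * (norm (x 0) + sqrt (sqnorm s u))"
    using traj_bound_uniform[of T] by blast
  define c where "c = max c1 (c0 / sqrt m)"
  have c: "c \<ge> 0" "c1 \<le> c" "c0 / sqrt m \<le> c" using T(2) by (auto simp: c_def)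
  have *: "0 \<le> s \<Longrightarrow> s \<le> real n * T \<Longrightarrow> traj s y w \<Longrightarrow> y 0 = 0 \<Longrightarrow> norm (y s) \<le> 2 * c * sqrt (E s y w y w)" for n s y w
  proof (induction n arbitrary: s)
    case 0
    thus ?case using c E_nonneg[of s y w] by simp
  next
    case (Suc n)
    show ?case
    \<comment> \<open>What remains at the left is a possibly incomplete window, where the plain
      trajectory bound from the zero state is enough.\<close>
    proof (cases "s \<le> T")
      case True
      have "sqrt (sqnorm s w) \<le> sqrt (E s y w y w) / sqrt m"
        using sqnorm_le_E[OF Suc.prems(3)] by (metis real_sqrt_divide real_sqrt_le_mono)
      hence "c0 * sqrt (sqnorm s w) \<le> c0 * (sqrt (E s y w y w) / sqrt m)"
        using c0(1) by (intro mult_left_mono) auto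
      hence "norm (y s) \<le> c0 * (sqrt (E s y w y w) / sqrt m)"
        using c0(2)[OF True Suc.prems(3), of s] Suc.prems by simp
      also have "\<dots> = (c0 / sqrt m) * sqrt (E s y w y w)" by simp
      also have "\<dots> \<le> 2 * c * sqrt (E s y w y w)"
        using c E_nonneg[OF Suc.prems(3)] by (intro mult_right_mono) auto
      finally show ?thesis .
    next
      case False
      let ?r = "s - T"
      have r: "0 \<le> ?r" "?r \<le> s" using False T by auto
      have y1: "traj ?r y w" using traj_subinterval[OF Suc.prems(3)] T by simp
      have y2: "traj T (\<lambda>t. y (?r + t)) (\<lambda>t. w (?r + t))" using traj_shift[OF Suc.prems(3) r] by simp
      let ?E2 = "E T (\<lambda>t. y (?r + t)) (\<lambda>t. w (?r + t)) (\<lambda>t. y (?r + t)) (\<lambda>t. w (?r + t))"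
      have sp: "E s y w y w = E ?r y w y w + ?E2"
        using E_split[OF Suc.prems(3) Suc.prems(3) r] by simp
      have "norm (y ?r) \<le> 2 * c * sqrt (E ?r y w y w)"
        using Suc.prems by (intro Suc.IH y1 r) (auto simp: algebra_simps)
      also have "\<dots> \<le> 2 * c * sqrt (E s y w y w)"
        using sp E_nonneg[OF y2] c by (intro mult_left_mono) auto
      finally have "norm (y ?r) \<le> 2 * c * sqrt (E s y w y w)" .
      moreover have "c1 * sqrt ?E2 \<le> c * sqrt (E s y w y w)"
        using sp E_nonneg[OF y1] E_nonneg[OF y2] c T by (intro mult_mono) auto
      ultimately show ?thesis using T(3)[OF y2] by simp
    qed
  qed
  have "norm (y s) \<le> (2 * c) * sqrt (E s y w y w)" if "0 \<le> s" "traj s y w" "y 0 = 0" for s y w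
  proof -
    obtain n where "s \<le> real n * T" using reals_Archimedean3[OF T(1)] less_imp_le by blast
    from *[OF that(1) this that(2,3)] show ?thesis .
  qed
  thus ?thesis using c by (intro exI[of _ "2 * c"]) auto
qed

end

section \<open>Problems with a linear terminal cost\<close>

context stable_lq_system
begin

lemma concat_control_0: "0 \<le> s \<Longrightarrow> y 0 = x s \<Longrightarrow> concat_control s x y 0 = x 0"
  by (cases "s = 0") (auto simp: concat_control_def)

text \<open>The continuation by a homogeneous optimum makes the terminal term exponentially small.
  In the second summand the tail of \<open>x\<close> is paired with an optimum, so it may be
  exchanged for any other trajectory from \<open>x s\<close>.\<close>

lemma terminal_stationary_test:
  assumes x: "terminal_stationary l T x u" and s: "0 \<le> s" "s \<le> T"
    and y: "traj s y w" "y 0 = 0" and p: "stationary 0 0 (T - s) p q" "p 0 = y s"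
  shows "E s x u y w + E (T - s) p q (\<lambda>t. x (s + t)) (\<lambda>t. u (s + t)) = l (p (T - s))"
proof -
  note tp = stationary_traj[OF p(1)]
  have "traj T (concat_control s y p) (concat_control s w q)"
    by (rule traj_concat[OF y(1) tp p(2) s])
  moreover have "concat_control s y p 0 = 0" using concat_control_0[of s p y] p(2) y(2) s by simp
  ultimately have "E T x u (concat_control s y p) (concat_control s w q) = l (p (T - s))"
    using x s by (simp add: terminal_stationary_def concat_control_end)
  thus ?thesis
    using E_concat[OF terminal_stationary_traj[OF x] y(1) tp p(2) s] by (simp add: E_commute)
qed

lemma exp_window:
  assumes "r \<le> 1"
  shows "exp (- (k / 2) * (T - r)) \<le> exp (k / 2) * exp (- (k / 2) * T)"
  unfolding exp_add[symmetric] exp_le_cancel_iff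
  using mult_left_mono[OF assms, of "k / 2"] k_pos by (simp add: right_diff_distrib)

text \<open>The energy up to \<open>s\<close> is bounded by the terminal term, that is, up to
  constants, by the decay factor of the continuation times \<open>norm (x s)\<close>. Detectability
  bounds the latter by the root of the same energy, so one root cancels.\<close>

lemma terminal_stationary_state_decay:
  assumes l: "bounded_linear l"
  shows "\<exists>c\<ge>0. \<forall>T x u s. terminal_stationary l T x u \<longrightarrow> x 0 = 0 \<longrightarrow> 0 \<le> s \<longrightarrow> s \<le> T \<longrightarrow>
    norm (x s) \<le> c * exp (- (k / 2) * (T - s))"
proof -
  obtain L where L: "L \<ge> 0" "\<And>h. norm (l h) \<le> norm h * L" using bounded_linear.nonneg_bounded[OF l] by blast
  obtain c where c: "c \<ge> 0" "\<And>s y w. s \<ge> 0 \<Longrightarrow> traj s y w \<Longrightarrow> y 0 = 0 \<Longrightarrow> norm (y s) \<le> c * sqrt (E s y w y w)"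
    using detectability by blast
  have "norm (x s) \<le> (L * decay_const * c\<^sup>2) * exp (- (k / 2) * (T - s))"
    if x: "terminal_stationary l T x u" "x 0 = 0" and s: "0 \<le> s" "s \<le> T" for T x u s
  proof -
    note tr = terminal_stationary_traj[OF x(1)]
    have trs: "traj s x u" using traj_subinterval[OF tr s(2)] .
    obtain p q where p: "stationary 0 0 (T - s) p q" "p 0 = x s"
      using stationary_exists[of "T - s" 0 0 "x s"] s by auto
    note tp = stationary_traj[OF p(1)]
    define e where "e = exp (- (k / 2) * (T - s))"
    define r where "r = sqrt (E s x u x u)"
    have r: "r \<ge> 0" "r * r = E s x u x u" using E_nonneg[OF trs] by (auto simp: r_def)
    have "E (T - s) p q (\<lambda>t. x (s + t)) (\<lambda>t. u (s + t)) = E (T - s) p q p q"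
      by (rule stationary_E[OF p(1) traj_shift[OF tr s] tp]) (simp add: p)
    hence "E s x u x u \<le> l (p (T - s))"
      using terminal_stationary_test[OF x(1) s trs x(2) p] E_nonneg[OF tp] by simp
    also have "\<dots> \<le> norm (p (T - s)) * L" using L(2)[of "p (T - s)"] by simp
    also have "\<dots> \<le> (decay_const * e * norm (x s)) * L"
      using stationary_terminal_decay[OF p(1)] s p(2) L(1) by (intro mult_right_mono) (auto simp: e_def)
    also have "\<dots> \<le> (decay_const * e * (c * r)) * L"
      using c(2)[OF s(1) trs x(2)] L(1) decay_const_ge_1 by (intro mult_right_mono mult_left_mono) (auto simp: e_def r_def)
    finally have "r * r \<le> (L * decay_const * e * c) * r" using r by (simp add: mult_ac)
    moreover have "0 \<le> L * decay_const * e * c" using L decay_const_ge_1 c by (simp add: e_def)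
    ultimately have "r \<le> L * decay_const * e * c" using r(1) by (cases "r = 0") auto
    hence "c * r \<le> c * (L * decay_const * e * c)" using c(1) by (rule mult_left_mono)
    thus ?thesis using c(2)[OF s(1) trs x(2)] by (simp add: r_def e_def power2_eq_square mult_ac)
  qed
  moreover have "L * decay_const * c\<^sup>2 \<ge> 0" using L decay_const_ge_1 by simp
  ultimately show ?thesis by blast
qed

text \<open>The test control is the optimal one cut off to the set where it exceeds the claimed bound.\<close>

lemma terminal_stationary_initial_control_bound:
  assumes l: "bounded_linear l" and c2: "c2 \<ge> 0"
  shows "\<exists>c\<ge>0. \<forall>T x u. T \<ge> 0 \<longrightarrow> terminal_stationary l T x u \<longrightarrow>
    (\<forall>t\<in>{0..min 1 T}. norm (x t) \<le> c2 * exp (- (k / 2) * T)) \<longrightarrow>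
    (\<exists>N. negligible N \<and> (\<forall>t\<in>{0..min 1 T} - N. norm (u t) \<le> c * exp (- (k / 2) * T)))"
proof -
  obtain L where L: "L \<ge> 0" "\<And>h. norm (l h) \<le> norm h * L" using bounded_linear.nonneg_bounded[OF l] by blast
  obtain c1 where c1: "c1 \<ge> 1" "\<And>s x u t. s \<le> 1 \<Longrightarrow> traj s x u \<Longrightarrow> t \<in> {0..s} \<Longrightarrow> norm (x t) \<le> c1 * (norm (x 0) + integral {0..t} (\<lambda>r. norm (u r)))"
    using traj_bound_L1[of 1] by blast
  obtain cE where cE: "cE \<ge> 0" "\<And>T x u. T \<ge> 0 \<Longrightarrow> stationary 0 0 T x u \<Longrightarrow> E T x u x u \<le> cE * (norm (x 0))\<^sup>2"
    using stationary_E_uniform_bound by blast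
  obtain k1 where k1: "k1 \<ge> 0" "\<And>x. norm (C x) \<le> norm x * k1" using C.nonneg_bounded by blast
  \<comment> \<open>The three summands bound, relative to \<open>a * h\<close>, the contribution of
    the states on the window, the pairing of the tails, and the terminal term.\<close>
  define c3 where "c3 = k1\<^sup>2 * c2 * c1 + cE * c1 * c2 + L * decay_const * exp (k / 2) * c1"
  have c3: "c3 \<ge> 0" using k1 c2 c1 cE L decay_const_ge_1 by (simp add: c3_def)
  \<comment> \<open>Exceeding \<open>c3 / m\<close> by \<open>1 / m\<close> makes the final
    comparison \<open>(c3 + 1) * (a * h) \<le> c3 * (a * h)\<close> force
    \<open>h = 0\<close>.\<close>
  define c where "c = (c3 + 1) / m"
  have c: "c \<ge> 0" "m * c = c3 + 1" using c3 m_pos by (auto simp: c_def)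
  have bound: "\<exists>N. negligible N \<and> (\<forall>t\<in>{0..min 1 T} - N. norm (u t) \<le> c * exp (- (k / 2) * T))"
    if T: "T \<ge> 0" and x: "terminal_stationary l T x u"
    and xb: "\<And>t. t \<in> {0..min 1 T} \<Longrightarrow> norm (x t) \<le> c2 * exp (- (k / 2) * T)" for T x u
  proof -
    define r where "r = min 1 T"
    have r: "0 \<le> r" "r \<le> T" "r \<le> 1" using T by (auto simp: r_def)
    define a where "a = exp (- (k / 2) * T)"
    have a: "a > 0" by (simp add: a_def)
    note tr = terminal_stationary_traj[OF x]
    note trr = traj_subinterval[OF tr r(2)]
    define w where "w t = (if norm (u t) \<le> c * a then 0 else u t)" for t
    have um: "u measurable_on {0..r}" using traj_L2[OF trr] by (simp add: L2_def)
    have "(\<lambda>t. u t - (if norm (u t) \<le> c * a then u t else 0)) measurable_on {0..r}"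
      by (intro measurable_on_diff um measurable_on_if_less measurable_on_norm)
    moreover have "(\<lambda>t. u t - (if norm (u t) \<le> c * a then u t else 0)) = w" by (auto simp: w_def)
    ultimately have wm: "w measurable_on {0..r}" by metis
    have wL: "L2 r w"
      by (rule L2_dominated[OF wm L2_square_integrable[OF traj_L2[OF trr]]]) (auto simp: w_def)
    define y where "y = mild 0 w"
    have y: "traj r y w" "y 0 = 0" unfolding y_def by (simp_all add: traj_mild[OF wL])
    \<comment> \<open>The test is measured by \<open>h\<close> because the lower bound for the
      control term and the three error terms are all linear in it.\<close>
    define h where "h = integral {0..r} (\<lambda>t. norm (w t))"
    have wi: "(\<lambda>t. norm (w t)) integrable_on {0..r}" by (rule L2_norm_integrable[OF wL])
    have h: "h \<ge> 0" unfolding h_def using wi by (intro integral_nonneg) auto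
    have yb: "norm (y t) \<le> c1 * h" if t: "t \<in> {0..r}" for t
    proof -
      have "integral {0..t} (\<lambda>r. norm (w r)) \<le> h"
        unfolding h_def using t wi integrable_subinterval_real[OF wi] by (intro integral_subset_le) auto
      hence "c1 * integral {0..t} (\<lambda>r. norm (w r)) \<le> c1 * h" using c1 by (intro mult_left_mono) auto
      thus ?thesis using c1(2)[OF r(3) y(1) t] y(2) by simp
    qed
    obtain p q where p: "stationary 0 0 (T - r) p q" "p 0 = y r"
      using stationary_exists[of "T - r" 0 0 "y r"] r by auto
    obtain p' q' where p': "stationary 0 0 (T - r) p' q'" "p' 0 = x r"
      using stationary_exists[of "T - r" 0 0 "x r"] r by auto
    note tp = stationary_traj[OF p(1)] and tp' = stationary_traj[OF p'(1)]
    have main: "E r x u y w + E (T - r) p q (\<lambda>t. x (r + t)) (\<lambda>t. u (r + t)) = l (p (T - r))"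
      by (rule terminal_stationary_test[OF x r(1,2) y p])
    have rb: "norm (y r) \<le> c1 * h" "norm (x r) \<le> c2 * a" using yb[of r] xb[of r] r by (auto simp: a_def r_def)
    \<comment> \<open>The tail of \<open>x\<close> has no small energy known in advance. As
      \<open>(p, q)\<close> is stationary, the tail may be replaced by the homogeneous optimum from
      \<open>x r\<close>, whose energy is at most a constant times the square of
      \<open>norm (x r)\<close>.\<close>
    have second: "\<bar>E (T - r) p q (\<lambda>t. x (r + t)) (\<lambda>t. u (r + t))\<bar> \<le> cE * c1 * c2 * (a * h)"
    proof -
      have "E (T - r) p q (\<lambda>t. x (r + t)) (\<lambda>t. u (r + t)) = E (T - r) p q p' q'"
        by (rule stationary_E[OF p(1) traj_shift[OF tr r(1,2)] tp']) (simp add: p')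
      moreover have "\<bar>E (T - r) p q p' q'\<bar> \<le> cE * (norm (y r) * norm (x r))"
      proof (rule power2_le_imp_le)
        have "\<bar>E (T - r) p q p' q'\<bar>\<^sup>2 \<le> E (T - r) p q p q * E (T - r) p' q' p' q'"
          using E_Cauchy_Schwarz[OF tp tp'] by simp
        also have "\<dots> \<le> (cE * (norm (y r))\<^sup>2) * (cE * (norm (x r))\<^sup>2)"
          using cE(2)[OF _ p(1)] cE(2)[OF _ p'(1)] p(2) p'(2) r E_nonneg[OF tp'] cE(1) by (intro mult_mono) auto
        also have "\<dots> = (cE * (norm (y r) * norm (x r)))\<^sup>2" by (simp add: power_mult_distrib power2_eq_square)
        finally show "\<bar>E (T - r) p q p' q'\<bar>\<^sup>2 \<le> (cE * (norm (y r) * norm (x r)))\<^sup>2" .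
      qed (use cE in simp)
      moreover have "cE * (norm (y r) * norm (x r)) \<le> cE * ((c1 * h) * (c2 * a))"
        using rb cE c1 h by (intro mult_left_mono mult_mono) auto
      ultimately show ?thesis by (simp add: mult_ac)
    qed
    have third: "l (p (T - r)) \<le> L * decay_const * exp (k / 2) * c1 * (a * h)"
    proof -
      have "l (p (T - r)) \<le> norm (p (T - r)) * L" using L(2)[of "p (T - r)"] by simp
      also have "\<dots> \<le> (decay_const * exp (- (k / 2) * (T - r)) * norm (y r)) * L"
        using stationary_terminal_decay[OF p(1)] r p(2) L(1) by (intro mult_right_mono) auto
      also have "\<dots> \<le> (decay_const * (exp (k / 2) * a) * (c1 * h)) * L"
      proof (intro mult_right_mono[OF _ L(1)] mult_mono rb mult_left_mono)
        show "exp (- (k / 2) * (T - r)) \<le> exp (k / 2) * a"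
          unfolding a_def by (rule exp_window[OF r(3)])
      qed (use decay_const_ge_1 a in auto)
      finally show ?thesis by (simp add: mult_ac)
    qed
    have iC: "(\<lambda>t. inner (C (x t)) (C (y t))) integrable_on {0..r}"
      using L2_inner_integrable[OF traj_L2_C[OF trr] traj_L2_C[OF y(1)]] .
    have iK: "(\<lambda>t. inner (K (u t)) (K (w t))) integrable_on {0..r}"
      using L2_inner_integrable[OF traj_L2_K[OF trr] traj_L2_K[OF y(1)]] .
    have first: "E r x u y w = integral {0..r} (\<lambda>t. inner (C (x t)) (C (y t))) + integral {0..r} (\<lambda>t. inner (K (u t)) (K (w t)))"
      unfolding E_def by (rule integral_add[OF iC iK])
    have CC: "\<bar>integral {0..r} (\<lambda>t. inner (C (x t)) (C (y t)))\<bar> \<le> k1\<^sup>2 * c2 * c1 * (a * h)"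
    proof -
      have "norm (integral {0..r} (\<lambda>t. inner (C (x t)) (C (y t)))) \<le> integral {0..r} (\<lambda>t. (c2 * a * k1) * (c1 * h * k1))"
      proof (rule integral_norm_bound_integral[OF iC])
        fix t assume t: "t \<in> {0..r}"
        have "norm (C (x t)) \<le> c2 * a * k1"
          using xb[of t] t k1 by (intro order_trans[OF k1(2)] mult_right_mono) (auto simp: r_def a_def)
        moreover have "norm (C (y t)) \<le> c1 * h * k1"
          using yb[OF t] k1 by (intro order_trans[OF k1(2)] mult_right_mono) auto
        ultimately have "norm (C (x t)) * norm (C (y t)) \<le> (c2 * a * k1) * (c1 * h * k1)"
          using c2 a k1 by (intro mult_mono) auto
        thus "norm (inner (C (x t)) (C (y t))) \<le> (c2 * a * k1) * (c1 * h * k1)"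
          using Cauchy_Schwarz_ineq2[of "C (x t)" "C (y t)"] by simp
      qed auto
      also have "\<dots> = r * ((c2 * a * k1) * (c1 * h * k1))" using r by simp
      also have "\<dots> \<le> 1 * ((c2 * a * k1) * (c1 * h * k1))"
        using r c2 a k1 c1 h by (intro mult_right_mono) auto
      finally show ?thesis by (simp add: mult_ac power2_eq_square)
    qed
    have Kuw: "inner (K (u t)) (K (w t)) \<ge> m * (norm (w t))\<^sup>2" for t
      using K_coercive[of "u t"] by (auto simp: w_def K.zero power2_norm_eq_inner)
    have i2: "(\<lambda>t. m * (norm (w t))\<^sup>2) integrable_on {0..r}"
      by (intro integrable_on_mult_right L2_square_integrable wL)
    \<comment> \<open>Wherever \<open>w\<close> is nonzero its norm exceeds \<open>c * a\<close>, so
      its squared norm dominates \<open>c * a\<close> times its norm.\<close>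
    have "m * (c * a * norm (w t)) \<le> m * (norm (w t))\<^sup>2" for t
      using m_pos by (intro mult_left_mono) (auto simp: w_def power2_eq_square intro!: mult_right_mono)
    hence "integral {0..r} (\<lambda>t. (m * c * a) * norm (w t)) \<le> integral {0..r} (\<lambda>t. m * (norm (w t))\<^sup>2)"
      by (intro integral_le[OF integrable_on_mult_right[OF wi] i2]) (simp add: mult.assoc)
    hence up: "(m * c * a) * h \<le> m * sqnorm r w" by (simp add: h_def sqnorm_def)
    have "integral {0..r} (\<lambda>t. m * (norm (w t))\<^sup>2) \<le> integral {0..r} (\<lambda>t. inner (K (u t)) (K (w t)))"
      using Kuw by (intro integral_le i2 iK) auto
    hence "m * sqnorm r w \<le> integral {0..r} (\<lambda>t. inner (K (u t)) (K (w t)))" by (simp add: sqnorm_def)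
    also have "\<dots> \<le> c3 * (a * h)"
      using main first CC second third unfolding c3_def distrib_right by linarith
    finally have low: "m * sqnorm r w \<le> c3 * (a * h)" .
    with up have "(c3 + 1) * (a * h) \<le> c3 * (a * h)" using c(2) by (simp add: mult.assoc)
    hence "a * h \<le> 0" by (simp add: distrib_right)
    hence "h = 0" using a h by (simp add: mult_le_0_iff)
    hence "sqnorm r w = 0" using low m_pos sqnorm_nonneg[of r w] by (simp add: mult_le_0_iff antisym)
    from sqnorm_zero_AE[OF wL this] obtain N where N: "negligible N" "\<And>t. t \<in> {0..r} - N \<Longrightarrow> w t = 0"
      by (rule AE_lebesgue_on_obtain_negligible) auto
    have "norm (u t) \<le> c * a" if "t \<in> {0..r} - N" for t
    proof (rule ccontr)
      assume "\<not> norm (u t) \<le> c * a"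
      hence "u t = 0" using N(2)[OF that] by (simp add: w_def)
      thus False using \<open>\<not> norm (u t) \<le> c * a\<close> c a by simp
    qed
    with N(1) show ?thesis unfolding r_def a_def by blast
  qed
  show ?thesis
  proof (intro exI[of _ c] conjI allI impI)
    fix T x u assume "0 \<le> T" "terminal_stationary l T x u"
      "\<forall>t\<in>{0..min 1 T}. norm (x t) \<le> c2 * exp (- (k / 2) * T)"
    thus "\<exists>N. negligible N \<and> (\<forall>t\<in>{0..min 1 T} - N. norm (u t) \<le> c * exp (- (k / 2) * T))"
      by (intro bound) auto
  qed (fact c(1))
qed

text \<open>The control bound covers the first unit of time; applied to the problem shifted by each
  natural number \<open>j \<le> T\<close> it covers the whole horizon, and the countably many null
  sets are united.\<close>

lemma terminal_stationary_decay:
  assumes l: "bounded_linear l"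
  shows "\<exists>c\<ge>0. \<forall>T x u. T \<ge> 0 \<longrightarrow> terminal_stationary l T x u \<longrightarrow> x 0 = 0 \<longrightarrow>
    (\<exists>N. negligible N \<and> (\<forall>t\<in>{0..T} - N. norm (u t) \<le> c * exp (- (k / 2) * (T - t)))) \<and>
    (\<forall>t\<in>{0..T}. norm (x t) \<le> c * exp (- (k / 2) * (T - t)))"
proof -
  obtain c1 where c1: "c1 \<ge> 0" "\<And>T x u s. terminal_stationary l T x u \<Longrightarrow> x 0 = 0 \<Longrightarrow> 0 \<le> s \<Longrightarrow> s \<le> T \<Longrightarrow>
    norm (x s) \<le> c1 * exp (- (k / 2) * (T - s))"
    using terminal_stationary_state_decay[OF l] by blast
  \<comment> \<open>The factor \<open>exp (k / 2)\<close> pays for expressing the state bound at all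
    times of a unit window by the decay at its left end.\<close>
  have "c1 * exp (k / 2) \<ge> 0" using c1 by simp
  from terminal_stationary_initial_control_bound[OF l this]
  obtain c2 where c2: "c2 \<ge> 0" "\<And>T x u. T \<ge> 0 \<Longrightarrow> terminal_stationary l T x u \<Longrightarrow>
    (\<forall>t\<in>{0..min 1 T}. norm (x t) \<le> (c1 * exp (k / 2)) * exp (- (k / 2) * T)) \<Longrightarrow>
    (\<exists>N. negligible N \<and> (\<forall>t\<in>{0..min 1 T} - N. norm (u t) \<le> c2 * exp (- (k / 2) * T)))" by blast
  define c where "c = max c1 c2"
  have c: "c1 \<le> c" "c2 \<le> c" "c \<ge> 0" using c1 by (auto simp: c_def)
  have "(\<exists>N. negligible N \<and> (\<forall>t\<in>{0..T} - N. norm (u t) \<le> c * exp (- (k / 2) * (T - t)))) \<and>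
    (\<forall>t\<in>{0..T}. norm (x t) \<le> c * exp (- (k / 2) * (T - t)))"
    if T: "T \<ge> 0" and x: "terminal_stationary l T x u" "x 0 = 0" for T x u
  proof
    have "\<exists>N. negligible N \<and> (\<forall>t\<in>{0..min 1 (T - real j)} - N. norm (u (real j + t)) \<le> c2 * exp (- (k / 2) * (T - real j)))"
      if j: "real j \<le> T" for j :: nat
    proof (rule c2(2)[of _ "\<lambda>t. x (real j + t)"])
      show "terminal_stationary l (T - real j) (\<lambda>t. x (real j + t)) (\<lambda>t. u (real j + t))"
        by (rule terminal_stationary_shift[OF x(1) _ j]) simp
      show "\<forall>t\<in>{0..min 1 (T - real j)}. norm (x (real j + t)) \<le> (c1 * exp (k / 2)) * exp (- (k / 2) * (T - real j))"
      proof
        fix t assume t: "t \<in> {0..min 1 (T - real j)}"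
        have "norm (x (real j + t)) \<le> c1 * exp (- (k / 2) * (T - (real j + t)))"
          using c1(2)[OF x, of "real j + t"] t by auto
        also have "\<dots> \<le> c1 * (exp (k / 2) * exp (- (k / 2) * (T - real j)))"
          using c1(1) t exp_window[of t "T - real j"] by (intro mult_left_mono) (auto simp: diff_diff_eq)
        finally show "norm (x (real j + t)) \<le> (c1 * exp (k / 2)) * exp (- (k / 2) * (T - real j))"
          by (simp add: mult.assoc)
      qed
    qed (use j in simp)
    then obtain N where N: "\<And>j. real j \<le> T \<Longrightarrow> negligible (N j)"
      "\<And>j t. real j \<le> T \<Longrightarrow> t \<in> {0..min 1 (T - real j)} - N j \<Longrightarrow> norm (u (real j + t)) \<le> c2 * exp (- (k / 2) * (T - real j))"
      by metis
    define N' where "N' = (\<Union>j\<in>{j. real j \<le> T}. (+) (real j) ` N j)"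
    have "countable {j::nat. real j \<le> T}" by simp
    hence "negligible N'"
      unfolding N'_def by (intro negligible_countable_Union countable_image) (auto intro: negligible_translation N)
    moreover have "norm (u t) \<le> c * exp (- (k / 2) * (T - t))" if t: "t \<in> {0..T} - N'" for t
    proof -
      define j where "j = nat \<lfloor>t\<rfloor>"
      have j: "real j \<le> t" "t - real j \<le> 1" using t by (auto simp: j_def) linarith
      hence jT: "real j \<le> T" using t by auto
      have "t - real j \<notin> N j"
      proof
        assume "t - real j \<in> N j"
        hence "real j + (t - real j) \<in> N'" unfolding N'_def using jT by blast
        thus False using t by simp
      qed
      hence "norm (u (real j + (t - real j))) \<le> c2 * exp (- (k / 2) * (T - real j))"
        using j t by (intro N(2) jT) auto
      also have "\<dots> \<le> c * exp (- (k / 2) * (T - t))"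
        using j k_pos c by (intro mult_mono) auto
      finally show ?thesis by simp
    qed
    ultimately show "\<exists>N. negligible N \<and> (\<forall>t\<in>{0..T} - N. norm (u t) \<le> c * exp (- (k / 2) * (T - t)))" by blast
    show "\<forall>t\<in>{0..T}. norm (x t) \<le> c * exp (- (k / 2) * (T - t))"
    proof
      fix t assume "t \<in> {0..T}"
      hence "norm (x t) \<le> c1 * exp (- (k / 2) * (T - t))" using c1(2)[OF x, of t] by auto
      also have "\<dots> \<le> c * exp (- (k / 2) * (T - t))" using c by (intro mult_right_mono) auto
      finally show "norm (x t) \<le> c * exp (- (k / 2) * (T - t))" .
    qed
  qed
  with c(3) show ?thesis by blast
qed

end

section \<open>The optimal steady state and the turnpike\<close>

context lq_system
begin

text \<open>The integrated form of \<open>A x + B u = h\<close>, closed under limits and free of a domain condition on \<open>x\<close>.\<close>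

definition balanced :: "'h \<Rightarrow> 'h \<Rightarrow> 'u \<Rightarrow> bool" where
  "balanced h x u \<longleftrightarrow> (\<forall>t\<ge>0. S t x - x = S_int t (h - B u))"

lemma S_int_linear: "0 \<le> t \<Longrightarrow> linear (S_int t)"
  by (rule bounded_linear.linear[OF S_int_bounded_linear])

lemma balanced_diff:
  assumes "balanced h x u" "balanced h' x' u'"
  shows "balanced (h - h') (x - x') (u - u')"
  unfolding balanced_def
proof (intro allI impI)
  fix t :: real assume t: "t \<ge> 0"
  have "S t (x - x') - (x - x') = (S t x - x) - (S t x' - x')" using S_diff[OF t] by simp
  also have "\<dots> = S_int t (h - B u) - S_int t (h' - B u')" using assms t by (simp add: balanced_def)
  also have "\<dots> = S_int t ((h - B u) - (h' - B u'))" by (rule linear_diff[OF S_int_linear[OF t], symmetric])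
  also have "(h - B u) - (h' - B u') = h - h' - B (u - u')" by (simp add: B.diff)
  finally show "S t (x - x') - (x - x') = S_int t (h - h' - B (u - u'))" .
qed

lemma balanced_scaleR:
  assumes "balanced h x u"
  shows "balanced (c *\<^sub>R h) (c *\<^sub>R x) (c *\<^sub>R u)"
  unfolding balanced_def
proof (intro allI impI)
  fix t :: real assume t: "t \<ge> 0"
  have "S t (c *\<^sub>R x) - c *\<^sub>R x = c *\<^sub>R (S t x - x)" using S_scaleR[OF t] by (simp add: scaleR_diff_right)
  also have "\<dots> = c *\<^sub>R S_int t (h - B u)" using assms t by (simp add: balanced_def)
  also have "\<dots> = S_int t (c *\<^sub>R (h - B u))" by (rule linear_scale[OF S_int_linear[OF t], symmetric])
  also have "c *\<^sub>R (h - B u) = c *\<^sub>R h - B (c *\<^sub>R u)" by (simp add: B.scaleR scaleR_diff_right)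
  finally show "S t (c *\<^sub>R x) - c *\<^sub>R x = S_int t (c *\<^sub>R h - B (c *\<^sub>R u))" .
qed

lemma balanced_zero: "balanced 0 0 0"
  by (simp add: balanced_def B.zero linear_0[OF S_int_linear])

lemma balanced_add:
  assumes "balanced h x u" "balanced h' x' u'"
  shows "balanced (h + h') (x + x') (u + u')"
  using balanced_diff[OF assms(1) balanced_scaleR[OF assms(2), of "-1"]] by simp

lemma traj_steady:
  assumes "balanced 0 x u"
  shows "traj T (\<lambda>_. x) (\<lambda>_. u)"
proof (rule trajI)
  show "L2 T (\<lambda>_. u)" by (intro L2_continuous continuous_intros)
  fix t :: real assume t: "0 \<le> t"
  have "S t x - x = - S_int t (B u)"
    using assms t linear_neg[OF S_int_linear[OF t]] by (simp add: balanced_def)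
  thus "x = mild x (\<lambda>_. u) t" using t by (simp add: mild_eq conv_const algebra_simps)
qed

lemma traj_integral_balanced:
  assumes tr: "traj T x u" and T: "0 \<le> T"
  shows "balanced (x T - x 0) (integral {0..T} x) (integral {0..T} u)"
  unfolding balanced_def
proof (intro allI impI)
  fix t :: real assume t: "t \<ge> 0"
  let ?y = "\<lambda>t. S t (x 0) + conv t (\<lambda>s. B (u s))"
  have y: "?y t = x t" if "t \<in> {0..T}" for t
    using trajD[OF tr, of t] that by (simp add: mild_eq)
  have "integral {0..T} ?y = integral {0..T} x" by (intro integral_cong y)
  moreover have "integral {0..T} (\<lambda>s. B (u s)) = B (integral {0..T} u)"
    using integral_linear[OF L1_integrable[OF L2_imp_L1[OF traj_L2[OF tr]] order_refl] B] by (simp add: o_def)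
  moreover have "?y T = x T" using y T by simp
  ultimately show "S t (integral {0..T} x) - integral {0..T} x = S_int t (x T - x 0 - B (integral {0..T} u))"
    using integrated_equation[OF L1_B[OF traj_L2[OF tr]] T t, of "x 0"] by simp
qed

text \<open>The difference quotient of the orbit of \<open>x\<close> is
  \<open>S_int t (- B u)\<close> divided by \<open>t\<close>, which converges to
  \<open>- B u\<close>; membership in \<open>D\<close> thus comes out as a conclusion.\<close>

lemma steady_state_balanced:
  assumes gen: "generates D A S" and bal: "balanced 0 x u"
  shows "steady_state D A B x u"
proof -
  have "((\<lambda>t. (S t x - x) /\<^sub>R t) \<longlongrightarrow> - B u) (at_right 0)"
  proof (rule tendstoI)
    fix e :: real assume e: "e > 0"
    have e2: "e / 2 > 0" using e by simp
    obtain d where d: "d > 0" "\<And>h. h \<in> {0..d} \<Longrightarrow> norm (S_int h (- B u) - h *\<^sub>R (- B u)) \<le> h * (e/2)"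
      using S_int_near[OF e2, of "- B u"] by blast
    have "dist ((S t x - x) /\<^sub>R t) (- B u) < e" if t: "0 < t" "t < d" for t
    proof -
      have "(S t x - x) /\<^sub>R t - (- B u) = (S_int t (- B u) - t *\<^sub>R (- B u)) /\<^sub>R t"
        using bal t by (simp add: balanced_def scaleR_add_right)
      hence "norm ((S t x - x) /\<^sub>R t - (- B u)) = norm (S_int t (- B u) - t *\<^sub>R (- B u)) / t"
        using t by (simp only: norm_scaleR) (simp add: divide_inverse mult.commute)
      also have "\<dots> \<le> t * (e / 2) / t" using d(2)[of t] t by (intro divide_right_mono) auto
      also have "\<dots> < e" using t e by simp
      finally show ?thesis by (simp add: dist_norm)
    qed
    thus "\<forall>\<^sub>F t in at_right 0. dist ((S t x - x) /\<^sub>R t) (- B u) < e"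
      unfolding eventually_at_right_field using d(1) by blast
  qed
  moreover from this have "x \<in> D" using gen by (auto simp: generates_def)
  hence "((\<lambda>t. (S t x - x) /\<^sub>R t) \<longlongrightarrow> A x) (at_right 0)" using gen by (auto simp: generates_def)
  ultimately have "A x = - B u" using tendsto_unique[OF trivial_limit_at_right_real] by blast
  with \<open>x \<in> D\<close> show ?thesis by (simp add: steady_state_def)
qed

lemma integral_inner_linear:
  fixes f :: "real \<Rightarrow> 'a::banach" and F :: "'a \<Rightarrow> 'b::real_inner"
  assumes "f integrable_on {0..T}" "bounded_linear F"
  shows "integral {0..T} (\<lambda>t. inner g (F (f t))) = inner g (F (integral {0..T} f))"
    "(\<lambda>t. inner g (F (f t))) integrable_on {0..T}"
proof -
  have bl: "bounded_linear (\<lambda>x. inner g (F x))"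
    by (rule bounded_linear_compose[OF bounded_linear_inner_right assms(2)])
  show "integral {0..T} (\<lambda>t. inner g (F (f t))) = inner g (F (integral {0..T} f))"
    using integral_linear[OF assms(1) bl] by (simp add: o_def)
  show "(\<lambda>t. inner g (F (f t))) integrable_on {0..T}"
    using integrable_linear[OF assms(1) bl] by (simp add: o_def)
qed

lemma traj_integrable:
  assumes "traj T x u"
  shows "x integrable_on {0..T}" "u integrable_on {0..T}"
  using integrable_continuous_real[OF traj_continuous[OF assms]] L1_integrable[OF L2_imp_L1[OF traj_L2[OF assms]] order_refl]
  by auto

text \<open>Against a constant pair, the first variation depends only on the time integrals of the
  test pair: this is the bridge from the dynamic to the static problem.\<close>

lemma integral_static:
  assumes "traj T y w"
  shows "E T (\<lambda>_. xe) (\<lambda>_. ue) y w + Lin z v T y w =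
    inner (C xe) (C (integral {0..T} y)) + inner (K ue) (K (integral {0..T} w))
      + inner z (integral {0..T} y) + inner v (integral {0..T} w)"
proof -
  note i = traj_integrable[OF assms]
  note a = integral_inner_linear[OF i(1) C, of "C xe"] integral_inner_linear[OF i(2) K, of "K ue"]
    integral_inner_linear[OF i(1) bounded_linear_ident, of z] integral_inner_linear[OF i(2) bounded_linear_ident, of v]
  show ?thesis unfolding E_def Lin_def
    by (subst integral_add[OF a(2,4)], subst integral_add[OF a(6,8)]) (simp only: a add.assoc)
qed

end

section \<open>Solvability of the static equation, the optimal steady state and the generalized
  turnpike\<close>

context stable_lq_system
begin

text \<open>The time integral of a trajectory solves the equation with the increment of the state as
  right-hand side, so a trajectory with prescribed increment \<open>h\<close> is sought. It is taken
  among the homogeneous optima on the contracting window.\<close>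

lemma balanced_surjective: "\<exists>c\<ge>0. \<forall>h. \<exists>x u. balanced h x u \<and> norm x + norm u \<le> c * norm h"
proof -
  obtain T where T: "T > 0" and half: "\<And>x u. stationary 0 0 T x u \<Longrightarrow> norm (x T) \<le> norm (x 0) / 2"
    using window_estimate by blast
  have "\<forall>y. \<exists>x u. stationary 0 0 T x u \<and> x 0 = y" using stationary_exists T by auto
  then obtain X U where XU: "\<And>y. stationary 0 0 T (X y) (U y)" "\<And>y. X y 0 = y" by metis
  obtain c1 where c1: "c1 \<ge> 1" "\<And>x u t. traj T x u \<Longrightarrow> t \<in> {0..T} \<Longrightarrow> norm (x t) \<le> c1 * (norm (x 0) + sqrt (sqnorm T u))"
    using traj_bound[of T] by blast
  obtain cE where cE: "cE \<ge> 0" "\<And>x u. stationary 0 0 T x u \<Longrightarrow> E T x u x u \<le> cE * (norm (x 0))\<^sup>2"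
    using stationary_E_uniform_bound T by (metis less_imp_le)
  define b where "b = sqrt (cE / m)"
  have b: "b \<ge> 0" using cE m_pos by (simp add: b_def)
  have sb: "sqrt (sqnorm T (U g)) \<le> b * norm g" for g
  proof -
    have "sqnorm T (U g) \<le> cE / m * (norm g)\<^sup>2"
      using sqnorm_le_E[OF stationary_traj[OF XU(1)]] cE(2)[OF XU(1), of g] XU(2)[of g] m_pos
      by (simp add: field_simps) (meson order_trans)
    hence "sqrt (sqnorm T (U g)) \<le> sqrt (cE / m * (norm g)\<^sup>2)" by (rule real_sqrt_le_mono)
    also have "\<dots> = b * norm g" unfolding b_def real_sqrt_mult by simp
    finally show ?thesis .
  qed
  define c where "c = 2 * (T * (c1 * (1 + b)) + sqrt T * b)"
  have "\<exists>x u. balanced h x u \<and> norm x + norm u \<le> c * norm h" for h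
  proof -
    \<comment> \<open>A fixed point \<open>g\<close> is an initial state whose optimum has increment
      \<open>h\<close>; the map contracts by \<open>1 / 2\<close> because differences of optima are
      optima.\<close>
    have "\<exists>!g. X g T - h = g"
    proof (rule banach_fix_type[of "1/2"], goal_cases)
      case 3
      show ?case
      proof (intro allI)
        fix g g'
        have "norm (X g T - X g' T) \<le> norm (X g 0 - X g' 0) / 2"
          by (rule half[OF stationary_diff[OF XU(1) XU(1)]])
        thus "dist (X g T - h) (X g' T - h) \<le> 1 / 2 * dist g g'" by (simp add: dist_norm XU(2))
      qed
    qed auto
    then obtain g where g: "X g T - h = g" by blast
    have "norm g \<le> norm (X g T) + norm h" using norm_triangle_ineq4[of "X g T" h] g by simp
    also have "\<dots> \<le> norm g / 2 + norm h" using half[OF XU(1), of g] XU(2)[of g] by simp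
    finally have gb: "norm g \<le> 2 * norm h" by simp
    note tr = stationary_traj[OF XU(1), of g]
    have "X g T - X g 0 = h" using g XU(2)[of g] by (metis add_diff_cancel_left' diff_add_cancel)
    hence bal: "balanced h (integral {0..T} (X g)) (integral {0..T} (U g))"
      using traj_integral_balanced[OF tr] T by simp
    have "norm (integral {0..T} (X g)) \<le> integral {0..T} (\<lambda>t. c1 * (1 + b) * norm g)"
    proof (rule integral_norm_bound_integral[OF traj_integrable(1)[OF tr]])
      fix t assume "t \<in> {0..T}"
      hence "norm (X g t) \<le> c1 * (norm g + sqrt (sqnorm T (U g)))" using c1(2)[OF tr] XU(2)[of g] by simp
      also have "\<dots> \<le> c1 * (norm g + b * norm g)" using sb c1(1) by (intro mult_left_mono add_left_mono) auto
      finally show "norm (X g t) \<le> c1 * (1 + b) * norm g" by (simp add: algebra_simps)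
    qed auto
    also have "\<dots> = T * (c1 * (1 + b)) * norm g" using T by simp
    finally have 1: "norm (integral {0..T} (X g)) \<le> T * (c1 * (1 + b)) * norm g" .
    have "norm (integral {0..T} (U g)) \<le> integral {0..T} (\<lambda>t. norm (U g t))"
      by (rule integral_norm_bound_integral[OF traj_integrable(2)[OF tr] L2_norm_integrable[OF traj_L2[OF tr]]]) simp
    also have "\<dots> \<le> sqrt T * sqrt (sqnorm T (U g))"
      using integral_norm_le_L2[OF traj_L2[OF tr]] T by (simp add: sqnorm_def)
    also have "\<dots> \<le> sqrt T * (b * norm g)" using sb T by (intro mult_left_mono) auto
    finally have 2: "norm (integral {0..T} (U g)) \<le> sqrt T * b * norm g" by simp
    have "norm (integral {0..T} (X g)) + norm (integral {0..T} (U g)) \<le> (T * (c1 * (1 + b)) + sqrt T * b) * norm g"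
      using 1 2 by (simp add: distrib_right)
    also have "\<dots> \<le> (T * (c1 * (1 + b)) + sqrt T * b) * (2 * norm h)"
      using gb T c1 b by (intro mult_left_mono) auto
    also have "\<dots> = c * norm h" by (simp add: c_def)
    finally show ?thesis using bal by blast
  qed
  moreover have "c \<ge> 0" using T c1 b by (simp add: c_def)
  ultimately show ?thesis by blast
qed

text \<open>A steady pair is a constant trajectory, so in the window estimate half of
  \<open>norm x\<close> is absorbed on the left, and the energy is the window length times the
  static quadratic cost.\<close>

lemma steady_coercive:
  "\<exists>c>0. \<forall>x u. balanced 0 x u \<longrightarrow> c * ((norm x)\<^sup>2 + (norm u)\<^sup>2) \<le> (norm (C x))\<^sup>2 + (norm (K u))\<^sup>2"
proof -
  obtain T c where T: "T > 0" "c \<ge> 0"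
    "\<And>y w. traj T y w \<Longrightarrow> norm (y T) \<le> norm (y 0) / 2 + c * sqrt (E T y w y w)"
    using window_estimate by blast
  define a where "a = 4 * c\<^sup>2 * T + 1 / m"
  have a: "a > 0" using T m_pos by (simp add: a_def add_nonneg_pos)
  have "(norm x)\<^sup>2 + (norm u)\<^sup>2 \<le> a * ((norm (C x))\<^sup>2 + (norm (K u))\<^sup>2)" if bal: "balanced 0 x u" for x u
  proof -
    define q where "q = (norm (C x))\<^sup>2 + (norm (K u))\<^sup>2"
    have q: "q \<ge> 0" by (simp add: q_def)
    have "E T (\<lambda>_. x) (\<lambda>_. u) (\<lambda>_. x) (\<lambda>_. u) = T * q" using T by (simp add: E_square q_def)
    hence "norm x \<le> 2 * c * sqrt (T * q)" using T(3)[OF traj_steady[OF bal]] by simp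
    hence "(norm x)\<^sup>2 \<le> (2 * c * sqrt (T * q))\<^sup>2" by (intro power_mono) auto
    also have "\<dots> = 4 * c\<^sup>2 * T * q" using T q by (simp add: power_mult_distrib)
    finally have 1: "(norm x)\<^sup>2 \<le> 4 * c\<^sup>2 * T * q" .
    have "m * (norm u)\<^sup>2 \<le> q" using K_coercive[of u] by (simp add: q_def add_increasing)
    hence "(norm u)\<^sup>2 \<le> 1 / m * q" using m_pos by (simp add: field_simps)
    with 1 show ?thesis by (simp add: a_def q_def[symmetric] distrib_right)
  qed
  thus ?thesis using a by (intro exI[of _ "1 / a"]) (auto simp: field_simps)
qed

text \<open>
  \<open>l\<close> is the Lagrange multiplier of the constraint \<open>A x + B u = 0\<close>. Averages of trajectories solve
  \<open>A x + B u = h\<close> with \<open>h\<close> the increment of the state, so the first variation integrates to a terminal term.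
\<close>

lemma optimal_steady_state:
  "\<exists>xe ue l. balanced 0 xe ue \<and> bounded_linear l \<and>
    (\<forall>T y w. T \<ge> 0 \<longrightarrow> traj T y w \<longrightarrow> y 0 = 0 \<longrightarrow> E T (\<lambda>_. xe) (\<lambda>_. ue) y w + Lin z v T y w = - l (y T))"
proof -
  define Z where "Z = {p. balanced 0 (fst p) (snd p)}"
  define Q where "Q p = (C (fst p), K (snd p))" for p
  define f where "f p = - (inner z (fst p) + inner v (snd p))" for p
  obtain c where c: "c > 0" "\<And>x u. balanced 0 x u \<Longrightarrow> c * ((norm x)\<^sup>2 + (norm u)\<^sup>2) \<le> (norm (C x))\<^sup>2 + (norm (K u))\<^sup>2"
    using steady_coercive by blast
  have "\<exists>p\<in>Z. \<forall>q\<in>Z. inner (Q p) (Q q) = f q"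
  proof (rule coercive_minimizer[of Z Q f c])
    show "subspace Z" unfolding subspace_def Z_def
      using balanced_add[of 0 _ _ 0] balanced_scaleR[of 0] balanced_zero by auto
    show "closed Z"
    proof -
      have "Z = (\<Inter>t\<in>{0..}. {p. S t (fst p) - fst p = S_int t (0 - B (snd p))})"
        by (auto simp: Z_def balanced_def)
      moreover have "closed {p. S t (fst p) - fst p = S_int t (0 - B (snd p))}" if "t \<in> {0..}" for t
        using that
        by (intro closed_Collect_eq continuous_intros bounded_linear.continuous_on[OF S_linear]
            bounded_linear.continuous_on[OF S_int_bounded_linear] bounded_linear.continuous_on[OF B]) auto
      ultimately show ?thesis by auto
    qed
    show "bounded_linear Q" unfolding Q_def
      by (intro bounded_linear_Pair bounded_linear_compose[OF C] bounded_linear_compose[OF K] bounded_linear_fst bounded_linear_snd)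
    show "bounded_linear f" unfolding f_def
      by (intro bounded_linear_minus bounded_linear_add bounded_linear_compose[OF bounded_linear_inner_right] bounded_linear_fst bounded_linear_snd)
    show "c * (norm p)\<^sup>2 \<le> (norm (Q p))\<^sup>2" if "p \<in> Z" for p
      using c(2)[of "fst p" "snd p"] that by (simp add: Z_def Q_def norm_prod_def)
  qed (use c in auto)
  then obtain xe ue where e: "balanced 0 xe ue"
    "\<And>x u. balanced 0 x u \<Longrightarrow> inner (C xe) (C x) + inner (K ue) (K u) = - (inner z x + inner v u)"
    by (auto simp: Z_def Q_def f_def)
  \<comment> \<open>Minus half the first variation of the static cost at \<open>(xe, ue)\<close>. It
    vanishes on steady pairs, so on solutions of \<open>A x + B u = h\<close> it depends on
    \<open>h\<close> alone.\<close>
  define d where "d x u = - (inner (C xe) (C x) + inner (K ue) (K u) + inner z x + inner v u)" for x u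
  have d0: "d x u = 0" if "balanced 0 x u" for x u using e(2)[OF that] by (simp add: d_def)
  have d_diff: "d (x - x') (u - u') = d x u - d x' u'" for x x' u u'
    by (simp add: d_def C.diff K.diff inner_diff_right)
  have d_add: "d (x + x') (u + u') = d x u + d x' u'" for x x' u u'
    by (simp add: d_def C.add K.add inner_add_right)
  have d_scale: "d (r *\<^sub>R x) (r *\<^sub>R u) = r * d x u" for r x u
    by (simp add: d_def C.scaleR K.scaleR algebra_simps)
  \<comment> \<open>The solutions are merely selected for each \<open>h\<close>; linearity of
    \<open>l\<close> comes from its independence of the selection, boundedness from the norm
    bound.\<close>
  obtain b where b: "b \<ge> 0" "\<And>h. \<exists>x u. balanced h x u \<and> norm x + norm u \<le> b * norm h"
    using balanced_surjective by blast
  then obtain X U where XU: "\<And>h. balanced h (X h) (U h)" "\<And>h. norm (X h) + norm (U h) \<le> b * norm h" by metis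
  define l where "l h = d (X h) (U h)" for h
  have l: "d x u = l h" if "balanced h x u" for h x u
    using d0[OF balanced_diff[OF that XU(1)[of h], simplified]] d_diff by (simp add: l_def)
  obtain k1 where k1: "k1 \<ge> 0" "\<And>x. norm (C x) \<le> norm x * k1" using C.nonneg_bounded by blast
  obtain k2 where k2: "k2 \<ge> 0" "\<And>x. norm (K x) \<le> norm x * k2" using K.nonneg_bounded by blast
  define r where "r = norm (C xe) * k1 + norm (K ue) * k2 + norm z + norm v"
  have db: "\<bar>d x u\<bar> \<le> r * (norm x + norm u)" for x u
  proof -
    have "\<bar>inner (C xe) (C x)\<bar> \<le> norm (C xe) * (norm x * k1)" "\<bar>inner (K ue) (K u)\<bar> \<le> norm (K ue) * (norm u * k2)"
      by (intro order_trans[OF Cauchy_Schwarz_ineq2] mult_left_mono k1 k2 norm_ge_zero)+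
    moreover have "\<bar>inner z x\<bar> \<le> norm z * norm x" "\<bar>inner v u\<bar> \<le> norm v * norm u" by (rule Cauchy_Schwarz_ineq2)+
    ultimately have "\<bar>d x u\<bar> \<le> norm (C xe) * (norm x * k1) + norm (K ue) * (norm u * k2) + norm z * norm x + norm v * norm u"
      unfolding d_def by linarith
    also have "\<dots> \<le> (norm (C xe) * k1 * norm x + norm (C xe) * k1 * norm u) + (norm (K ue) * k2 * norm u + norm (K ue) * k2 * norm x)
      + (norm z * norm x + norm z * norm u) + (norm v * norm u + norm v * norm x)"
      using k1(1) k2(1) by (intro add_mono) auto
    also have "\<dots> = r * (norm x + norm u)" by (simp add: r_def algebra_simps)
    finally show ?thesis .
  qed
  have r: "r \<ge> 0" using k1(1) k2(1) by (simp add: r_def)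
  have "bounded_linear l"
  proof (rule bounded_linear_intro[of _ "r * b"])
    show "l (h + h') = l h + l h'" for h h'
      using l[OF balanced_add[OF XU(1)[of h] XU(1)[of h']]] by (simp add: d_add l_def)
    show "l (q *\<^sub>R h) = q *\<^sub>R l h" for q h
      using l[OF balanced_scaleR[OF XU(1)[of h], of q]] by (simp add: d_scale l_def)
    show "norm (l h) \<le> norm h * (r * b)" for h
    proof -
      have "norm (l h) \<le> r * (norm (X h) + norm (U h))" unfolding l_def using db by simp
      also have "\<dots> \<le> r * (b * norm h)" using XU(2) r by (intro mult_left_mono) auto
      finally show ?thesis by (simp add: mult_ac)
    qed
  qed
  moreover have "E T (\<lambda>_. xe) (\<lambda>_. ue) y w + Lin z v T y w = - l (y T)"
    if "T \<ge> 0" "traj T y w" "y 0 = 0" for T y w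
  proof -
    have "balanced (y T) (integral {0..T} y) (integral {0..T} w)"
      using traj_integral_balanced[OF that(2,1)] that(3) by simp
    from l[OF this] show ?thesis unfolding integral_static[OF that(2)] by (simp add: d_def)
  qed
  ultimately show ?thesis using e(1) by blast
qed

lemma GLQ_turnpike:
  "\<exists>xe ue. balanced 0 xe ue \<and> exponential_turnpike S B C K z v xe ue"
proof -
  obtain xe ue l where e: "balanced 0 xe ue" and l: "bounded_linear l" and
    el: "\<And>T y w. T \<ge> 0 \<Longrightarrow> traj T y w \<Longrightarrow> y 0 = 0 \<Longrightarrow> E T (\<lambda>_. xe) (\<lambda>_. ue) y w + Lin z v T y w = - l (y T)"
    using optimal_steady_state[of z v] by blast
  obtain c where c: "c \<ge> 0" and decay: "\<And>T x u. T \<ge> 0 \<Longrightarrow> terminal_stationary l T x u \<Longrightarrow> x 0 = 0 \<Longrightarrow>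
    (\<exists>N. negligible N \<and> (\<forall>t\<in>{0..T} - N. norm (u t) \<le> c * exp (- (k / 2) * (T - t)))) \<and>
    (\<forall>t\<in>{0..T}. norm (x t) \<le> c * exp (- (k / 2) * (T - t)))"
    using terminal_stationary_decay[OF l] by blast
  have "\<exists>M'>0. \<exists>k'>0. \<forall>x0\<in>N. \<forall>T>0. \<exists>x u. the_optimal_pair S B C K z v T x0 x u \<and>
      (\<forall>t\<in>{0..T}. norm (x t - xe) + norm (u t - ue) \<le> M' * (exp (- k' * t) + exp (- k' * (T - t))))"
    if N: "bounded N" for N
  proof -
    obtain a where a: "\<And>x. x \<in> N \<Longrightarrow> norm x \<le> a" using N unfolding bounded_iff by blast
    \<comment> \<open>The first summand covers the homogeneous part for all initial states in
      \<open>N\<close>, \<open>2 * c\<close> covers the state and the control of the correction, and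
      the 1 ensures positivity.\<close>
    define M' where "M' = M * (\<bar>a\<bar> + norm xe) + 2 * c + 1"
    have M': "M' > 0" using M_pos c by (simp add: M'_def add_nonneg_pos)
    have "\<exists>x u. the_optimal_pair S B C K z v T x0 x u \<and>
      (\<forall>t\<in>{0..T}. norm (x t - xe) + norm (u t - ue) \<le> M' * (exp (- (k/2) * t) + exp (- (k/2) * (T - t))))"
      if x0: "x0 \<in> N" and T: "T > 0" for x0 T
    proof -
      obtain x u where x: "stationary z v T x u" "x 0 = x0"
        using stationary_exists[of T z v x0] T by auto
      note tr = stationary_traj[OF x(1)]
      let ?y = "\<lambda>t. x t - xe" and ?w = "\<lambda>t. u t - ue"
      have y: "traj T ?y ?w" by (rule traj_diff[OF tr traj_steady[OF e]])
      \<comment> \<open>The pair supplied by the turnpike is taken because its control, too, is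
        bounded at every time.\<close>
      obtain p q where p: "stationary 0 0 T p q" "p 0 = x0 - xe"
        "\<And>t. t \<in> {0..T} \<Longrightarrow> norm (p t) + norm (q t) \<le> M * norm (x0 - xe) * (exp (- k * t) + exp (- k * (T - t)))"
        using LQ_turnpike[OF T, of "x0 - xe"] by blast
      note tp = stationary_traj[OF p(1)]
      let ?x = "\<lambda>t. ?y t - p t" and ?u = "\<lambda>t. ?w t - q t"
      \<comment> \<open>\<open>Lin\<close> cancels between the variational equation of
        \<open>x\<close> and the identity \<open>el\<close> for the steady state, which leaves
        exactly the terminal functional \<open>l\<close>.\<close>
      have ts: "terminal_stationary l T ?x ?u"
        unfolding terminal_stationary_def
      proof (intro conjI allI impI)
        show "traj T ?x ?u" by (rule traj_diff[OF y tp])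
        fix y' w' assume y': "traj T y' w'" "y' 0 = 0"
        have "E T ?x ?u y' w' = E T x u y' w' - E T (\<lambda>_. xe) (\<lambda>_. ue) y' w' - E T p q y' w'"
          using E_diff_left[OF y'(1) y tp] E_diff_left[OF y'(1) tr traj_steady[OF e]] by simp
        moreover have "E T p q y' w' = 0" "E T x u y' w' = - Lin z v T y' w'"
          using p(1) x(1) y' unfolding stationary_def by (force simp: add_eq_0_iff2)+
        ultimately show "E T ?x ?u y' w' = l (y' T)" using el[OF _ y'] T by simp
      qed
      have "?x 0 = 0" using x(2) p(2) by simp
      from decay[OF less_imp_le[OF T] ts this] obtain N' where N': "negligible N'"
        "\<And>t. t \<in> {0..T} - N' \<Longrightarrow> norm (?u t) \<le> c * exp (- (k / 2) * (T - t))"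
        and xb: "\<And>t. t \<in> {0..T} \<Longrightarrow> norm (?x t) \<le> c * exp (- (k / 2) * (T - t))" by blast
      \<comment> \<open>On the exceptional null set the control is redefined so that its correction
        vanishes there, which gives the bound at every \<open>t\<close> without affecting
        optimality.\<close>
      define u' where "u' t = (if t \<in> N' then ue + q t else u t)" for t
      have ub: "norm (u' t - ue - q t) \<le> c * exp (- (k / 2) * (T - t))" if "t \<in> {0..T}" for t
        using N'(2)[of t] that c by (auto simp: u'_def)
      have "stationary z v T x u'" by (rule stationary_spike[OF x(1) N'(1)]) (simp add: u'_def)
      hence opt: "the_optimal_pair S B C K z v T x0 x u'" using x(2) T by (intro stationary_imp_the_optimal) auto
      have "norm (x t - xe) + norm (u' t - ue) \<le> M' * (exp (- (k/2) * t) + exp (- (k/2) * (T - t)))" if t: "t \<in> {0..T}" for t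
      proof -
        define s where "s = exp (- (k/2) * t) + exp (- (k/2) * (T - t))"
        have s: "exp (- (k / 2) * (T - t)) \<le> s" "s > 0" by (auto simp: s_def add_pos_pos)
        have "exp (- k * t) + exp (- k * (T - t)) \<le> s"
          unfolding s_def using t k_pos by (intro add_mono) auto
        hence "M * norm (x0 - xe) * (exp (- k * t) + exp (- k * (T - t))) \<le> M * (\<bar>a\<bar> + norm xe) * s"
          using a[OF x0] norm_triangle_ineq4[of x0 xe] M_pos by (intro mult_mono) (auto intro!: mult_nonneg_nonneg)
        hence 1: "norm (p t) + norm (q t) \<le> M * (\<bar>a\<bar> + norm xe) * s" using p(3)[OF t] by linarith
        have 2: "norm (?x t) \<le> c * s" "norm (u' t - ue - q t) \<le> c * s"
          using xb[OF t] ub[OF t] mult_left_mono[OF s(1) c] by linarith+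
        have "norm (x t - xe) \<le> norm (p t) + norm (?x t)" "norm (u' t - ue) \<le> norm (q t) + norm (u' t - ue - q t)"
          by (rule norm_triangle_sub)+
        hence "norm (x t - xe) + norm (u' t - ue) \<le> (M * (\<bar>a\<bar> + norm xe) + 2 * c) * s"
          using 1 2 unfolding distrib_right by linarith
        also have "\<dots> \<le> M' * s" using s by (intro mult_right_mono) (auto simp: M'_def)
        finally show ?thesis by (simp add: s_def)
      qed
      with opt show ?thesis by blast
    qed
    moreover have "k / 2 > 0" using k_pos by simp
    ultimately show ?thesis using M' by blast
  qed
  hence "exponential_turnpike S B C K z v xe ue"
    unfolding exponential_turnpike_def by blast
  with e show ?thesis by blast
qed

end

theorem theorem3p10:
  fixes S :: "real \<Rightarrow> 'h::chilbert_space \<Rightarrow> 'h"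
    and D :: "'h set" and A :: "'h \<Rightarrow> 'h"
    and B :: "'u::chilbert_space \<Rightarrow> 'h"
    and C :: "'h \<Rightarrow> 'y::chilbert_space"
    and K :: "'u \<Rightarrow> 'u"
    and z :: 'h and v :: 'u
  assumes "generates D A S"
    and "bounded_clinear B" and "bounded_clinear C" and "bounded_clinear K"
    and "coercive K"
  shows "(\<exists>xe ue. steady_state D A B xe ue \<and> exponential_turnpike S B C K z v xe ue)
         \<longleftrightarrow> exponential_turnpike S B C K 0 0 0 0"
proof -
  obtain m where m: "m > 0" "\<And>u. m * (norm u)\<^sup>2 \<le> (norm (K u))\<^sup>2"
    using coercive_lower_bound[OF assms(4,5)] by blast
  have C0: "C0_semigroup S" using assms(1) by (simp add: generates_def)
  have "lq_system S B C K m"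
  proof (rule lq_system.intro)
    show "c0_semigroup S"
      by (rule c0_semigroup.intro) (use C0 in \<open>simp_all add: C0_semigroup_def bounded_clinear_def\<close>)
    show "lq_system_axioms B C K m"
      by (rule lq_system_axioms.intro) (use assms(2-4) m in \<open>simp_all add: bounded_clinear_def\<close>)
  qed
  then interpret lq_system S B C K m .
  show ?thesis
  proof
    assume "\<exists>xe ue. steady_state D A B xe ue \<and> exponential_turnpike S B C K z v xe ue"
    thus "exponential_turnpike S B C K 0 0 0 0" using exponential_turnpike_LQ by blast
  next
    assume "exponential_turnpike S B C K 0 0 0 0"
    from exponential_turnpike_LQ_uniform[OF this] obtain M k where Mk: "M > 0" "k > 0"
      "\<And>y T. T > 0 \<Longrightarrow> \<exists>x u. stationary 0 0 T x u \<and> x 0 = y \<and>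
        (\<forall>t\<in>{0..T}. norm (x t) + norm (u t) \<le> M * norm y * (exp (- k * t) + exp (- k * (T - t))))" by blast
    interpret stable_lq_system S B C K m M k
      by unfold_locales (use Mk in auto)
    show "\<exists>xe ue. steady_state D A B xe ue \<and> exponential_turnpike S B C K z v xe ue"
      using GLQ_turnpike[of z v] steady_state_balanced[OF assms(1)] by blast
  qed
qed

end
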